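(* There is a randomized online algorithm for prize-collecting node-weighted Steiner forest which is $O(\log k \log n)$-competitive against an oblivious adversary on a graph with $n$ vertices, where $k$ denotes the number of terminal pairs received online.
   Context: Online prize-collecting node-weighted Steiner forest: an undirected graph $G=(V,E)$ with $|V|=n$ and node weights $w\in\mathbb{R}_{\ge 0}^V$ is given beforehand. At each time $i=1,\dots,k$ a pair of terminals $(s_i,t_i)\in V\times V$ and a penalty $p_i\in\mathbb{R}_{\ge0}\cup\{+\infty\}$ arrive. The algorithm must immediately and irrevocably either augment a set $S\subseteq V$ (vertices can never be removed from $S$) so that the induced subgraph $G[S]$ connects $s_i$ and $t_i$, or pay the penalty $p_i$. The cost is $w(S)=\sum_{v\in S}w_v$ plus the sum of paid penalties; the goal is to minimize it. An oblivious adversary knows the algorithm's description but must fix the entire input sequence before the algorithm starts; a randomized algorithm is $\gamma$-competitive against an oblivious adversary if $\mathbb{E}[\mathsf{ALG}(I)]\le\gamma\cdot\mathsf{OPT}(I)$ for every input $I$, where $\mathsf{OPT}(I)$ is the offline optimum cost and the expectation is over the algorithm's randomness. *)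

theory Defs
  imports "HOL-Probability.Probability" "Graph_Theory.Digraph_Component"
begin

text \<open>
  An undirected graph is a symmetric digraph, as in the locale \<^locale>\<open>graph\<close>
  (finite, no loops, no parallel arcs, every arc has its reverse).
\<close>

definition node_weighted_graph :: "('v, 'e) pre_digraph \<Rightarrow> ('v \<Rightarrow> real) \<Rightarrow> bool" where
  "node_weighted_graph G w \<longleftrightarrow> graph G \<and> (\<forall>v\<in>verts G. 0 \<le> w v)"

text \<open>
  A request \<open>(s, t, p)\<close> is a terminal pair with its penalty; \<open>s = t\<close> and \<open>p = \<infinity>\<close> are allowed.
\<close>

type_synonym 'v request = "'v \<times> 'v \<times> ennreal"

definition penalty :: "'v request \<Rightarrow> ennreal" where
  "penalty r = snd (snd r)"

definition valid_requests :: "('v, 'e) pre_digraph \<Rightarrow> 'v request list \<Rightarrow> bool" where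
  "valid_requests G \<sigma> \<longleftrightarrow> set \<sigma> \<subseteq> verts G \<times> verts G \<times> UNIV"

text \<open>
  \<open>G[S]\<close> connects the terminals of the request. Both terminals must then lie in \<open>S\<close>, even if
  they are equal, since \<^const>\<open>reachable\<close> relates only vertices of the graph.
\<close>

definition connects :: "('v, 'e) pre_digraph \<Rightarrow> 'v set \<Rightarrow> 'v request \<Rightarrow> bool" where
  "connects G S r = (case r of (s, t, p) \<Rightarrow> s \<rightarrow>\<^sup>*\<^bsub>G \<restriction> S\<^esub> t)"

definition node_cost :: "('v \<Rightarrow> real) \<Rightarrow> 'v set \<Rightarrow> ennreal" where
  "node_cost w S = ennreal (\<Sum>v\<in>S. w v)"

definition opt :: "('v, 'e) pre_digraph \<Rightarrow> ('v \<Rightarrow> real) \<Rightarrow> 'v request list \<Rightarrow> ennreal" where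
  "opt G w \<sigma> =
     Inf {node_cost w S + (\<Sum>i\<in>P. penalty (\<sigma> ! i)) | S P.
            S \<subseteq> verts G \<and> P \<subseteq> {..<length \<sigma>} \<and> (\<forall>i\<in>{..<length \<sigma>} - P. connects G S (\<sigma> ! i))}"

text \<open>
  A deterministic strategy maps the nonempty list of requests received so far to the response to
  its last element: \<open>None\<close> means that the penalty is paid, \<open>Some X\<close> that the vertices \<open>X\<close> are
  added to the current solution. The number of requests still to come is not an input.
\<close>

type_synonym 'v strategy = "'v request list \<Rightarrow> 'v set option"

definition bought :: "'v strategy \<Rightarrow> 'v request list \<Rightarrow> 'v set" where
  "bought D \<sigma> = (\<Union>i<length \<sigma>. case D (take (Suc i) \<sigma>) of None \<Rightarrow> {} | Some X \<Rightarrow> X)"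

definition paid :: "'v strategy \<Rightarrow> 'v request list \<Rightarrow> ennreal" where
  "paid D \<sigma> =
     (\<Sum>i<length \<sigma>. case D (take (Suc i) \<sigma>) of None \<Rightarrow> penalty (\<sigma> ! i) | Some X \<Rightarrow> 0)"

definition alg_cost :: "('v \<Rightarrow> real) \<Rightarrow> 'v strategy \<Rightarrow> 'v request list \<Rightarrow> ennreal" where
  "alg_cost w D \<sigma> = node_cost w (bought D \<sigma>) + paid D \<sigma>"

definition feasible_strategy :: "('v, 'e) pre_digraph \<Rightarrow> 'v strategy \<Rightarrow> bool" where
  "feasible_strategy G D \<longleftrightarrow>
     (\<forall>\<sigma> X. \<sigma> \<noteq> [] \<and> valid_requests G \<sigma> \<and> D \<sigma> = Some X \<longrightarrow>
        X \<subseteq> verts G \<and> connects G (bought D \<sigma>) (last \<sigma>))"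

text \<open>
  A randomized algorithm draws a seed from a probability space \<open>M\<close> and then, given the weighted
  graph, follows the deterministic strategy determined by the seed.
\<close>

type_synonym ('r, 'v, 'e) online_algorithm =
  "'r \<Rightarrow> ('v, 'e) pre_digraph \<Rightarrow> ('v \<Rightarrow> real) \<Rightarrow> 'v strategy"

definition randomized_online_algorithm ::
    "'r measure \<Rightarrow> ('r, 'v, 'e) online_algorithm \<Rightarrow> bool" where
  "randomized_online_algorithm M A \<longleftrightarrow>
     prob_space M \<and>
     (\<forall>G w. node_weighted_graph G w \<longrightarrow>
        (\<forall>\<omega>\<in>space M. feasible_strategy G (A \<omega> G w)) \<and>
        (\<forall>\<sigma>. \<sigma> \<noteq> [] \<and> valid_requests G \<sigma> \<longrightarrow> (\<lambda>\<omega>. A \<omega> G w \<sigma>) \<in> M \<rightarrow>\<^sub>M count_space UNIV))"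

text \<open>
  Competitiveness against an oblivious adversary: the input is fixed before the seed is drawn.
  The ratio \<open>\<gamma> k n\<close> depends on the number \<open>k\<close> of requests and the number \<open>n\<close> of vertices.
\<close>

definition competitive ::
    "'r measure \<Rightarrow> ('r, 'v, 'e) online_algorithm \<Rightarrow> (nat \<Rightarrow> nat \<Rightarrow> real) \<Rightarrow> bool" where
  "competitive M A \<gamma> \<longleftrightarrow>
     (\<forall>G w \<sigma>. node_weighted_graph G w \<and> valid_requests G \<sigma> \<longrightarrow>
        (\<integral>\<^sup>+ \<omega>. alg_cost w (A \<omega> G w) \<sigma> \<partial>M)
          \<le> ennreal (\<gamma> (length \<sigma>) (card (verts G))) * opt G w \<sigma>)"

end

theory Submission
  imports Defs
begin

text \<open>
  A request at current distance \<open>d\<close> is handled at scale \<open>r = 2 ^ j\<close> with \<open>16 r \<le> d < 32 r\<close> and pays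
  \<open>O(r)\<close> for a connection. If both terminals are close to hubs of scale \<open>j\<close>, these hubs are not yet
  connected to each other, so there are fewer such merges than hubs. Otherwise some terminal \<open>x\<close> is far
  from all hubs; the new hub is a sampled vertex on the rim of the ball of radius \<open>r\<close> around \<open>x\<close> (a
  vertex of weight at least \<open>r\<close> reached by a path of weight at most \<open>r\<close>), if there is one, and this is
  charged geometrically to the weight of that vertex, or \<open>x\<close> itself. In the latter case the weights of
  the rim vertices are raised multiplicatively and one of them is sampled with probabilities equal to
  the increments, so that the expected weight of sampled vertices is at most the sum of the radii of
  these events.

  The radii of the events are compared with an offline solution. If it skips the request, sampling
  the decision with probability penalty / gap bounds the expected radius by the penalty. If it
  contains a rim vertex \<open>v\<close>, the weight of \<open>v\<close> grows, which happens for a total radius of at most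
  \<open>O(w v log k log n)\<close>. Otherwise it contains a light piece around \<open>x\<close> of weight between \<open>r\<close> and \<open>2 r\<close>;
  these pieces are disjoint at each of the \<open>O(log k)\<close> relevant scales. The update is omitted when the
  total weight of the rim exceeds \<open>2 log i\<close> although none of its vertices has been sampled. The rim is
  a ball of the original metric, hence fixed in advance, so a supermartingale bounds the probability of
  this by \<open>1 / i\<^sup>2\<close>, even though the run itself depends on the earlier samples.
\<close>

section \<open>Markov chains driven by seeds\<close>

text \<open>The factor log n is the logarithm of the growth of a weight from 1 / n to a constant;
  the factor log k is the reciprocal step size \<open>limit i + 2\<close>. The step size depends on
  the index \<open>i\<close> because the strategy does not know k; the failure probabilities 1 / (i
  + 2)^2 are still summable. The scale and the terminal of an event depend on the run. Hence the
  failure bound is summed over all relevant scales and both terminals of the request, for which the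
  rims are fixed by the input; this adds only O(log k) times the offline cost. Penalties paid for
  requests that the offline solution serves are at most the weight of \<open>trunk\<close> in
  expectation, so they are absorbed by the connection cost. One seed space must serve all graphs and
  inputs of every length, whence sequences of reals. The run is analysed as a Markov chain of
  finitely supported pmfs and transferred to seeds only at the end. Every estimate is either an
  invariant of all reachable states or a comparison of expected one-step increments.\<close>

lemma finite_partition_interval:
  fixes a :: "'i \<Rightarrow> real"
  assumes "finite I" "\<And>i. i \<in> I \<Longrightarrow> 0 \<le> a i"
  shows "\<exists>f. f \<in> borel \<rightarrow>\<^sub>M count_space UNIV \<and> (\<forall>u\<in>{0..<sum a I}. f u \<in> I) \<and>
    (\<forall>i\<in>I. emeasure lborel ({0..<sum a I} \<inter> f -` {i}) = ennreal (a i))"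
  using assms
proof (induction I rule: finite_induct)
  case empty
  show ?case by (intro exI[of _ "\<lambda>_. undefined"]) auto
next
  case (insert x I)
  then obtain f where f: "f \<in> borel \<rightarrow>\<^sub>M count_space UNIV" "\<forall>u\<in>{0..<sum a I}. f u \<in> I"
    "\<forall>i\<in>I. emeasure lborel ({0..<sum a I} \<inter> f -` {i}) = ennreal (a i)"
    by (metis insertCI)
  \<comment> \<open>The intervals are laid end to end; the new element receives the last stretch, to
    the right of those that \<open>f\<close> already distributes.\<close>
  define g where "g u = (if u < sum a I then f u else x)" for u
  have nn: "0 \<le> sum a I" "0 \<le> a x" using insert.prems by (auto intro!: sum_nonneg)
  have S: "sum a (insert x I) = a x + sum a I" using insert.hyps by simp
  have "g \<in> borel \<rightarrow>\<^sub>M count_space UNIV"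
    unfolding g_def using f(1) by measurable
  moreover have "\<forall>u\<in>{0..<sum a (insert x I)}. g u \<in> insert x I"
  proof
    fix u assume "u \<in> {0..<sum a (insert x I)}"
    then show "g u \<in> insert x I" using f(2) by (cases "u < sum a I") (simp_all add: g_def)
  qed
  moreover have "emeasure lborel ({0..<sum a (insert x I)} \<inter> g -` {i}) = ennreal (a i)"
    if "i \<in> insert x I" for i
  proof (cases "i = x")
    case True
    have "{0..<sum a (insert x I)} \<inter> g -` {i} = {sum a I..<sum a I + a x}"
    proof (rule set_eqI)
      fix u
      show "u \<in> {0..<sum a (insert x I)} \<inter> g -` {i} \<longleftrightarrow> u \<in> {sum a I..<sum a I + a x}"
        using f(2) insert.hyps(2) nn True by (cases "u < sum a I") (force simp: g_def S)+
    qed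
    then show ?thesis using nn True by simp
  next
    case False
    then have "{0..<sum a (insert x I)} \<inter> g -` {i} = {0..<sum a I} \<inter> f -` {i}"
    proof (intro set_eqI)
      fix u
      show "u \<in> {0..<sum a (insert x I)} \<inter> g -` {i} \<longleftrightarrow> u \<in> {0..<sum a I} \<inter> f -` {i}"
        using nn False by (cases "u < sum a I") (auto simp: g_def S)
    qed
    then show ?thesis using f(3) False that by simp
  qed
  ultimately show ?case by blast
qed

definition uniform01 :: "real measure" where
  "uniform01 = uniform_measure lborel {0..<1}"

lemma sets_uniform01 [measurable_cong, simp]: "sets uniform01 = sets borel"
  by (simp add: uniform01_def)

lemma space_uniform01 [simp]: "space uniform01 = UNIV"
  by (simp add: uniform01_def)

lemma prob_space_uniform01: "prob_space uniform01"
  unfolding uniform01_def by (intro prob_space_uniform_measure) auto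

text \<open>The range condition holds for every argument, not merely almost surely: feasibility is
  demanded for each single seed, so even a null set of illegal states would do harm.\<close>

lemma ex_sampler:
  fixes p :: "'i pmf"
  assumes "finite (set_pmf p)"
  shows "\<exists>f. f \<in> uniform01 \<rightarrow>\<^sub>M count_space UNIV \<and> range f \<subseteq> set_pmf p \<and>
    distr uniform01 (count_space UNIV) f = measure_pmf p"
proof -
  have one: "sum (pmf p) (set_pmf p) = 1"
    using assms by (simp add: sum_pmf_eq_1)
  obtain f :: "real \<Rightarrow> 'i" where f: "f \<in> borel \<rightarrow>\<^sub>M count_space UNIV" "\<forall>u\<in>{0..<1}. f u \<in> set_pmf p"
    "\<forall>i\<in>set_pmf p. emeasure lborel ({0..<1} \<inter> f -` {i}) = ennreal (pmf p i)"
    using finite_partition_interval[of "set_pmf p" "pmf p", OF assms pmf_nonneg, unfolded one] by blast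
  define g where "g u = (if 0 \<le> u \<and> u < 1 then f u else f 0)" for u
  have gm: "g \<in> borel \<rightarrow>\<^sub>M count_space UNIV"
    unfolding g_def using f(1) by measurable
  then have gm': "g \<in> uniform01 \<rightarrow>\<^sub>M count_space UNIV"
    by (simp add: uniform01_def)
  have r: "range g \<subseteq> set_pmf p" using f(2) by (auto simp: g_def)
  have "distr uniform01 (count_space UNIV) g = measure_pmf p"
  proof (rule measure_eqI_countable_AE[where \<Omega> = "set_pmf p"])
    show "AE x in distr uniform01 (count_space UNIV) g. x \<in> set_pmf p"
      using r gm' by (subst AE_distr_iff) auto
    show "AE x in measure_pmf p. x \<in> set_pmf p" by (rule AE_pmfI)
    fix x assume x: "x \<in> set_pmf p"
    have gs: "g -` {x} \<in> sets borel" using measurable_sets[OF gm, of "{x}"] by simp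
    have "emeasure (distr uniform01 (count_space UNIV) g) {x} = emeasure uniform01 (g -` {x})"
      using gm' by (subst emeasure_distr) auto
    also have "\<dots> = emeasure lborel ({0..<1} \<inter> g -` {x})"
      unfolding uniform01_def using gs by (subst emeasure_uniform_measure) (auto simp: divide_ennreal_def)
    also have "{0..<1} \<inter> g -` {x} = {0..<1} \<inter> f -` {x}" by (auto simp: g_def)
    finally show "emeasure (distr uniform01 (count_space UNIV) g) {x} = emeasure (measure_pmf p) {x}"
      using f(3) x by (simp add: emeasure_pmf_single)
  qed (auto)
  with gm' r show ?thesis by blast
qed

definition sampler :: "'i pmf \<Rightarrow> real \<Rightarrow> 'i" where
  "sampler p = (SOME f. f \<in> uniform01 \<rightarrow>\<^sub>M count_space UNIV \<and> range f \<subseteq> set_pmf p \<and>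
    distr uniform01 (count_space UNIV) f = measure_pmf p)"

lemma sampler:
  assumes "finite (set_pmf p)"
  shows "sampler p \<in> uniform01 \<rightarrow>\<^sub>M count_space UNIV" "sampler p u \<in> set_pmf p"
    "distr uniform01 (count_space UNIV) (sampler p) = measure_pmf p"
  using someI_ex[OF ex_sampler[OF assms]] unfolding sampler_def by auto

primrec chain :: "('s \<Rightarrow> 'a \<Rightarrow> 's pmf) \<Rightarrow> 's \<Rightarrow> 'a list \<Rightarrow> 's pmf" where
  "chain K s [] = return_pmf s"
| "chain K s (a # as) = bind_pmf (K s a) (\<lambda>s'. chain K s' as)"

primrec seeded :: "('s \<Rightarrow> 'a \<Rightarrow> 's pmf) \<Rightarrow> 's \<Rightarrow> 'a list \<Rightarrow> (nat \<Rightarrow> real) \<Rightarrow> 's" where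
  "seeded K s [] \<omega> = s"
| "seeded K s (a # as) \<omega> = seeded K (sampler (K s a) (\<omega> 0)) as (\<lambda>n. \<omega> (Suc n))"

lemma chain_snoc: "chain K s (as @ [a]) = bind_pmf (chain K s as) (\<lambda>s'. K s' a)"
  by (induction as arbitrary: s) (simp_all add: bind_return_pmf bind_return_pmf' bind_assoc_pmf)

text \<open>Step number m always reads coordinate m. Runs on a history and on its extension
  therefore share all earlier states, so the answers to successive histories belong to one
  run.\<close>

lemma seeded_snoc:
  "seeded K s (as @ [a]) \<omega> = sampler (K (seeded K s as \<omega>) a) (\<omega> (length as))"
  by (induction as arbitrary: s \<omega>) simp_all

lemma seeded_in_chain:
  assumes "\<And>s a. finite (set_pmf (K s a))"
  shows "seeded K s as \<omega> \<in> set_pmf (chain K s as)"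
  using assms
proof (induction as arbitrary: s \<omega>)
  case (Cons a as)
  let ?t = "sampler (K s a) (\<omega> 0)"
  have "?t \<in> set_pmf (K s a)" by (rule sampler(2)[OF Cons.prems])
  moreover have "seeded K ?t as (\<lambda>n. \<omega> (Suc n)) \<in> set_pmf (chain K ?t as)"
    by (rule Cons.IH[OF Cons.prems])
  ultimately show ?case by (auto simp only: seeded.simps chain.simps set_bind_pmf)
qed simp

definition seeds :: "(nat \<Rightarrow> real) measure" where
  "seeds = (\<Pi>\<^sub>M i\<in>UNIV. uniform01)"

lemma prob_space_seeds: "prob_space seeds"
  unfolding seeds_def by (intro prob_space_PiM prob_space_uniform01)

text \<open>The first coordinate is independent of the shifted sequence, which is again distributed
  like \<open>seeds\<close>; Fubini then splits off one \<open>bind_pmf\<close> per request.\<close>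

lemma seeded_measurable_distr:
  assumes fin: "\<And>s a. finite (set_pmf (K s a))"
  shows "seeded K s as \<in> seeds \<rightarrow>\<^sub>M count_space UNIV \<and>
    distr seeds (count_space UNIV) (seeded K s as) = measure_pmf (chain K s as)"
proof (induction as arbitrary: s)
  case Nil
  interpret prob_space seeds by (rule prob_space_seeds)
  have "(\<lambda>\<omega>. s) \<in> seeds \<rightarrow>\<^sub>M count_space UNIV" by simp
  moreover have "distr seeds (count_space UNIV) (\<lambda>\<omega>. s) = return (count_space UNIV) s"
    by (rule distr_const) simp
  ultimately show ?case by (simp add: return_pmf.rep_eq)
next
  case (Cons a as)
  interpret U: prob_space uniform01 by (rule prob_space_uniform01)
  interpret Q: sequence_space uniform01 ..
  have Seq: "Q.S = seeds" by (simp add: seeds_def)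
  let ?p = "K s a" and ?f = "sampler (K s a)"
  note [measurable] = sampler(1)[OF fin]
  have IHm[measurable]: "seeded K t as \<in> seeds \<rightarrow>\<^sub>M count_space UNIV" for t
    using Cons.IH by blast
  have dec: "(\<lambda>(u, \<omega>). seeded K (?f u) as \<omega>) \<in> (uniform01 \<Otimes>\<^sub>M seeds) \<rightarrow>\<^sub>M count_space UNIV"
  proof -
    have "(\<lambda>x. seeded K (?f (fst x)) as (snd x)) \<in> (uniform01 \<Otimes>\<^sub>M seeds) \<rightarrow>\<^sub>M count_space UNIV"
    \<comment> \<open>The state type may be uncountable, so joint measurability is reduced to the
      finitely many possible successor states.\<close>
    proof (rule measurable_compose_countable'[where g = "\<lambda>x. ?f (fst x)" and I = "set_pmf ?p"
          and f = "\<lambda>t x. seeded K t as (snd x)"])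
      show "(\<lambda>x. ?f (fst x)) \<in> uniform01 \<Otimes>\<^sub>M seeds \<rightarrow>\<^sub>M count_space (set_pmf ?p)"
      proof (rule measurable_count_space_extend[where B = UNIV])
      qed (auto intro: sampler(2)[OF fin])
    qed (auto intro: countable_finite fin)
    then show ?thesis by (simp add: case_prod_beta')
  qed
  have hd: "(\<lambda>\<omega>. (\<omega> 0, \<lambda>n. \<omega> (Suc n))) \<in> seeds \<rightarrow>\<^sub>M uniform01 \<Otimes>\<^sub>M seeds"
    unfolding seeds_def by (rule measurable_Pair) (auto intro!: measurable_PiM_single' simp: space_PiM)
  have m: "seeded K s (a # as) \<in> seeds \<rightarrow>\<^sub>M count_space UNIV"
  proof -
    have "seeded K s (a # as) = (\<lambda>\<omega>. seeded K (?f (\<omega> 0)) as (\<lambda>n. \<omega> (Suc n)))"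
      by (rule ext) simp
    then show ?thesis using measurable_compose[OF hd dec] by simp
  qed
  have "distr seeds (count_space UNIV) (seeded K s (a # as)) = measure_pmf (chain K s (a # as))"
  proof (rule measure_eqI)
    fix X assume "X \<in> sets (distr seeds (count_space UNIV) (seeded K s (a # as)))"
    have itm: "(\<lambda>(u, \<omega>). case_nat u \<omega>) \<in> uniform01 \<Otimes>\<^sub>M seeds \<rightarrow>\<^sub>M seeds"
      unfolding seeds_def by measurable
    have mI: "(\<lambda>\<omega>. indicator X (seeded K s (a # as) \<omega>) :: ennreal) \<in> borel_measurable seeds"
      by (rule measurable_compose[OF m]) simp
    have "emeasure (distr seeds (count_space UNIV) (seeded K s (a # as))) X
      = (\<integral>\<^sup>+\<omega>. indicator X (seeded K s (a # as) \<omega>) \<partial>seeds)"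
      using m by (subst nn_integral_distr[symmetric]) auto
    also have "\<dots> = (\<integral>\<^sup>+\<omega>. indicator X (seeded K s (a # as) \<omega>) \<partial>distr (uniform01 \<Otimes>\<^sub>M seeds) seeds (\<lambda>(u, \<omega>). case_nat u \<omega>))"
      using Q.PiM_iter unfolding Seq by simp
    also have "\<dots> = (\<integral>\<^sup>+x. indicator X (seeded K (?f (fst x)) as (snd x)) \<partial>(uniform01 \<Otimes>\<^sub>M seeds))"
      using itm mI by (subst nn_integral_distr) (auto simp: case_prod_beta')
    also have "\<dots> = (\<integral>\<^sup>+u. \<integral>\<^sup>+\<omega>. indicator X (seeded K (?f u) as \<omega>) \<partial>seeds \<partial>uniform01)"
    proof (subst sigma_finite_measure.nn_integral_fst[symmetric])
      show "sigma_finite_measure seeds"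
        using prob_space_seeds prob_space_imp_sigma_finite by blast
      show "(\<lambda>x. indicator X (seeded K (?f (fst x)) as (snd x))) \<in> borel_measurable (uniform01 \<Otimes>\<^sub>M seeds)"
        using measurable_compose[OF dec, of "indicator X" borel] by (simp add: case_prod_beta')
    qed simp
    also have "\<dots> = (\<integral>\<^sup>+u. emeasure (chain K (?f u) as) X \<partial>uniform01)"
    proof (rule nn_integral_cong)
      fix u
      have "(\<integral>\<^sup>+\<omega>. indicator X (seeded K (?f u) as \<omega>) \<partial>seeds) = emeasure (distr seeds (count_space UNIV) (seeded K (?f u) as)) X"
        using nn_integral_distr[OF IHm, of "indicator X" "?f u"] by simp
      then show "(\<integral>\<^sup>+\<omega>. indicator X (seeded K (?f u) as \<omega>) \<partial>seeds) = emeasure (chain K (?f u) as) X"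
        using Cons.IH by simp
    qed
    also have "\<dots> = (\<integral>\<^sup>+t. emeasure (chain K t as) X \<partial>distr uniform01 (count_space UNIV) ?f)"
      by (subst nn_integral_distr) auto
    also have "\<dots> = (\<integral>\<^sup>+t. emeasure (chain K t as) X \<partial>measure_pmf ?p)"
      using sampler(3)[OF fin] by simp
    also have "\<dots> = emeasure (measure_pmf (chain K s (a # as))) X"
      by (simp add: emeasure_bind_pmf)
    finally show "emeasure (distr seeds (count_space UNIV) (seeded K s (a # as))) X
      = emeasure (measure_pmf (chain K s (a # as))) X" .
  qed simp
  with m show ?case by blast
qed

lemma nn_integral_seeded:
  assumes "\<And>s a. finite (set_pmf (K s a))"
  shows "(\<integral>\<^sup>+\<omega>. h (seeded K s as \<omega>) \<partial>seeds) = (\<integral>\<^sup>+t. h t \<partial>measure_pmf (chain K s as))"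
proof -
  note D = seeded_measurable_distr[of K s as, OF assms]
  have "(\<integral>\<^sup>+\<omega>. h (seeded K s as \<omega>) \<partial>seeds)
      = (\<integral>\<^sup>+t. h t \<partial>distr seeds (count_space UNIV) (seeded K s as))"
    using nn_integral_distr[OF conjunct1[OF D], of h] by simp
  then show ?thesis unfolding conjunct2[OF D] .
qed

section \<open>Links, rims and light pieces\<close>

definition link_cost :: "('v \<Rightarrow> real) \<Rightarrow> 'v set \<Rightarrow> 'v set \<Rightarrow> real" where
  "link_cost w T X = sum w (X - T)"

definition links :: "('v, 'e) pre_digraph \<Rightarrow> 'v \<Rightarrow> 'v \<Rightarrow> 'v set set" where
  "links G s t = {X. X \<subseteq> verts G \<and> s \<rightarrow>\<^sup>*\<^bsub>G \<restriction> X\<^esub> t}"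

definition cheapest :: "('v, 'e) pre_digraph \<Rightarrow> ('v \<Rightarrow> real) \<Rightarrow> 'v set \<Rightarrow> 'v \<Rightarrow> 'v \<Rightarrow> 'v set" where
  "cheapest G w T s t = arg_min_on (link_cost w T) (links G s t)"

definition remaining :: "('v, 'e) pre_digraph \<Rightarrow> ('v \<Rightarrow> real) \<Rightarrow> 'v set \<Rightarrow> 'v \<Rightarrow> 'v \<Rightarrow> real" where
  "remaining G w T s t = link_cost w T (cheapest G w T s t)"

text \<open>The weight of the target \<open>v\<close> is not counted, so that a heavy vertex can be
  near; the relation is therefore not symmetric. It uses the original weights, independently of what
  has been bought.\<close>

definition near :: "('v, 'e) pre_digraph \<Rightarrow> ('v \<Rightarrow> real) \<Rightarrow> real \<Rightarrow> 'v \<Rightarrow> 'v \<Rightarrow> bool" where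
  "near G w r s v \<longleftrightarrow> (\<exists>X\<in>links G s v. link_cost w {v} X \<le> r)"

definition rim :: "('v, 'e) pre_digraph \<Rightarrow> ('v \<Rightarrow> real) \<Rightarrow> real \<Rightarrow> 'v \<Rightarrow> 'v set" where
  "rim G w r s = {v \<in> verts G. near G w r s v \<and> r \<le> w v}"

locale node_weighted =
  fixes G :: "('v, 'e) pre_digraph" and w :: "'v \<Rightarrow> real"
  assumes node_weighted_graph: "node_weighted_graph G w"
begin

sublocale graph G using node_weighted_graph by (simp add: node_weighted_graph_def)

abbreviation V where "V \<equiv> verts G"

lemma w_nonneg: "v \<in> V \<Longrightarrow> 0 \<le> w v"
  using node_weighted_graph by (simp add: node_weighted_graph_def)

lemma finV [simp, intro]: "finite V" by (rule finite_verts)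

lemma finite_subV: "X \<subseteq> V \<Longrightarrow> finite X" by (rule finite_subset) auto

lemma sum_w_mono: "X \<subseteq> Y \<Longrightarrow> Y \<subseteq> V \<Longrightarrow> sum w X \<le> sum w Y"
  by (rule sum_mono2) (auto simp: finite_subV w_nonneg)

lemma sum_w_nonneg: "X \<subseteq> V \<Longrightarrow> 0 \<le> sum w X"
  by (rule sum_nonneg) (auto simp: w_nonneg)

lemma sum_w_Un: "X \<subseteq> V \<Longrightarrow> Y \<subseteq> V \<Longrightarrow> sum w (X \<union> Y) \<le> sum w X + sum w Y"
  by (subst sum.union_inter[symmetric]) (auto simp: finite_subV intro!: sum_w_nonneg)

lemma reachable_sym: "s \<rightarrow>\<^sup>*\<^bsub>G \<restriction> X\<^esub> t \<Longrightarrow> t \<rightarrow>\<^sup>*\<^bsub>G \<restriction> X\<^esub> s"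
proof (rule symmetric_reachable)
  show "symmetric (G \<restriction> X)"
    using sym_arcs unfolding symmetric_conv by fastforce
qed

lemma reachable_trans_in: "s \<rightarrow>\<^sup>*\<^bsub>G \<restriction> X\<^esub> t \<Longrightarrow> t \<rightarrow>\<^sup>*\<^bsub>G \<restriction> X\<^esub> u \<Longrightarrow> s \<rightarrow>\<^sup>*\<^bsub>G \<restriction> X\<^esub> u"
  by (rule wf_digraph.reachable_trans) auto

lemma reachable_refl_in: "s \<in> X \<Longrightarrow> s \<rightarrow>\<^sup>*\<^bsub>G \<restriction> X\<^esub> s"
  by (rule wf_digraph.reachable_refl) auto

lemma reachable_in: "s \<rightarrow>\<^sup>*\<^bsub>G \<restriction> X\<^esub> t \<Longrightarrow> s \<in> X \<and> t \<in> X"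
  by (auto elim: reachable_in_vertsE)

lemma links_sym: "links G s t = links G t s"
  by (auto simp: links_def intro: reachable_sym)

lemma links_Un:
  "X \<in> links G s t \<Longrightarrow> Y \<in> links G t u \<Longrightarrow> X \<union> Y \<in> links G s u"
proof -
  assume a: "X \<in> links G s t" "Y \<in> links G t u"
  have "s \<rightarrow>\<^sup>*\<^bsub>G \<restriction> (X \<union> Y)\<^esub> t"
    by (rule reachable_induce_ss[where S = X]) (use a in \<open>auto simp: links_def\<close>)
  moreover have "t \<rightarrow>\<^sup>*\<^bsub>G \<restriction> (X \<union> Y)\<^esub> u"
    by (rule reachable_induce_ss[where S = Y]) (use a in \<open>auto simp: links_def\<close>)
  ultimately show ?thesis using a reachable_trans_in unfolding links_def by blast
qed

lemma links_mono: "X \<in> links G s t \<Longrightarrow> X \<subseteq> Y \<Longrightarrow> Y \<subseteq> V \<Longrightarrow> Y \<in> links G s t"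
  unfolding links_def by (auto intro: reachable_induce_ss)

lemma finite_links: "finite (links G s t)"
  by (rule finite_subset[of _ "Pow V"]) (auto simp: links_def)

lemma link_ends: "X \<in> links G s t \<Longrightarrow> s \<in> X \<and> t \<in> X"
  unfolding links_def using reachable_in by auto

lemma link_subset: "X \<in> links G s t \<Longrightarrow> X \<subseteq> V"
  unfolding links_def by auto

lemma cheapest_in: "links G s t \<noteq> {} \<Longrightarrow> cheapest G w T s t \<in> links G s t"
  unfolding cheapest_def using arg_min_if_finite(1)[OF finite_links] by blast

lemma remaining_le: "X \<in> links G s t \<Longrightarrow> remaining G w T s t \<le> link_cost w T X"
  unfolding remaining_def cheapest_def
  using arg_min_least[OF finite_links] by fastforce

lemma link_cost_nonneg: "X \<subseteq> V \<Longrightarrow> 0 \<le> link_cost w T X"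
  unfolding link_cost_def by (rule sum_w_nonneg) auto

lemma remaining_nonneg: "links G s t \<noteq> {} \<Longrightarrow> 0 \<le> remaining G w T s t"
  unfolding remaining_def using cheapest_in[of s t T] by (auto intro!: link_cost_nonneg dest: link_subset)

lemma near_mono: "near G w r s v \<Longrightarrow> r \<le> r' \<Longrightarrow> near G w r' s v"
  unfolding near_def by (meson order_trans)

lemma near_refl: "s \<in> V \<Longrightarrow> 0 \<le> r \<Longrightarrow> near G w r s s"
  unfolding near_def
  by (rule bexI[of _ "{s}"]) (auto simp: links_def link_cost_def intro: reachable_refl_in)

lemma link_cost_Un: "X \<subseteq> V \<Longrightarrow> Y \<subseteq> V \<Longrightarrow> link_cost w T (X \<union> Y) \<le> link_cost w T X + link_cost w T Y"
  unfolding link_cost_def Un_Diff by (rule sum_w_Un) auto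

lemma link_cost_antimono: "X \<subseteq> V \<Longrightarrow> T \<subseteq> T' \<Longrightarrow> link_cost w T' X \<le> link_cost w T X"
  unfolding link_cost_def by (rule sum_w_mono) auto

text \<open>Two near hubs that are already joined would give a cheap link.\<close>

lemma hubs_not_joined:
  assumes "near G w r s h" "near G w r t h'" "h \<in> T" "h' \<in> T" "T \<subseteq> V"
    and "2 * r < remaining G w T s t"
  shows "\<not> h \<rightarrow>\<^sup>*\<^bsub>G \<restriction> T\<^esub> h'"
proof
  assume hh: "h \<rightarrow>\<^sup>*\<^bsub>G \<restriction> T\<^esub> h'"
  obtain X Y where X: "X \<in> links G s h" "link_cost w {h} X \<le> r"
    and Y: "Y \<in> links G t h'" "link_cost w {h'} Y \<le> r"
    using assms(1,2) unfolding near_def by auto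
  have T: "T \<in> links G h h'" using hh assms(5) by (simp add: links_def)
  have XV: "X \<subseteq> V" "Y \<subseteq> V" using X(1) Y(1) by (auto dest: link_subset)
  have "X \<union> (T \<union> Y) \<in> links G s t"
    using links_Un[OF X(1) links_Un[OF T]] Y(1) links_sym by blast
  then have "remaining G w T s t \<le> link_cost w T (X \<union> (T \<union> Y))" by (rule remaining_le)
  also have "\<dots> = link_cost w T (X \<union> Y)" unfolding link_cost_def by (rule arg_cong[of _ _ "sum w"]) auto
  also have "\<dots> \<le> link_cost w T X + link_cost w T Y" by (rule link_cost_Un[OF XV])
  also have "\<dots> \<le> link_cost w {h} X + link_cost w {h'} Y"
    using assms(3,4) XV by (intro add_mono link_cost_antimono) auto
  also have "\<dots> \<le> 2 * r" using X Y by simp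
  finally show False using assms(6) by simp
qed

text \<open>Grow a connected piece of the solution \<open>S\<close> around \<open>s\<close> until its weight exceeds \<open>r\<close>; either
  the last vertex is heavy, or the piece is light.\<close>

lemma rim_or_light:
  assumes "S \<in> links G s t" "r < remaining G w {} s t" "0 \<le> r"
  shows "rim G w r s \<inter> S \<noteq> {} \<or>
    (\<exists>X\<subseteq>S. (\<forall>u\<in>X. X \<in> links G s u) \<and> r < sum w X \<and> sum w X \<le> 2 * r)"
proof (cases "w s \<le> r")
  case False
  have "s \<in> S" "S \<subseteq> V" using assms(1) link_ends link_subset by auto
  then have "s \<in> rim G w r s \<inter> S" using False assms(3) by (auto simp: rim_def intro: near_refl)
  then show ?thesis by blast
next
  case True
  have sS: "s \<in> S" "t \<in> S" "S \<subseteq> V" using assms(1) link_ends link_subset by auto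
  define C where "C = {X. X \<subseteq> S \<and> s \<in> X \<and> (\<forall>u\<in>X. X \<in> links G s u) \<and> sum w X \<le> r}"
  have fC: "finite C" unfolding C_def by (rule finite_subset[of _ "Pow S"]) (use sS finite_subV in auto)
  have "{s} \<in> C" unfolding C_def using sS True by (auto simp: links_def intro: reachable_refl_in)
  then have ne: "C \<noteq> {}" by blast
  obtain X where XC: "X \<in> C" and max: "\<forall>Y\<in>C. X \<subseteq> Y \<longrightarrow> X = Y"
    using finite_has_maximal[OF fC ne] by blast
  have X: "X \<subseteq> S" "s \<in> X" "\<forall>u\<in>X. X \<in> links G s u" "sum w X \<le> r"
    using XC unfolding C_def by auto
  have XV: "X \<subseteq> V" using X sS by auto
  have "t \<notin> X"
  proof
    assume "t \<in> X"
    then have "X \<in> links G s t" using X by auto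
    then have "remaining G w {} s t \<le> sum w X" using remaining_le[of X s t "{}"] by (simp add: link_cost_def)
    then show False using X assms(2) by auto
  qed
  have reach: "s \<rightarrow>\<^sup>*\<^bsub>G \<restriction> S\<^esub> t" using assms(1) by (simp add: links_def)
  have "\<exists>u v. u \<in> X \<and> v \<in> S - X \<and> u \<rightarrow>\<^bsub>G \<restriction> S\<^esub> v"
  proof (rule ccontr)
    interpret GS: wf_digraph "G \<restriction> S" by auto
    assume no: "\<nexists>u v. u \<in> X \<and> v \<in> S - X \<and> u \<rightarrow>\<^bsub>G \<restriction> S\<^esub> v"
    from reach have "t \<in> X"
    proof (induction rule: GS.reachable_induct)
      case base then show ?case using X by auto
    next
      case (step x y)
      then show ?case using no GS.adj_in_verts(2)[of x y] by auto
    qed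
    then show False using \<open>t \<notin> X\<close> by simp
  qed
  then obtain u v where uv: "u \<in> X" "v \<in> S" "v \<notin> X" "u \<rightarrow>\<^bsub>G \<restriction> S\<^esub> v" by blast
  define Y where "Y = insert v X"
  have YV: "Y \<subseteq> V" "Y \<subseteq> S" using XV uv sS X by (auto simp: Y_def)
  have adj: "u \<rightarrow>\<^bsub>G \<restriction> Y\<^esub> v"
    using uv(1,4) unfolding Y_def arcs_ends_conv by force
  have Yu: "Y \<in> links G s x" if "x \<in> X" for x
  proof (rule links_mono)
    show "X \<in> links G s x" using X(3) that by blast
  qed (use YV in \<open>auto simp: Y_def\<close>)
  have "s \<rightarrow>\<^sup>*\<^bsub>G \<restriction> Y\<^esub> v"
  proof (rule wf_digraph.reachable_adj_trans[OF _ _ adj])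
    show "s \<rightarrow>\<^sup>*\<^bsub>G \<restriction> Y\<^esub> u" using Yu[OF uv(1)] X(3) uv(1) YV by (simp add: links_def)
  qed auto
  then have Yv: "Y \<in> links G s v" using YV by (simp add: links_def)
  have Yall: "\<forall>x\<in>Y. Y \<in> links G s x" using Yu Yv by (auto simp: Y_def)
  have Ysum: "sum w Y = w v + sum w X" using uv finite_subV[OF XV] by (simp add: Y_def)
  have gt: "r < sum w Y"
  proof (rule ccontr)
    assume "\<not> r < sum w Y"
    then have "Y \<in> C" using Yall X YV unfolding C_def by (auto simp: Y_def)
    then show False using max uv by (auto simp: Y_def)
  qed
  \<comment> \<open>\<open>near\<close> ignores the weight of its target \<open>v\<close>, so the
    link \<open>Y\<close> counts only with the weight of \<open>X\<close>, which is at most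
    \<open>r\<close>.\<close>
  have "Y - {v} = X" using uv by (auto simp: Y_def)
  then have "near G w r s v" unfolding near_def link_cost_def using Yv X by auto
  then show ?thesis
  proof (cases "r \<le> w v")
    case True
    then have "v \<in> rim G w r s \<inter> S" using \<open>near G w r s v\<close> uv(2) sS(3) by (auto simp: rim_def)
    then show ?thesis by blast
  next
    case False
    then have "sum w Y \<le> 2 * r" using Ysum X(4) by simp
    then show ?thesis using gt Yall YV by blast
  qed
qed

text \<open>A common vertex would splice the two pieces into a single link of weight at most
  \<open>4 * r\<close>, which makes each centre near the other.\<close>

lemma light_disjoint:
  assumes "\<forall>u\<in>X. X \<in> links G s u" "\<forall>u\<in>Y. Y \<in> links G t u" "sum w X \<le> 2 * r" "sum w Y \<le> 2 * r"
    and "\<not> (near G w (4 * r) s t \<and> near G w (4 * r) t s)"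
  shows "X \<inter> Y = {}"
proof (rule ccontr)
  assume "X \<inter> Y \<noteq> {}"
  then obtain u where u: "u \<in> X" "u \<in> Y" by blast
  have l: "X \<in> links G s u" "Y \<in> links G u t" using u assms(1,2) links_sym by auto
  have Z: "X \<union> Y \<in> links G s t" "X \<union> Y \<in> links G t s"
    using links_Un[OF l] links_sym by auto
  have V: "X \<subseteq> V" "Y \<subseteq> V" using l link_subset by auto
  have c: "link_cost w A (X \<union> Y) \<le> 4 * r" for A
  proof -
    have "link_cost w A (X \<union> Y) \<le> link_cost w {} (X \<union> Y)" using V by (intro link_cost_antimono) auto
    also have "\<dots> \<le> sum w X + sum w Y" using sum_w_Un[OF V] by (simp add: link_cost_def)
    finally show ?thesis using assms(3,4) by simp
  qed
  show False using assms(5) Z c unfolding near_def by blast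
qed

end

section \<open>The algorithm\<close>

text \<open>
  \<open>trunk\<close> collects the vertices bought to connect requests and \<open>fac\<close> the sampled vertices. A hub
  \<open>(j, h)\<close> is the centre of a ball at scale \<open>2 ^ j\<close>. An event \<open>(i, j, x, g)\<close> records that request
  \<open>i\<close> made its terminal \<open>x\<close> a hub because no other hub was available; the flag \<open>g\<close> says whether the
  weights were raised. \<open>events\<close> is read only by the analysis, and \<open>resp\<close> is the answer to the last
  request.
\<close>

record 'v state =
  trunk :: "'v set"
  fac :: "'v set"
  wt :: "'v \<Rightarrow> real"
  hubs :: "(int \<times> 'v) set"
  events :: "(nat \<times> int \<times> 'v \<times> bool) set"
  skipped :: "nat set"
  clock :: nat
  resp :: "'v set option"

definition initial :: "'v state" where
  "initial = \<lparr>trunk = {}, fac = {}, wt = (\<lambda>_. 0), hubs = {}, events = {}, skipped = {}, clock = 0, resp = None\<rparr>"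

definition rad :: "int \<Rightarrow> real" where
  "rad j = 2 powr real_of_int j"

text \<open>The factor 16 leaves room for the detours of a merge: two hubs within
  \<open>4 * rad j\<close> of the terminals account for \<open>8 * rad j\<close>, which is still
  less than the gap, so they cannot be joined already.\<close>

definition level :: "real \<Rightarrow> int" where
  "level d = \<lfloor>log 2 (d / 16)\<rfloor>"

text \<open>A vertex whose weight has reached 1 is bought outright, at a price of at most
  \<open>w v * wt s v\<close>. Weights are raised only on rims without facilities, so this also
  keeps all weights bounded, and hence the logarithm that measures their growth.\<close>

definition facilities :: "('v, 'e) pre_digraph \<Rightarrow> 'v state \<Rightarrow> 'v set" where
  "facilities G s = fac s \<union> {v \<in> verts G. 1 \<le> wt s v}"

definition solution :: "('v, 'e) pre_digraph \<Rightarrow> 'v state \<Rightarrow> 'v set" where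
  "solution G s = trunk s \<union> facilities G s"

definition limit :: "nat \<Rightarrow> real" where
  "limit i = 2 * ln (real i + 2)"

text \<open>
  Multiplicative weights: the additive term \<open>1 / n\<close> starts the growth, and the step size
  \<open>1 / (limit i + 2)\<close> keeps the total increment at most 1, and the expected weight of the sampled
  vertex at most \<open>rad j\<close>, as long as the rim has total weight below \<open>limit i\<close>.
\<close>

definition increment ::
    "('v, 'e) pre_digraph \<Rightarrow> ('v \<Rightarrow> real) \<Rightarrow> 'v state \<Rightarrow> int \<Rightarrow> 'v \<Rightarrow> 'v \<Rightarrow> real" where
  "increment G w s j x v = (if v \<in> rim G w (rad j) x
     then rad j / (w v * (limit (clock s) + 2)) * (wt s v + 1 / real (card (verts G))) else 0)"

text \<open>The radius \<open>4 * rad j\<close> is dictated by \<open>light_disjoint\<close>: a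
  terminal with no hub of its level in this range has a light piece disjoint from those of the
  earlier events of that level.\<close>

definition near_hub :: "('v, 'e) pre_digraph \<Rightarrow> ('v \<Rightarrow> real) \<Rightarrow> 'v state \<Rightarrow> int \<Rightarrow> 'v \<Rightarrow> 'v \<Rightarrow> bool" where
  "near_hub G w s j x h \<longleftrightarrow> (j, h) \<in> hubs s \<and> near G w (4 * rad j) x h"

datatype 'v action = Free | Merge 'v 'v | Facility 'v | is_Private: Private 'v bool

definition gap :: "('v, 'e) pre_digraph \<Rightarrow> ('v \<Rightarrow> real) \<Rightarrow> 'v state \<Rightarrow> 'v \<Rightarrow> 'v \<Rightarrow> real" where
  "gap G w s a b = remaining G w (solution G s) a b"

text \<open>\<open>x\<close> is \<open>b\<close> only if \<open>a\<close> has a near hub; a near hub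
  of \<open>x\<close> thus means that both terminals have one, and otherwise \<open>x\<close> is a
  terminal without any.\<close>

definition action :: "('v, 'e) pre_digraph \<Rightarrow> ('v \<Rightarrow> real) \<Rightarrow> 'v state \<Rightarrow> 'v \<Rightarrow> 'v \<Rightarrow> 'v action" where
  "action G w s a b =
     (let d = gap G w s a b; j = level d;
          x = (if \<exists>h. near_hub G w s j a h then b else a);
          B = rim G w (rad j) x
      in if d \<le> 0 then Free
         else if \<exists>h. near_hub G w s j x h
         then Merge (SOME h. near_hub G w s j a h) (SOME h. near_hub G w s j b h)
         else if facilities G s \<inter> B \<noteq> {} then Facility (SOME v. v \<in> facilities G s \<inter> B)
         else Private x (sum (wt s) B < limit (clock s)))"

text \<open>Declaring a hub does not buy a path from the terminal to it; only a later merge buys the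
  paths to its two hubs. Both kinds of new hub lie in the new solution anyway: \<open>v\<close> is a
  facility, and \<open>x\<close> is an end of the link. After a private event the hub is
  \<open>x\<close> even if a vertex was sampled.\<close>

definition connect ::
    "('v, 'e) pre_digraph \<Rightarrow> ('v \<Rightarrow> real) \<Rightarrow> 'v state \<Rightarrow> 'v \<Rightarrow> 'v \<Rightarrow> 'v option \<Rightarrow> 'v state" where
  "connect G w s a b c =
     (let T = solution G s; j = level (gap G w s a b); X = cheapest G w T a b
      in case action G w s a b of
           Free \<Rightarrow> s\<lparr>trunk := trunk s \<union> (X - T)\<rparr>
         | Merge h h' \<Rightarrow>
             s\<lparr>trunk := trunk s \<union> ((X \<union> (cheapest G w {h} a h \<union> cheapest G w {h'} b h')) - T)\<rparr>
         | Facility v \<Rightarrow> s\<lparr>trunk := trunk s \<union> (X - T), hubs := insert (j, v) (hubs s)\<rparr>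
         | Private x g \<Rightarrow>
             s\<lparr>trunk := trunk s \<union> (X - T), fac := fac s \<union> set_option c,
               wt := (if g then (\<lambda>v. wt s v + increment G w s j x v) else wt s),
               hubs := insert (j, x) (hubs s), events := insert (clock s, j, x, g) (events s)\<rparr>)"

definition update ::
    "('v, 'e) pre_digraph \<Rightarrow> ('v \<Rightarrow> real) \<Rightarrow> 'v state \<Rightarrow> 'v request \<Rightarrow> 'v option option \<Rightarrow> 'v state" where
  "update G w s r z = (case r of (a, b, p) \<Rightarrow> (case z of
       None \<Rightarrow> s\<lparr>skipped := insert (clock s) (skipped s), clock := Suc (clock s), resp := None\<rparr>
     | Some c \<Rightarrow> let s' = connect G w s a b c
                 in s'\<lparr>clock := Suc (clock s), resp := Some (solution G s')\<rparr>))"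

text \<open>
  A request whose penalty is smaller than the gap is served with probability penalty / gap, so that
  the expected penalty paid is at most the expected connection cost.
\<close>

definition join_prob :: "('v, 'e) pre_digraph \<Rightarrow> ('v \<Rightarrow> real) \<Rightarrow> 'v state \<Rightarrow> 'v request \<Rightarrow> real" where
  "join_prob G w s r = (case r of (a, b, p) \<Rightarrow>
     if links G a b = {} then 0
     else if ennreal (gap G w s a b) \<le> p then 1 else enn2real p / gap G w s a b)"

text \<open>The increments serve as probabilities and \<open>None\<close> takes the remaining mass.
  The other branch only makes the definition total; \<open>selection_valid\<close> supplies the
  condition for sane states.\<close>

definition selection :: "'v set \<Rightarrow> ('v \<Rightarrow> real) \<Rightarrow> 'v option pmf" where
  "selection V f = (if finite V \<and> (\<forall>v\<in>V. 0 \<le> f v) \<and> sum f V \<le> 1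
     then embed_pmf (\<lambda>z. case z of None \<Rightarrow> 1 - sum f V | Some v \<Rightarrow> if v \<in> V then f v else 0)
     else return_pmf None)"

definition sample :: "('v, 'e) pre_digraph \<Rightarrow> ('v \<Rightarrow> real) \<Rightarrow> 'v state \<Rightarrow> 'v \<Rightarrow> 'v \<Rightarrow> 'v option pmf" where
  "sample G w s a b = (case action G w s a b of
       Private x g \<Rightarrow> if g then selection (rim G w (rad (level (gap G w s a b))) x)
                              (increment G w s (level (gap G w s a b)) x)
                      else return_pmf None
     | _ \<Rightarrow> return_pmf None)"

definition transition :: "('v, 'e) pre_digraph \<Rightarrow> ('v \<Rightarrow> real) \<Rightarrow> 'v state \<Rightarrow> 'v request \<Rightarrow> 'v state pmf" where
  "transition G w s r = map_pmf (update G w s r)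
     (bind_pmf (bernoulli_pmf (join_prob G w s r))
       (\<lambda>z. if z then map_pmf Some (sample G w s (fst r) (fst (snd r))) else return_pmf None))"

section \<open>The sampling law, radii and the case analysis of one step\<close>

lemma
  assumes "finite V" "\<And>v. v \<in> V \<Longrightarrow> 0 \<le> f v" "sum f V \<le> 1"
  shows pmf_selection: "pmf (selection V f) z = (case z of None \<Rightarrow> 1 - sum f V | Some v \<Rightarrow> if v \<in> V then f v else 0)"
    and nn_integral_selection: "(\<integral>\<^sup>+z. h z \<partial>measure_pmf (selection V f)) =
      h None * ennreal (1 - sum f V) + (\<Sum>v\<in>V. h (Some v) * ennreal (f v))"
proof -
  define g where "g z = (case z of None \<Rightarrow> 1 - sum f V | Some v \<Rightarrow> if v \<in> V then f v else 0)" for z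
  have g0: "0 \<le> g z" for z using assms by (auto simp: g_def split: option.split)
  let ?A = "insert None (Some ` V)"
  have "(\<integral>\<^sup>+z. ennreal (g z) \<partial>count_space UNIV) = (\<integral>\<^sup>+z. ennreal (g z) * indicator ?A z \<partial>count_space UNIV)"
    by (intro nn_integral_cong) (auto simp: g_def indicator_def split: option.split)
  also have "\<dots> = (\<Sum>z\<in>?A. ennreal (g z))"
    using assms(1) by (subst nn_integral_count_space_indicator[symmetric]) (auto simp: nn_integral_count_space_finite)
  also have "\<dots> = ennreal (\<Sum>z\<in>?A. g z)" using g0 by (rule sum_ennreal)
  also have "(\<Sum>z\<in>?A. g z) = g None + (\<Sum>v\<in>V. g (Some v))"
    using assms(1) by (subst sum.insert) (auto simp: sum.reindex)
  also have "\<dots> = 1" by (simp add: g_def)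
  finally have g1: "(\<integral>\<^sup>+z. ennreal (g z) \<partial>count_space UNIV) = 1" by simp
  have sel: "selection V f = embed_pmf g"
    using assms unfolding selection_def g_def by auto
  have p: "pmf (selection V f) z = g z" for z
    unfolding sel using g0 g1 by (rule pmf_embed_pmf)
  then show "pmf (selection V f) z = (case z of None \<Rightarrow> 1 - sum f V | Some v \<Rightarrow> if v \<in> V then f v else 0)"
    by (simp add: g_def)
  have "(\<integral>\<^sup>+z. h z \<partial>measure_pmf (selection V f)) = (\<Sum>z\<in>?A. h z * ennreal (pmf (selection V f) z))"
  proof (rule nn_integral_measure_pmf_support)
    fix x assume "x \<in> set_pmf (selection V f)" "x \<notin> ?A"
    then show "h x = 0" using p[of x] by (cases x) (auto simp: set_pmf_iff g_def split: if_splits)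
  qed (use assms in auto)
  also have "\<dots> = h None * ennreal (g None) + (\<Sum>v\<in>V. h (Some v) * ennreal (g (Some v)))"
    using assms(1) by (subst sum.insert) (auto simp: sum.reindex p)
  finally show "(\<integral>\<^sup>+z. h z \<partial>measure_pmf (selection V f)) =
      h None * ennreal (1 - sum f V) + (\<Sum>v\<in>V. h (Some v) * ennreal (f v))"
    by (simp add: g_def cong: sum.cong)
qed

lemma set_selection: "set_pmf (selection V f) \<subseteq> insert None (Some ` V)"
proof (cases "finite V \<and> (\<forall>v\<in>V. 0 \<le> f v) \<and> sum f V \<le> 1")
  case True
  then have *: "pmf (selection V f) z = (case z of None \<Rightarrow> 1 - sum f V | Some v \<Rightarrow> if v \<in> V then f v else 0)" for z
    by (intro pmf_selection) auto
  show ?thesis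
  proof
    fix z assume "z \<in> set_pmf (selection V f)"
    then have "pmf (selection V f) z \<noteq> 0" by (simp add: set_pmf_iff)
    then show "z \<in> insert None (Some ` V)" unfolding * by (cases z) (auto split: if_splits)
  qed
next
  case False
  show ?thesis unfolding selection_def if_not_P[OF False] by simp
qed

lemma finite_set_selection: "finite (set_pmf (selection V f))"
proof (cases "finite V")
  case True
  then show ?thesis by (intro finite_subset[OF set_selection]) simp
qed (simp add: selection_def)

lemma finite_set_sample: "finite (set_pmf (sample G w s a b))"
  unfolding sample_def by (auto split: action.split intro: finite_set_selection)

lemma finite_set_transition: "finite (set_pmf (transition G w s r))"
  unfolding transition_def by (auto simp: finite_set_sample)

lemma rad_pos [simp]: "0 < rad j" by (simp add: rad_def)

lemma rad_level:
  assumes "0 < d" shows "16 * rad (level d) \<le> d" "d < 32 * rad (level d)"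
proof -
  have d: "d / 16 = 2 powr log 2 (d / 16)" using assms by simp
  have "rad (level d) \<le> 2 powr log 2 (d / 16)"
    unfolding rad_def level_def by (intro powr_mono) auto
  then show "16 * rad (level d) \<le> d" using d by simp
  have "2 powr log 2 (d / 16) < 2 powr (1 + real_of_int (level d))"
    unfolding level_def by (intro powr_less_mono) linarith+
  also have "\<dots> = 2 * rad (level d)" by (simp add: rad_def powr_add)
  finally show "d < 32 * rad (level d)" using d by simp
qed

lemma limit_ge: "0 \<le> limit i"
  unfolding limit_def by simp

lemma action_cases:
  obtains (free) "action G w s a b = Free" "gap G w s a b \<le> 0"
  | (merge) h h' where "action G w s a b = Merge h h'" "0 < gap G w s a b"
      "near_hub G w s (level (gap G w s a b)) a h" "near_hub G w s (level (gap G w s a b)) b h'"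
  | (facility) v x where "action G w s a b = Facility v" "0 < gap G w s a b" "x \<in> {a, b}"
      "\<nexists>h. near_hub G w s (level (gap G w s a b)) x h" "v \<in> facilities G s"
      "v \<in> rim G w (rad (level (gap G w s a b))) x"
  | (priv) x where "action G w s a b =
        Private x (sum (wt s) (rim G w (rad (level (gap G w s a b))) x) < limit (clock s))"
      "0 < gap G w s a b" "x \<in> {a, b}"
      "\<nexists>h. near_hub G w s (level (gap G w s a b)) x h"
      "facilities G s \<inter> rim G w (rad (level (gap G w s a b))) x = {}"
proof -
  let ?j = "level (gap G w s a b)"
  define x where "x = (if \<exists>h. near_hub G w s ?j a h then b else a)"
  let ?B = "rim G w (rad ?j) x"
  have act: "action G w s a b = (if gap G w s a b \<le> 0 then Free
         else if \<exists>h. near_hub G w s ?j x h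
         then Merge (SOME h. near_hub G w s ?j a h) (SOME h. near_hub G w s ?j b h)
         else if facilities G s \<inter> ?B \<noteq> {} then Facility (SOME v. v \<in> facilities G s \<inter> ?B)
         else Private x (sum (wt s) ?B < limit (clock s)))"
    unfolding action_def Let_def x_def ..
  show thesis
  proof (cases "gap G w s a b \<le> 0")
    case True
    then show thesis using act free by simp
  next
    case pos: False
    show thesis
    proof (cases "\<exists>h. near_hub G w s ?j x h")
      case True
      then have "\<exists>h. near_hub G w s ?j a h" "\<exists>h. near_hub G w s ?j b h"
        by (auto simp: x_def split: if_splits)
      then have "near_hub G w s ?j a (SOME h. near_hub G w s ?j a h)"
        "near_hub G w s ?j b (SOME h. near_hub G w s ?j b h)" by (blast intro: someI_ex)+
      then show thesis using merge act pos True by simp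
    next
      case no: False
      have x: "x \<in> {a, b}" by (simp add: x_def)
      show thesis
      proof (cases "facilities G s \<inter> ?B = {}")
        case True
        then show thesis using priv[of x] act pos no x by simp
      next
        case False
        then have "(SOME v. v \<in> facilities G s \<inter> ?B) \<in> facilities G s \<inter> ?B"
          by (intro some_in_eq[THEN iffD2])
        then show thesis using facility[of "SOME v. v \<in> facilities G s \<inter> ?B" x] act pos no x False by simp
      qed
    qed
  qed
qed

lemma join_prob_range: "0 \<le> join_prob G w s r" "join_prob G w s r \<le> 1"
proof -
  obtain a b p where r: "r = (a, b, p)" by (cases r)
  have "0 \<le> join_prob G w s r \<and> join_prob G w s r \<le> 1"
  proof (cases "links G a b = {} \<or> ennreal (gap G w s a b) \<le> p")
    case True
    then show ?thesis by (auto simp: join_prob_def r)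
  next
    case False
    then have p: "p < ennreal (gap G w s a b)" by (simp add: not_le)
    then have "0 < gap G w s a b" by (metis ennreal_neg not_less not_less_zero)
    moreover have "enn2real p \<le> gap G w s a b"
      using p calculation by (simp add: enn2real_leI less_imp_le)
    ultimately show ?thesis using False by (auto simp: join_prob_def r)
  qed
  then show "0 \<le> join_prob G w s r" "join_prob G w s r \<le> 1" by auto
qed

lemma transition_cases:
  assumes "t \<in> set_pmf (transition G w s (a, b, p))"
  obtains (skip) "t = s\<lparr>skipped := insert (clock s) (skipped s), clock := Suc (clock s), resp := None\<rparr>"
  | (join) c where "links G a b \<noteq> {}" "c \<in> set_pmf (sample G w s a b)"
      "t = (connect G w s a b c)\<lparr>clock := Suc (clock s), resp := Some (solution G (connect G w s a b c))\<rparr>"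
proof -
  obtain z where z: "z \<in> set_pmf (bernoulli_pmf (join_prob G w s (a, b, p)))"
    and t: "t \<in> update G w s (a, b, p) ` set_pmf (if z then map_pmf Some (sample G w s a b) else return_pmf None)"
    using assms unfolding transition_def by (auto split: if_splits)
  show thesis
  proof (cases z)
    case True
    then have "join_prob G w s (a, b, p) \<noteq> 0" using z by (auto simp: set_pmf_iff)
    then have "links G a b \<noteq> {}" by (auto simp: join_prob_def)
    moreover obtain c where "c \<in> set_pmf (sample G w s a b)" "t = update G w s (a, b, p) (Some c)"
      using t True by auto
    ultimately show thesis by (intro join[of c]) (auto simp: update_def Let_def)
  next
    case False
    then show thesis using t skip by (auto simp: update_def)
  qed
qed

section \<open>Components of hubs and basic properties of a connection step\<close>

definition component :: "('v, 'e) pre_digraph \<Rightarrow> 'v set \<Rightarrow> 'v \<Rightarrow> 'v set" where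
  "component G T h = {u. h \<rightarrow>\<^sup>*\<^bsub>G \<restriction> T\<^esub> u}"

text \<open>The level stays in the pair, so that hubs of one level in one component count once,
  while hubs of different levels keep separate shares of the potential.\<close>

definition comps :: "('v, 'e) pre_digraph \<Rightarrow> 'v set \<Rightarrow> (int \<times> 'v) set \<Rightarrow> (int \<times> 'v set) set" where
  "comps G T H = (\<lambda>(j, h). (j, component G T h)) ` H"

definition rad_sum :: "(int \<times> 'a) set \<Rightarrow> real" where
  "rad_sum A = (\<Sum>x\<in>A. rad (fst x))"

definition event_sum :: "'v state \<Rightarrow> real" where
  "event_sum s = (\<Sum>e\<in>events s. rad (fst (snd e)))"

lemma rad_sum_insert: "finite A \<Longrightarrow> rad_sum (insert (j, x) A) \<le> rad_sum A + rad j"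
  by (cases "(j, x) \<in> A") (auto simp: rad_sum_def insert_absorb less_imp_le)

context node_weighted begin

lemma component_eq_iff:
  assumes "h' \<in> T"
  shows "component G T h = component G T h' \<longleftrightarrow> h \<rightarrow>\<^sup>*\<^bsub>G \<restriction> T\<^esub> h'"
proof
  assume "component G T h = component G T h'"
  moreover have "h' \<in> component G T h'" using assms by (simp add: component_def reachable_refl_in)
  ultimately have "h' \<in> component G T h" by simp
  then show "h \<rightarrow>\<^sup>*\<^bsub>G \<restriction> T\<^esub> h'" by (simp add: component_def)
next
  assume h: "h \<rightarrow>\<^sup>*\<^bsub>G \<restriction> T\<^esub> h'"
  show "component G T h = component G T h'"
    unfolding component_def
    by (rule Collect_cong, rule iffI) (rule reachable_trans_in[OF reachable_sym[OF h]] reachable_trans_in[OF h], assumption)+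
qed

lemma Union_component:
  assumes "T \<subseteq> T'" "h \<in> T"
  shows "(\<Union>u\<in>component G T h. component G T' u) = component G T' h"
proof -
  have "component G T' u = component G T' h" if "u \<in> component G T h" for u
  proof -
    have "h \<rightarrow>\<^sup>*\<^bsub>G \<restriction> T'\<^esub> u" using that assms(1) unfolding component_def by (auto intro: reachable_induce_ss)
    then show ?thesis using component_eq_iff[of u T' h] reachable_in by auto
  qed
  moreover have "h \<in> component G T h" using assms(2) by (auto simp: component_def intro: reachable_refl_in)
  ultimately show ?thesis by blast
qed

text \<open>Enlarging the solution only glues components together. Written as an image of the old
  pairs, the new potential is a sum over an image set and hence cannot exceed the old one.\<close>

lemma comps_coarsen:
  assumes "T \<subseteq> T'" "snd ` H \<subseteq> T"
  shows "comps G T' H = (\<lambda>(j, c). (j, \<Union>u\<in>c. component G T' u)) ` comps G T H"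
proof -
  have "comps G T' H = (\<lambda>(j, h). (j, \<Union>u\<in>component G T h. component G T' u)) ` H"
    unfolding comps_def
  proof (rule image_cong[OF refl])
    fix x assume "x \<in> H"
    then have "snd x \<in> T" using assms(2) by auto
    then show "(case x of (j, h) \<Rightarrow> (j, component G T' h)) = (case x of (j, h) \<Rightarrow> (j, \<Union>u\<in>component G T h. component G T' u))"
      using Union_component[OF assms(1)] by (simp add: case_prod_beta')
  qed
  then show ?thesis unfolding comps_def by (simp add: image_image case_prod_beta')
qed

lemma rad_sum_image_le: "finite A \<Longrightarrow> rad_sum ((\<lambda>(j, c). (j, f c)) ` A) \<le> rad_sum A"
  unfolding rad_sum_def
  by (rule order_trans[OF sum_image_le]) (auto simp: case_prod_beta' less_imp_le)

lemma rad_sum_comps_mono: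
  assumes "T \<subseteq> T'" "snd ` H \<subseteq> T" "finite H"
  shows "rad_sum (comps G T' H) \<le> rad_sum (comps G T H)"
  unfolding comps_coarsen[OF assms(1,2)] using assms(3) by (intro rad_sum_image_le) (simp add: comps_def)

text \<open>The components of \<open>h\<close> and \<open>h'\<close> have the same image after
  gluing, so one of the two pairs can be removed before the image is taken; this saves its
  \<open>rad j\<close>.\<close>

lemma rad_sum_comps_merge:
  assumes "T \<subseteq> T'" "snd ` H \<subseteq> T" "finite H" "(j, h) \<in> H" "(j, h') \<in> H"
    and "\<not> h \<rightarrow>\<^sup>*\<^bsub>G \<restriction> T\<^esub> h'" "h \<rightarrow>\<^sup>*\<^bsub>G \<restriction> T'\<^esub> h'"
  shows "rad_sum (comps G T' H) + rad j \<le> rad_sum (comps G T H)"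
proof -
  let ?f = "\<lambda>(j :: int, c). (j, \<Union>u\<in>c. component G T' u)"
  let ?A = "comps G T H" and ?x = "(j, component G T h)" and ?y = "(j, component G T h')"
  have hT: "h \<in> T" "h' \<in> T" using assms(2,4,5) by auto
  have fin: "finite ?A" using assms(3) by (simp add: comps_def)
  have xy: "?x \<in> ?A" "?y \<in> ?A" using assms(4,5) by (force simp: comps_def)+
  have ne: "?x \<noteq> ?y" using component_eq_iff[OF hT(2)] assms(6) by simp
  have fxy: "?f ?x = ?f ?y"
    using Union_component[OF assms(1)] component_eq_iff[of h' T' h] hT assms(1,7) by auto
  have "?f ` ?A = ?f ` insert ?y (?A - {?y})" using xy by (simp add: insert_absorb)
  also have "\<dots> = insert (?f ?x) (?f ` (?A - {?y}))" unfolding fxy by (rule image_insert)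
  also have "\<dots> = ?f ` (?A - {?y})" using xy ne by (intro insert_absorb imageI) auto
  finally have "?f ` ?A = ?f ` (?A - {?y})" .
  then have "rad_sum (comps G T' H) \<le> rad_sum (?A - {?y})"
    unfolding comps_coarsen[OF assms(1,2)] using rad_sum_image_le[of "?A - {?y}"] fin by simp
  also have "\<dots> = rad_sum ?A - rad j"
    unfolding rad_sum_def using fin xy by (simp add: sum_diff1)
  finally show ?thesis by simp
qed

text \<open>The bound 3 on the weights is generous: a raised weight was below 1 and grows by at most
  1. Injectivity of \<open>fst\<close> on the events says that a request creates at most one event,
  which \<open>small_events\<close> counts.\<close>

definition sane :: "'v state \<Rightarrow> bool" where
  "sane s \<longleftrightarrow> trunk s \<subseteq> V \<and> fac s \<subseteq> V \<and> (\<forall>v\<in>V. 0 \<le> wt s v \<and> wt s v \<le> 3) \<and>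
     finite (hubs s) \<and> snd ` hubs s \<subseteq> solution G s \<and> finite (events s) \<and>
     (\<forall>e\<in>events s. fst e < clock s) \<and> inj_on fst (events s)"

lemma facilities_subset: "sane s \<Longrightarrow> facilities G s \<subseteq> V"
  by (auto simp: sane_def facilities_def)

lemma solution_subset: "sane s \<Longrightarrow> solution G s \<subseteq> V"
  using facilities_subset by (auto simp: sane_def solution_def)

lemma rim_subset: "rim G w r x \<subseteq> V"
  by (auto simp: rim_def)

lemma increment_nonneg: "sane s \<Longrightarrow> v \<in> V \<Longrightarrow> 0 \<le> increment G w s j x v"
  unfolding increment_def using w_nonneg[of v] limit_ge[of "clock s"] by (auto simp: sane_def less_imp_le)

text \<open>Rim vertices weigh at least \<open>rad j\<close>, and the summand 2 beside
  \<open>limit\<close> gives the bound 1 / 2, which is what makes \<open>ln (1 + y)\<close> at least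
  \<open>y / 2\<close> in \<open>connect_growth_bound\<close>.\<close>

lemma increment_ratio:
  assumes "v \<in> rim G w (rad j) x"
  shows "0 < w v" "0 < rad j / (w v * (limit i + 2))" "rad j / (w v * (limit i + 2)) \<le> 1 / 2"
proof -
  have r: "rad j \<le> w v" using assms by (simp add: rim_def)
  then show wp: "0 < w v" using rad_pos[of j] by linarith
  have l: "0 \<le> limit i" by (rule limit_ge)
  show "0 < rad j / (w v * (limit i + 2))" using wp l by simp
  have "rad j * 2 \<le> w v * (limit i + 2)" using r wp l by (intro mult_mono) auto
  moreover have "0 < w v * (limit i + 2)" using wp l by simp
  ultimately show "rad j / (w v * (limit i + 2)) \<le> 1 / 2" by (subst pos_divide_le_eq) auto
qed

lemma increment_le_1:
  assumes "sane s" "facilities G s \<inter> rim G w (rad j) x = {}" "v \<in> V"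
  shows "increment G w s j x v \<le> 1" "wt s v + increment G w s j x v \<le> 3"
proof -
  have n: "1 \<le> real (card V)" using assms(3) by (metis One_nat_def Suc_leI card_gt_0_iff empty_iff finV of_nat_1 of_nat_le_iff)
  have "increment G w s j x v \<le> 1 \<and> wt s v + increment G w s j x v \<le> 3"
  proof (cases "v \<in> rim G w (rad j) x")
    case True
    then have lt: "wt s v < 1" "0 \<le> wt s v" using assms by (auto simp: facilities_def sane_def)
    have "increment G w s j x v \<le> 1 / 2 * (1 + 1)"
      unfolding increment_def if_P[OF True] using increment_ratio(1)[OF True] increment_ratio(2,3)[OF True, of "clock s"] lt n
      by (intro mult_mono add_mono) (auto simp: field_simps)
    then show ?thesis using lt by simp
  next
    case False
    then show ?thesis using assms by (auto simp: increment_def sane_def)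
  qed
  then show "increment G w s j x v \<le> 1" "wt s v + increment G w s j x v \<le> 3" by auto
qed

text \<open>Over a rim the additive terms 1 / n sum to at most 1. The factor \<open>w v\<close>
  cancels against the denominator in the first bound; in the second, \<open>rad j / w v\<close> is
  at most 1.\<close>

lemma sum_weight_increment:
  assumes "sane s" "V \<noteq> {}"
  shows "(\<Sum>v\<in>rim G w (rad j) x. w v * increment G w s j x v)
    \<le> rad j / (limit (clock s) + 2) * (sum (wt s) (rim G w (rad j) x) + 1)"
    and "sum (increment G w s j x) (rim G w (rad j) x)
    \<le> (sum (wt s) (rim G w (rad j) x) + 1) / (limit (clock s) + 2)"
proof -
  let ?B = "rim G w (rad j) x" and ?L = "limit (clock s) + 2" and ?n = "real (card V)"
  have L: "0 < ?L" using limit_ge[of "clock s"] by simp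
  have n: "0 < ?n" using assms(2) by (simp add: card_gt_0_iff)
  have B: "real (card ?B) * (1 / ?n) \<le> 1" using n card_mono[OF finV rim_subset] by (simp add: field_simps)
  have S: "(\<Sum>v\<in>?B. wt s v + 1 / ?n) \<le> sum (wt s) ?B + 1" using B by (simp add: sum.distrib)
  have "(\<Sum>v\<in>?B. w v * increment G w s j x v) = (\<Sum>v\<in>?B. rad j / ?L * (wt s v + 1 / ?n))"
  proof (rule sum.cong)
    fix v assume v: "v \<in> ?B"
    have "w v * (rad j / (w v * ?L) * y) = rad j / ?L * y" for y
      using increment_ratio(1)[OF v] L by (simp del: distrib_left_numeral)
    then show "w v * increment G w s j x v = rad j / ?L * (wt s v + 1 / ?n)"
      by (simp only: increment_def if_P[OF v])
  qed simp
  also have "\<dots> = rad j / ?L * (\<Sum>v\<in>?B. wt s v + 1 / ?n)" by (simp add: sum_distrib_left)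
  also have "\<dots> \<le> rad j / ?L * (sum (wt s) ?B + 1)" using S L less_imp_le[OF rad_pos[of j]] by (intro mult_left_mono divide_nonneg_pos) auto
  finally show "(\<Sum>v\<in>?B. w v * increment G w s j x v) \<le> rad j / ?L * (sum (wt s) ?B + 1)" .
  have "sum (increment G w s j x) ?B \<le> (\<Sum>v\<in>?B. 1 / ?L * (wt s v + 1 / ?n))"
  proof (rule sum_mono)
    fix v assume v: "v \<in> ?B"
    have w: "rad j \<le> w v" "v \<in> V" using v by (simp_all add: rim_def)
    have pos: "0 < w v" "0 \<le> wt s v" using increment_ratio(1)[OF v] w assms(1) by (simp_all add: sane_def)
    have "rad j / w v \<le> 1" using pos w by simp
    then have "rad j / w v / ?L \<le> 1 / ?L" using L by (intro divide_right_mono) auto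
    then have "rad j / (w v * ?L) \<le> 1 / ?L" unfolding divide_divide_eq_left .
    then have "rad j / (w v * ?L) * (wt s v + 1 / ?n) \<le> 1 / ?L * (wt s v + 1 / ?n)"
      using pos n by (intro mult_right_mono) auto
    then show "increment G w s j x v \<le> 1 / ?L * (wt s v + 1 / ?n)" using v by (simp add: increment_def)
  qed
  also have "\<dots> = (\<Sum>v\<in>?B. wt s v + 1 / ?n) / ?L" by (simp add: sum_divide_distrib)
  also have "\<dots> \<le> (sum (wt s) ?B + 1) / ?L" using S L by (intro divide_right_mono) auto
  finally show "sum (increment G w s j x) ?B \<le> (sum (wt s) ?B + 1) / ?L" .
qed

lemma connect_facilities_mono:
  assumes "sane s" shows "facilities G s \<subseteq> facilities G (connect G w s a b c)"
  unfolding connect_def Let_def facilities_def using increment_nonneg[OF assms]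
  by (auto split: action.split intro: order_trans add_increasing2)

text \<open>A uniform view of all four actions: each buys the missing part of some link
  \<open>X\<close>. Only a merge pays more than the gap, namely at most \<open>4 * rad\<close> extra
  for each of its two hubs.\<close>

lemma connect_path:
  assumes "sane s" "links G a b \<noteq> {}"
  obtains X where "X \<in> links G a b" "trunk (connect G w s a b c) = trunk s \<union> (X - solution G s)"
    "gap G w s a b \<le> link_cost w (solution G s) X"
    "(\<nexists>h h'. action G w s a b = Merge h h') \<longrightarrow> link_cost w (solution G s) X = gap G w s a b"
    "\<forall>h h'. action G w s a b = Merge h h' \<longrightarrow> X \<in> links G a h \<and> X \<in> links G b h' \<and>
       link_cost w (solution G s) X \<le> gap G w s a b + 8 * rad (level (gap G w s a b))"
proof -
  let ?T = "solution G s" and ?X = "cheapest G w (solution G s) a b"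
  let ?j = "level (gap G w s a b)"
  have X: "?X \<in> links G a b" "link_cost w ?T ?X = gap G w s a b"
    using cheapest_in[OF assms(2)] by (auto simp: gap_def remaining_def)
  show thesis
  proof (cases rule: action_cases[of G w s a b])
    case (merge h h')
    let ?Y = "cheapest G w {h} a h" and ?Z = "cheapest G w {h'} b h'"
    have near_link: "cheapest G w {h} x h \<in> links G x h \<and> link_cost w ?T (cheapest G w {h} x h) \<le> 4 * rad ?j"
      if nh: "near_hub G w s ?j x h" for x h
    proof -
      have hT: "h \<in> ?T" using nh assms(1) by (force simp: near_hub_def sane_def)
      obtain A where A: "A \<in> links G x h" "link_cost w {h} A \<le> 4 * rad ?j"
        using nh by (auto simp: near_hub_def near_def)
      then have C: "cheapest G w {h} x h \<in> links G x h" by (intro cheapest_in) auto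
      have "link_cost w ?T (cheapest G w {h} x h) \<le> link_cost w {h} (cheapest G w {h} x h)"
        using C hT by (intro link_cost_antimono) (auto dest: link_subset)
      also have "\<dots> \<le> link_cost w {h} A" using remaining_le[OF A(1), of "{h}"] by (simp add: remaining_def)
      finally show ?thesis using A C by simp
    qed
    note Y = near_link[OF merge(3)] and Z = near_link[OF merge(4)]
    define U where "U = ?X \<union> (?Y \<union> ?Z)"
    have UV: "U \<subseteq> V" "?X \<subseteq> V" "?Y \<subseteq> V" "?Z \<subseteq> V" using X Y Z by (auto simp: U_def dest: link_subset)
    have "link_cost w ?T U \<le> link_cost w ?T ?X + (link_cost w ?T ?Y + link_cost w ?T ?Z)"
      unfolding U_def using UV by (intro order_trans[OF link_cost_Un] add_left_mono link_cost_Un) auto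
    then have U: "link_cost w ?T U \<le> gap G w s a b + 8 * rad ?j" using X Y Z by simp
    have up: "A \<in> links G p q \<Longrightarrow> A \<subseteq> U \<Longrightarrow> U \<in> links G p q" for p q A
      using links_mono UV(1) by blast
    have L: "U \<in> links G a b" "U \<in> links G a h" "U \<in> links G b h'"
      using up[OF X(1)] up[OF conjunct1[OF Y]] up[OF conjunct1[OF Z]] by (auto simp: U_def)
    show thesis
    proof (rule that[of U])
      show "trunk (connect G w s a b c) = trunk s \<union> (U - ?T)"
        by (simp add: connect_def Let_def merge(1) U_def)
      show "gap G w s a b \<le> link_cost w ?T U" unfolding gap_def by (rule remaining_le[OF L(1)])
      show "(\<nexists>h h'. action G w s a b = Merge h h') \<longrightarrow> link_cost w ?T U = gap G w s a b"
        using merge(1) by simp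
      show "\<forall>p q. action G w s a b = Merge p q \<longrightarrow> U \<in> links G a p \<and> U \<in> links G b q \<and>
          link_cost w ?T U \<le> gap G w s a b + 8 * rad (level (gap G w s a b))"
        using merge(1) L U by simp
    qed (rule L)
  next
    case free
    show thesis by (rule that[of ?X]) (use X free(1) in \<open>simp_all add: connect_def Let_def\<close>)
  next
    case (facility v x)
    show thesis by (rule that[of ?X]) (use X facility(1) in \<open>simp_all add: connect_def Let_def\<close>)
  next
    case (priv x)
    show thesis by (rule that[of ?X]) (use X priv(1) in \<open>simp_all add: connect_def Let_def\<close>)
  qed
qed

lemma connect_solution:
  assumes "sane s" "links G a b \<noteq> {}"
  shows "solution G s \<subseteq> solution G (connect G w s a b c)"
    and "solution G (connect G w s a b c) \<subseteq> V \<Longrightarrow> solution G (connect G w s a b c) \<in> links G a b"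
proof -
  obtain X where X: "X \<in> links G a b" "trunk (connect G w s a b c) = trunk s \<union> (X - solution G s)"
    by (rule connect_path[OF assms, of c])
  show 1: "solution G s \<subseteq> solution G (connect G w s a b c)"
    using X(2) connect_facilities_mono[OF assms(1), of a b c] by (auto simp: solution_def)
  then have "X \<subseteq> solution G (connect G w s a b c)" using X(2) by (auto simp: solution_def)
  then show "solution G (connect G w s a b c) \<in> links G a b" if "solution G (connect G w s a b c) \<subseteq> V"
    using that by (rule links_mono[OF X(1)])
qed

end

section \<open>Invariants\<close>

lemma facilities_update [simp]:
  "facilities G (s\<lparr>clock := n\<rparr>) = facilities G s"
  "facilities G (s\<lparr>resp := r\<rparr>) = facilities G s"
  "facilities G (s\<lparr>skipped := N\<rparr>) = facilities G s"
  by (simp_all add: facilities_def)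

lemma solution_update [simp]:
  "solution G (s\<lparr>clock := n\<rparr>) = solution G s"
  "solution G (s\<lparr>resp := r\<rparr>) = solution G s"
  "solution G (s\<lparr>skipped := N\<rparr>) = solution G s"
  by (simp_all add: solution_def)

lemma sample_subset:
  assumes "c \<in> set_pmf (sample G w s a b)" "action G w s a b = Private x g"
  shows "set_option c \<subseteq> rim G w (rad (level (gap G w s a b))) x"
  using assms set_selection by (fastforce simp: sample_def split: if_splits)

context node_weighted begin

lemma sane_initial: "sane initial"
  by (simp add: sane_def initial_def)

lemma rim_near: "v \<in> rim G w (rad j) x \<Longrightarrow> near G w (4 * rad j) x v"
  by (rule near_mono[of "rad j"]) (auto simp: rim_def less_imp_le)

lemma link_ends_V: "links G a b \<noteq> {} \<Longrightarrow> a \<in> V \<and> b \<in> V"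
  using link_ends link_subset by blast

lemma connect_ends:
  assumes "sane s" "links G a b \<noteq> {}"
  shows "a \<in> solution G (connect G w s a b c)" "b \<in> solution G (connect G w s a b c)"
proof -
  obtain X where X: "X \<in> links G a b" "trunk (connect G w s a b c) = trunk s \<union> (X - solution G s)"
    by (rule connect_path[OF assms, of c])
  have "X \<subseteq> solution G (connect G w s a b c)"
    using X(2) connect_solution(1)[OF assms, of c] by (auto simp: solution_def)
  then show "a \<in> solution G (connect G w s a b c)" "b \<in> solution G (connect G w s a b c)"
    using link_ends[OF X(1)] by auto
qed

lemma transition_sane:
  assumes s: "sane s" and t: "t \<in> set_pmf (transition G w s (a, b, p))"
  shows "sane t"
  using t
proof (cases rule: transition_cases)
  case skip
  then show ?thesis using s by (auto simp: sane_def less_SucI)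
next
  case (join c)
  note [simp] = connect_def Let_def
  obtain X where X: "X \<in> links G a b" "trunk (connect G w s a b c) = trunk s \<union> (X - solution G s)"
    by (rule connect_path[OF s join(1), of c])
  have P: "trunk t \<subseteq> V" using X link_subset[OF X(1)] s unfolding join(3) by (auto simp: sane_def simp del: connect_def)
  have S: "solution G s \<subseteq> solution G t"
    using connect_solution(1)[OF s join(1), of c] unfolding join(3) by (simp del: connect_def)
  have ab: "a \<in> solution G t" "b \<in> solution G t"
    using connect_ends[OF s join(1), of c] unfolding join(3) by (simp_all del: connect_def)
  have H: "snd ` hubs s \<subseteq> solution G t" using S s by (auto simp: sane_def)
  have E: "\<forall>e\<in>events s. fst e < Suc (clock s)" using s by (auto simp: sane_def less_SucI)
  show ?thesis
  proof (cases rule: action_cases[of G w s a b])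
    case free
    then have "fac t = fac s" "wt t = wt s" "hubs t = hubs s" "events t = events s" "clock t = Suc (clock s)"
      by (simp_all add: join(3))
    then show ?thesis unfolding sane_def using P H E s by (simp add: sane_def)
  next
    case (merge h h')
    then have "fac t = fac s" "wt t = wt s" "hubs t = hubs s" "events t = events s" "clock t = Suc (clock s)"
      by (simp_all add: join(3))
    then show ?thesis unfolding sane_def using P H E s by (simp add: sane_def)
  next
    case (facility v x)
    then have "fac t = fac s" "wt t = wt s" "hubs t = insert (level (gap G w s a b), v) (hubs s)"
      "events t = events s" "clock t = Suc (clock s)"
      by (simp_all add: join(3))
    moreover have "v \<in> solution G t" using facility(5) S by (auto simp: solution_def)
    ultimately show ?thesis unfolding sane_def using P H E s by (simp add: sane_def)
  next
    case (priv x)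
    let ?j = "level (gap G w s a b)" and ?g = "sum (wt s) (rim G w (rad (level (gap G w s a b))) x) < limit (clock s)"
    have t': "fac t = fac s \<union> set_option c"
      "wt t = (if ?g then (\<lambda>v. wt s v + increment G w s ?j x v) else wt s)"
      "hubs t = insert (?j, x) (hubs s)" "events t = insert (clock s, ?j, x, ?g) (events s)" "clock t = Suc (clock s)"
      using priv(1) by (simp_all add: join(3))
    have "fac t \<subseteq> V" using sample_subset[OF join(2) priv(1)] rim_subset s t'(1) by (auto simp: sane_def)
    moreover have "\<forall>v\<in>V. 0 \<le> wt t v \<and> wt t v \<le> 3"
      using increment_nonneg[OF s] increment_le_1(2)[OF s priv(5)] s t'(2) by (auto simp: sane_def)
    moreover have "x \<in> solution G t" using priv(3) ab by auto
    moreover have "inj_on fst (insert (clock s, ?j, x, ?g) (events s))"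
    proof -
      have "clock s \<notin> fst ` (events s - {(clock s, ?j, x, ?g)})" using s by (auto simp: sane_def)
      then show ?thesis using s by (simp add: sane_def)
    qed
    ultimately show ?thesis unfolding sane_def t'(3-5) using P H E s by (simp add: sane_def)
  qed
qed

text \<open>
  The components of the hubs serve as a potential: a merge creates no hub, but pays with the component
  that it removes.
\<close>

definition cost_bound :: "'v state \<Rightarrow> bool" where
  "cost_bound s \<longleftrightarrow> sum w (trunk s) + 40 * rad_sum (comps G (solution G s) (hubs s)) \<le> 80 * rad_sum (hubs s)"

text \<open>Every hub has someone to pay for its radius: either its own facility weight, which
  bounds the radius, or an event with the same level and centre.\<close>

definition hub_origin :: "'v state \<Rightarrow> bool" where
  "hub_origin s \<longleftrightarrow> (\<forall>(j, h)\<in>hubs s. (h \<in> facilities G s \<and> rad j \<le> w h) \<or> (\<exists>i g. (i, j, h, g) \<in> events s))"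

text \<open>The fractional cost of the weights. An update raises it by at most the radius of its
  event, since the rim carries weight below \<open>limit\<close> at that moment.\<close>

definition weight_bound :: "'v state \<Rightarrow> bool" where
  "weight_bound s \<longleftrightarrow> (\<Sum>v\<in>V. w v * wt s v) \<le> event_sum s"

text \<open>A terminal becomes a private hub only if it has no near hub of its level. This excludes
  nearness from the later to the earlier centre only, whence the negated conjunction of both
  directions.\<close>

definition separated :: "'v state \<Rightarrow> bool" where
  "separated s \<longleftrightarrow> (\<forall>i j x g. (i, j, x, g) \<in> events s \<longrightarrow> (j, x) \<in> hubs s) \<and>
     (\<forall>i j x g i' x' g'. (i, j, x, g) \<in> events s \<longrightarrow> (i', j, x', g') \<in> events s \<longrightarrow>
        (i, x, g) \<noteq> (i', x', g') \<longrightarrow> \<not> (near G w (4 * rad j) x x' \<and> near G w (4 * rad j) x' x))"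

definition good_near :: "'v state \<Rightarrow> 'v \<Rightarrow> real" where
  "good_near s v = (\<Sum>(i, j, x, g)\<in>{(i, j, x, g)\<in>events s. g \<and> v \<in> rim G w (rad j) x}. rad j)"

text \<open>\<open>good_near s v\<close> is the total radius of the events that raised the weight of
  \<open>v\<close>. The parameter \<open>K\<close> bounds the request indices, so that
  \<open>limit K\<close> dominates every \<open>limit\<close> used so far.\<close>

definition growth_bound :: "nat \<Rightarrow> 'v state \<Rightarrow> bool" where
  "growth_bound K s \<longleftrightarrow> (\<forall>v\<in>V. good_near s v \<le> 2 * w v * (limit K + 2) * ln (real (card V) * wt s v + 1))"

lemma sum_trunk_connect:
  assumes "sane s" "X \<subseteq> V" "trunk t = trunk s \<union> (X - solution G s)"
  shows "sum w (trunk t) = sum w (trunk s) + link_cost w (solution G s) X"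
proof -
  have "trunk s \<inter> (X - solution G s) = {}" by (auto simp: solution_def)
  moreover have "finite (trunk s)" "finite (X - solution G s)"
    using assms(1,2) finite_subV by (auto simp: sane_def)
  ultimately show ?thesis unfolding assms(3) link_cost_def by (intro sum.union_disjoint)
qed

lemma rad_sum_comps_insert:
  "finite H \<Longrightarrow> rad_sum (comps G T (insert (j, h) H)) \<le> rad_sum (comps G T H) + rad j"
  unfolding comps_def by (simp add: rad_sum_insert)

text \<open>A new hub adds \<open>80 * rad\<close> on the right, against less than
  \<open>32 * rad\<close> for the link and at most \<open>40 * rad\<close> for a new component. A
  merge costs less than \<open>(32 + 8) * rad\<close> and is paid by the component that
  disappears.\<close>

lemma connect_cost_bound:
  assumes s: "sane s" "cost_bound s" and ab: "links G a b \<noteq> {}"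
    and V: "solution G (connect G w s a b c) \<subseteq> V"
  shows "cost_bound (connect G w s a b c)"
proof -
  let ?t = "connect G w s a b c" and ?j = "level (gap G w s a b)"
  note mono = connect_solution(1)[OF s(1) ab, of c]
  have hs: "snd ` hubs s \<subseteq> solution G s" "finite (hubs s)" using s(1) by (auto simp: sane_def)
  note cmono = rad_sum_comps_mono[OF mono hs]
  have new: "cost_bound ?t" if h: "hubs ?t = insert (?j, h) (hubs s)" "(?j, h) \<notin> hubs s"
    and pos: "0 < gap G w s a b" and X: "X \<subseteq> V" "trunk ?t = trunk s \<union> (X - solution G s)"
      "link_cost w (solution G s) X = gap G w s a b" for h X
  proof -
    have "rad_sum (hubs ?t) = rad_sum (hubs s) + rad ?j"
      unfolding h(1) rad_sum_def using h(2) hs(2) by simp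
    moreover have "rad_sum (comps G (solution G ?t) (hubs ?t)) \<le> rad_sum (comps G (solution G s) (hubs s)) + rad ?j"
      unfolding h(1) using rad_sum_comps_insert[OF hs(2), of "solution G ?t" ?j h] cmono by simp
    moreover have "sum w (trunk ?t) = sum w (trunk s) + gap G w s a b"
      using sum_trunk_connect[OF s(1) X(1,2)] X(3) by simp
    moreover have "gap G w s a b < 32 * rad ?j" using rad_level(2)[OF pos] .
    ultimately show ?thesis using s(2) rad_pos[of ?j] unfolding cost_bound_def by linarith
  qed
  obtain X where X: "X \<in> links G a b" "trunk ?t = trunk s \<union> (X - solution G s)"
    and "gap G w s a b \<le> link_cost w (solution G s) X"
    and X3: "(\<nexists>h h'. action G w s a b = Merge h h') \<longrightarrow> link_cost w (solution G s) X = gap G w s a b"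
    and X4: "\<forall>h h'. action G w s a b = Merge h h' \<longrightarrow> X \<in> links G a h \<and> X \<in> links G b h' \<and>
       link_cost w (solution G s) X \<le> gap G w s a b + 8 * rad (level (gap G w s a b))"
    by (rule connect_path[OF s(1) ab, of c])
  note XV = link_subset[OF X(1)]
  show ?thesis
  proof (cases rule: action_cases[of G w s a b])
    case free
    have h: "hubs ?t = hubs s" using free(1) by (simp add: connect_def Let_def)
    have "gap G w s a b = 0" using free(2) remaining_nonneg[OF ab] by (simp add: gap_def antisym)
    then have "sum w (trunk ?t) = sum w (trunk s)"
      using sum_trunk_connect[OF s(1) XV X(2)] X3 free(1) by simp
    then show ?thesis using s(2) cmono unfolding cost_bound_def h by simp
  next
    case (merge h h')
    have hb: "hubs ?t = hubs s" using merge(1) by (simp add: connect_def Let_def)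
    have hubs: "(?j, h) \<in> hubs s" "(?j, h') \<in> hubs s"
      and nr: "near G w (4 * rad ?j) a h" "near G w (4 * rad ?j) b h'"
      using merge by (auto simp: near_hub_def)
    have hT: "h \<in> solution G s" "h' \<in> solution G s" using hs hubs by force+
    have d: "16 * rad ?j \<le> gap G w s a b" "gap G w s a b < 32 * rad ?j" using rad_level[OF merge(2)] by auto
    have nj: "\<not> h \<rightarrow>\<^sup>*\<^bsub>G \<restriction> solution G s\<^esub> h'"
    proof (rule hubs_not_joined[OF nr hT solution_subset[OF s(1)]])
      have "2 * (4 * rad ?j) < gap G w s a b" using d rad_pos[of ?j] by linarith
      then show "2 * (4 * rad ?j) < remaining G w (solution G s) a b" by (simp add: gap_def)
    qed
    have "X \<in> links G h h'"
      using X4[rule_format, OF merge(1)] links_Un[of X h a X b] links_Un[of X h b X h'] X(1) links_sym by auto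
    moreover have "X \<subseteq> solution G ?t" using X(2) mono by (auto simp: solution_def)
    ultimately have "solution G ?t \<in> links G h h'" using V by (rule links_mono)
    then have j: "h \<rightarrow>\<^sup>*\<^bsub>G \<restriction> solution G ?t\<^esub> h'" by (simp add: links_def)
    have "rad_sum (comps G (solution G ?t) (hubs s)) + rad ?j \<le> rad_sum (comps G (solution G s) (hubs s))"
      by (rule rad_sum_comps_merge[OF mono hs hubs nj j])
    moreover have "sum w (trunk ?t) \<le> sum w (trunk s) + (gap G w s a b + 8 * rad ?j)"
      using sum_trunk_connect[OF s(1) XV X(2)] X4[rule_format, OF merge(1)] by simp
    ultimately show ?thesis using s(2) d(2) unfolding cost_bound_def hb by linarith
  next
    case (facility v x)
    have "hubs ?t = insert (?j, v) (hubs s)" using facility(1) by (simp add: connect_def Let_def)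
    \<comment> \<open>The hub must be new for the sum over the set of hubs to grow: an old hub on
      the rim of \<open>x\<close> would be a near hub of \<open>x\<close>.\<close>
    moreover have "(?j, v) \<notin> hubs s"
      using facility(4) rim_near[OF facility(6)] by (auto simp: near_hub_def)
    ultimately show ?thesis using new facility(2) XV X(2) X3 facility(1) by auto
  next
    case (priv x)
    have "hubs ?t = insert (?j, x) (hubs s)" using priv(1) by (simp add: connect_def Let_def)
    moreover have "(?j, x) \<notin> hubs s"
      using priv(3,4) link_ends_V[OF ab] near_refl[of x "4 * rad ?j"] rad_pos[of ?j]
      by (auto simp: near_hub_def less_imp_le)
    ultimately show ?thesis using new priv(2) XV X(2) X3 priv(1) by auto
  qed
qed

lemma connect_hub_origin:
  assumes "sane s" "hub_origin s"
  shows "hub_origin (connect G w s a b c)"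
proof -
  let ?t = "connect G w s a b c" and ?j = "level (gap G w s a b)"
  have F: "facilities G s \<subseteq> facilities G ?t" by (rule connect_facilities_mono[OF assms(1)])
  have E: "events s \<subseteq> events ?t" by (auto simp: connect_def Let_def split: action.split)
  have old: "(h \<in> facilities G ?t \<and> rad j \<le> w h) \<or> (\<exists>i g. (i, j, h, g) \<in> events ?t)"
    if "(j, h) \<in> hubs s" for j h
    using that assms(2) F E unfolding hub_origin_def by blast
  have "(h \<in> facilities G ?t \<and> rad j \<le> w h) \<or> (\<exists>i g. (i, j, h, g) \<in> events ?t)"
    if jh: "(j, h) \<in> hubs ?t" for j h
  proof (cases "(j, h) \<in> hubs s")
    case False
    show ?thesis
    proof (cases rule: action_cases[of G w s a b])
      case (facility v x)
      then show ?thesis using jh False F by (auto simp: connect_def Let_def rim_def)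
    next
      case (priv x)
      then show ?thesis using jh False by (auto simp: connect_def Let_def)
    qed (use jh False in \<open>auto simp: connect_def Let_def\<close>)
  qed (rule old)
  then show ?thesis unfolding hub_origin_def by blast
qed

lemma fresh_event: "sane s \<Longrightarrow> (clock s, e) \<notin> events s"
  by (auto simp: sane_def)

lemma event_sum_insert:
  "sane s \<Longrightarrow> (\<Sum>e\<in>insert (clock s, j, x, g) (events s). rad (fst (snd e))) = event_sum s + rad j"
  using fresh_event[of s "(j, x, g)"] by (simp add: event_sum_def sane_def)

lemma connect_weight_bound:
  assumes s: "sane s" "weight_bound s" and ab: "links G a b \<noteq> {}"
  shows "weight_bound (connect G w s a b c)"
proof -
  let ?t = "connect G w s a b c" and ?j = "level (gap G w s a b)"
  show ?thesis
  proof (cases rule: action_cases[of G w s a b])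
    case (priv x)
    let ?B = "rim G w (rad ?j) x"
    let ?g = "sum (wt s) ?B < limit (clock s)"
    have E: "event_sum ?t = event_sum s + rad ?j"
    proof -
      have "events ?t = insert (clock s, ?j, x, ?g) (events s)" using priv(1) by (simp add: connect_def Let_def)
      then show ?thesis using event_sum_insert[OF s(1)] unfolding event_sum_def[of ?t] by simp
    qed
    show ?thesis
    proof (cases ?g)
      case True
      have wt: "wt ?t = (\<lambda>v. wt s v + increment G w s ?j x v)"
        using priv(1) True by (simp add: connect_def Let_def)
      have "(\<Sum>v\<in>V. w v * increment G w s ?j x v) = (\<Sum>v\<in>?B. w v * increment G w s ?j x v)"
        by (rule sum.mono_neutral_right) (auto simp: rim_def increment_def)
      also have "\<dots> \<le> rad ?j / (limit (clock s) + 2) * (sum (wt s) ?B + 1)"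
        using link_ends_V[OF ab] by (intro sum_weight_increment[OF s(1)]) auto
      also have "\<dots> \<le> rad ?j / (limit (clock s) + 2) * (limit (clock s) + 2)"
        using True limit_ge[of "clock s"] less_imp_le[OF rad_pos[of ?j]]
        by (intro mult_left_mono divide_nonneg_pos) linarith+
      also have "\<dots> = rad ?j" using limit_ge[of "clock s"] by simp
      finally show ?thesis using s(2) E unfolding weight_bound_def wt by (simp add: distrib_left sum.distrib)
    next
      case False
      then have "wt ?t = wt s" using priv(1) by (simp add: connect_def Let_def)
      then show ?thesis using s(2) E less_imp_le[OF rad_pos[of ?j]] unfolding weight_bound_def by simp
    qed
  qed (use s(2) in \<open>simp_all add: connect_def Let_def weight_bound_def event_sum_def\<close>)
qed

lemma connect_separated:
  assumes s: "sane s" "separated s"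
  shows "separated (connect G w s a b c)"
proof (cases rule: action_cases[of G w s a b])
  case (priv x)
  let ?t = "connect G w s a b c" and ?j = "level (gap G w s a b)"
  let ?g = "sum (wt s) (rim G w (rad ?j) x) < limit (clock s)"
  have t: "events ?t = insert (clock s, ?j, x, ?g) (events s)" "hubs ?t = insert (?j, x) (hubs s)"
    using priv(1) by (simp_all add: connect_def Let_def)
  have old: "(j, x) \<in> hubs s" if "(i, j, x, g) \<in> events s" for i j x g
    using that s(2) unfolding separated_def by metis
  have old2: "\<not> (near G w (4 * rad j) y y' \<and> near G w (4 * rad j) y' y)"
    if "(i, j, y, g) \<in> events s" "(i', j, y', g') \<in> events s" "(i, y, g) \<noteq> (i', y', g')" for i j y g i' y' g'
    using that s(2) unfolding separated_def by metis
  have sep: "\<not> near G w (4 * rad ?j) x x'" if "(i, ?j, x', g) \<in> events s" for i x' g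
    using old[OF that] priv(4) by (simp add: near_hub_def)
  show ?thesis unfolding separated_def t
  proof (intro conjI allI impI)
    fix i j y g assume "(i, j, y, g) \<in> insert (clock s, ?j, x, ?g) (events s)"
    then show "(j, y) \<in> insert (?j, x) (hubs s)" using old by auto
  next
    fix i j y g i' y' g'
    assume e: "(i, j, y, g) \<in> insert (clock s, ?j, x, ?g) (events s)"
      "(i', j, y', g') \<in> insert (clock s, ?j, x, ?g) (events s)" and ne: "(i, y, g) \<noteq> (i', y', g')"
    consider "(i, j, y, g) \<in> events s" "(i', j, y', g') \<in> events s"
      | "j = ?j" "y = x" "(i', j, y', g') \<in> events s" | "j = ?j" "y' = x" "(i, j, y, g) \<in> events s"
      using e ne by auto
    then show "\<not> (near G w (4 * rad j) y y' \<and> near G w (4 * rad j) y' y)"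
      by cases (use old2 sep ne in blast)+
  qed
next
  case (facility v x)
  then have "events (connect G w s a b c) = events s" "hubs s \<subseteq> hubs (connect G w s a b c)"
    by (auto simp: connect_def Let_def)
  then show ?thesis using s(2) unfolding separated_def by (simp add: subset_iff)
qed (use s(2) in \<open>simp_all add: connect_def Let_def separated_def\<close>)

lemma connect_growth_bound:
  assumes s: "sane s" "growth_bound K s" and ab: "links G a b \<noteq> {}" and K: "clock s \<le> K"
  shows "growth_bound K (connect G w s a b c)"
proof (cases rule: action_cases[of G w s a b])
  case (priv x)
  let ?t = "connect G w s a b c" and ?j = "level (gap G w s a b)"
  let ?B = "rim G w (rad ?j) x" and ?n = "real (card V)"
  let ?g = "sum (wt s) ?B < limit (clock s)"
  have n: "0 < ?n" using link_ends_V[OF ab] by (auto simp: card_gt_0_iff)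
  have E: "events ?t = insert (clock s, ?j, x, ?g) (events s)"
    using priv(1) by (simp_all add: connect_def Let_def)
  have old: "good_near s v \<le> 2 * w v * (limit K + 2) * ln (?n * wt s v + 1)" if "v \<in> V" for v
    using s(2) that by (simp add: growth_bound_def)
  have fin: "finite (events s)" using s(1) by (simp add: sane_def)
  have "good_near ?t v \<le> 2 * w v * (limit K + 2) * ln (?n * wt ?t v + 1)" if v: "v \<in> V" for v
  proof (cases "?g \<and> v \<in> ?B")
    case True
    then have set: "{(i, j, x, g)\<in>events ?t. g \<and> v \<in> rim G w (rad j) x}
      = insert (clock s, ?j, x, ?g) {(i, j, x, g)\<in>events s. g \<and> v \<in> rim G w (rad j) x}"
      unfolding E by auto
    have gn: "good_near ?t v = good_near s v + rad ?j"
      unfolding good_near_def set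
      by (subst sum.insert) (auto intro: finite_subset[OF _ fin] simp: fresh_event[OF s(1)])
    define y where "y = rad ?j / (w v * (limit (clock s) + 2))"
    have y: "0 < y" "y \<le> 1 / 2" and wv: "0 < w v"
      unfolding y_def using True increment_ratio(2,3)[of v ?j x "clock s"] increment_ratio(1)[of v ?j x] by auto
    \<comment> \<open>The additive 1 / n in \<open>increment\<close> turns the update into a
      multiplication of this shifted weight by \<open>1 + y\<close>, so its logarithm accumulates
      the radii.\<close>
    have wt: "?n * wt ?t v + 1 = (?n * wt s v + 1) * (1 + y)"
    proof -
      have "increment G w s ?j x v = y * (wt s v + 1 / ?n)" using True by (simp add: increment_def y_def)
      then have "wt ?t v = wt s v + y * (wt s v + 1 / ?n)" using priv(1) True by (simp add: connect_def Let_def)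
      moreover have "m * (z + y * (z + 1 / m)) + 1 = (m * z + 1) * (1 + y)" if "0 < m" for m z :: real
        using that by (simp add: field_simps)
      ultimately show ?thesis using n by presburger
    qed
    have "0 \<le> wt s v" using s(1) v by (simp add: sane_def)
    then have ln: "ln (?n * wt ?t v + 1) = ln (?n * wt s v + 1) + ln (1 + y)"
      unfolding wt using y n by (intro ln_mult_pos) (auto intro: add_nonneg_pos)
    have "y\<^sup>2 \<le> y / 2" using y by (simp add: power2_eq_square mult_left_le)
    then have "y / 2 \<le> ln (1 + y)" using ln_one_plus_pos_lower_bound[of y] y by simp
    then have "2 * w v * (limit K + 2) * (y / 2) \<le> 2 * w v * (limit K + 2) * ln (1 + y)"
      using wv limit_ge[of K] by (intro mult_left_mono) auto
    moreover have "rad ?j \<le> 2 * w v * (limit K + 2) * (y / 2)"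
    proof -
      have l: "limit (clock s) \<le> limit K" using K by (simp add: limit_def)
      have "rad ?j = w v * (limit (clock s) + 2) * y" using wv limit_ge[of "clock s"] by (simp add: y_def)
      also have "\<dots> \<le> w v * (limit K + 2) * y" using l wv y by (intro mult_right_mono mult_left_mono) auto
      finally show ?thesis by simp
    qed
    ultimately show ?thesis using old[OF v] gn unfolding ln by (simp add: distrib_left)
  next
    case False
    then have set: "{(i, j, x, g)\<in>events ?t. g \<and> v \<in> rim G w (rad j) x}
      = {(i, j, x, g)\<in>events s. g \<and> v \<in> rim G w (rad j) x}"
      unfolding E by auto
    have "wt s v \<le> wt ?t v" using priv(1) increment_nonneg[OF s(1) v] by (simp add: connect_def Let_def)
    moreover have "0 \<le> wt s v" using s(1) v by (simp add: sane_def)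
    ultimately have "ln (?n * wt s v + 1) \<le> ln (?n * wt ?t v + 1)"
      using n by (subst ln_le_cancel_iff) (auto intro: add_nonneg_pos mult_left_mono)
    then have "2 * w v * (limit K + 2) * ln (?n * wt s v + 1) \<le> 2 * w v * (limit K + 2) * ln (?n * wt ?t v + 1)"
      using w_nonneg[OF v] limit_ge[of K] by (intro mult_left_mono) auto
    then show ?thesis using old[OF v] unfolding good_near_def set by simp
  qed
  then show ?thesis by (simp add: growth_bound_def)
qed (use s(2) in \<open>simp_all add: connect_def Let_def growth_bound_def good_near_def\<close>)

text \<open>\<open>K\<close> stays fixed along the run; \<open>growth_bound\<close> is claimed only
  while the clock has not passed \<open>K\<close>, as later steps may be smaller than
  \<open>limit K\<close> accounts for.\<close>

definition invariant :: "nat \<Rightarrow> 'v state \<Rightarrow> bool" where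
  "invariant K s \<longleftrightarrow> sane s \<and> cost_bound s \<and> hub_origin s \<and> weight_bound s \<and> separated s \<and>
     (clock s \<le> K \<longrightarrow> growth_bound K s)"

lemma invariant_initial: "invariant K initial"
proof -
  have "good_near initial v = 0" for v
    unfolding good_near_def by (rule sum.neutral) (simp add: initial_def)
  then show ?thesis
    by (simp add: invariant_def sane_initial)
      (simp add: initial_def cost_bound_def hub_origin_def weight_bound_def separated_def growth_bound_def
        comps_def rad_sum_def event_sum_def)
qed

lemma transition_invariant:
  assumes s: "invariant K s" and t: "t \<in> set_pmf (transition G w s (a, b, p))"
  shows "invariant K t"
proof -
  have sane: "sane s" "sane t" using s transition_sane[OF _ t] by (auto simp: invariant_def)
  show ?thesis using t
  proof (cases rule: transition_cases)
    case skip
    show ?thesis using s sane unfolding skip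
      by (simp add: invariant_def cost_bound_def hub_origin_def weight_bound_def separated_def
          growth_bound_def good_near_def event_sum_def)
  next
    case (join c)
    let ?u = "connect G w s a b c"
    have V: "solution G ?u \<subseteq> V" using solution_subset[OF sane(2)] by (simp add: join(3))
    have "cost_bound ?u" "hub_origin ?u" "weight_bound ?u" "separated ?u"
      using connect_cost_bound[OF _ _ join(1) V] connect_hub_origin connect_weight_bound[OF _ _ join(1)]
        connect_separated s by (auto simp: invariant_def)
    moreover have "Suc (clock s) \<le> K \<Longrightarrow> growth_bound K ?u"
      using connect_growth_bound[OF sane(1) _ join(1)] s by (simp add: invariant_def)
    ultimately show ?thesis using sane(2) unfolding join(3)
      by (simp add: invariant_def cost_bound_def hub_origin_def weight_bound_def separated_def
          growth_bound_def good_near_def event_sum_def)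
  qed
qed

lemma chain_invariant: "t \<in> set_pmf (chain (transition G w) initial \<sigma>) \<Longrightarrow> invariant K t"
proof (induction \<sigma> arbitrary: t rule: rev_induct)
  case Nil
  then show ?case by (simp add: invariant_initial)
next
  case (snoc r \<sigma>)
  obtain a b p where r: "r = (a, b, p)" by (cases r)
  obtain s where s: "s \<in> set_pmf (chain (transition G w) initial \<sigma>)" "t \<in> set_pmf (transition G w s (a, b, p))"
    using snoc.prems unfolding r by (auto simp: chain_snoc)
  show ?case by (rule transition_invariant[OF snoc.IH[OF s(1)] s(2)])
qed

lemma chain_clock: "t \<in> set_pmf (chain (transition G w) initial \<sigma>) \<Longrightarrow> clock t = length \<sigma>"
proof (induction \<sigma> arbitrary: t rule: rev_induct)
  case Nil
  then show ?case by (simp add: initial_def)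
next
  case (snoc r \<sigma>)
  obtain a b p where r: "r = (a, b, p)" by (cases r)
  obtain s where s: "s \<in> set_pmf (chain (transition G w) initial \<sigma>)" "t \<in> set_pmf (transition G w s (a, b, p))"
    using snoc.prems unfolding r by (auto simp: chain_snoc)
  show ?case using s(2) snoc.IH[OF s(1)] by (cases rule: transition_cases) auto
qed

end

section \<open>Expected costs\<close>

definition reward :: "('v, 'e) pre_digraph \<Rightarrow> ('v \<Rightarrow> real) \<Rightarrow> 'v state \<Rightarrow> 'v \<Rightarrow> 'v \<Rightarrow> real" where
  "reward G w s a b = (case action G w s a b of Private x g \<Rightarrow> rad (level (gap G w s a b)) | _ \<Rightarrow> 0)"

lemma reward_nonneg: "0 \<le> reward G w s a b"
  by (auto simp: reward_def less_imp_le split: action.split)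

lemma rad_sum_geometric:
  assumes "finite J" "\<And>j. j \<in> J \<Longrightarrow> j \<le> b"
  shows "sum rad J \<le> 2 * rad b"
  using assms
proof (induction J arbitrary: b rule: finite_linorder_max_induct)
  case (insert m A)
  have "sum rad A \<le> 2 * rad (m - 1)" using insert.hyps(2) by (intro insert.IH) fastforce
  also have "2 * rad (m - 1) = rad m" by (simp add: rad_def powr_diff)
  finally have "sum rad (insert m A) \<le> 2 * rad m"
    using insert.hyps by (subst sum.insert) auto
  also have "\<dots> \<le> 2 * rad b" using insert.prems[of m] by (simp add: rad_def)
  finally show ?case .
qed (simp add: less_imp_le)

lemma rad_sum_bounded:
  assumes "finite J" "\<And>j. j \<in> J \<Longrightarrow> rad j \<le> c" "0 \<le> c"
  shows "sum rad J \<le> 2 * c"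
proof (cases "J = {}")
  case False
  have "sum rad J \<le> 2 * rad (Max J)" using assms(1) by (intro rad_sum_geometric) auto
  also have "\<dots> \<le> 2 * c" using assms(2)[of "Max J"] assms(1) False by simp
  finally show ?thesis .
qed (simp add: assms(3))

lemma nn_integral_transition:
  "(\<integral>\<^sup>+t. h t \<partial>measure_pmf (transition G w s (a, b, p))) =
     (\<integral>\<^sup>+c. h (update G w s (a, b, p) (Some c)) \<partial>measure_pmf (sample G w s a b)) * ennreal (join_prob G w s (a, b, p))
     + h (update G w s (a, b, p) None) * ennreal (1 - join_prob G w s (a, b, p))"
  unfolding transition_def nn_integral_map_pmf nn_integral_bind_pmf
  by (subst nn_integral_bernoulli_pmf) (simp_all add: join_prob_range)

lemma nn_integral_transition_simple:
  assumes "\<And>c. h (update G w s (a, b, p) (Some c)) = h s + ennreal x" "h (update G w s (a, b, p) None) = h s" "0 \<le> x"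
  shows "(\<integral>\<^sup>+t. h t \<partial>measure_pmf (transition G w s (a, b, p))) = h s + ennreal (join_prob G w s (a, b, p) * x)"
proof -
  let ?q = "join_prob G w s (a, b, p)"
  have q: "0 \<le> ?q" "?q \<le> 1" by (rule join_prob_range)+
  have "(\<integral>\<^sup>+t. h t \<partial>measure_pmf (transition G w s (a, b, p))) = (h s + ennreal x) * ennreal ?q + h s * ennreal (1 - ?q)"
    unfolding nn_integral_transition assms by simp
  also have "\<dots> = h s * (ennreal ?q + ennreal (1 - ?q)) + ennreal (?q * x)"
    using q assms(3) by (simp add: distrib_left distrib_right ennreal_mult ac_simps)
  also have "ennreal ?q + ennreal (1 - ?q) = 1" using q by (simp flip: ennreal_plus)
  finally show ?thesis by simp
qed

lemma nn_integral_chain_step: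
  assumes "i < length \<sigma>"
  shows "(\<integral>\<^sup>+t. h t \<partial>measure_pmf (chain K s (take (Suc i) \<sigma>))) =
    (\<integral>\<^sup>+t. (\<integral>\<^sup>+u. h u \<partial>measure_pmf (K t (\<sigma> ! i))) \<partial>measure_pmf (chain K s (take i \<sigma>)))"
  using assms by (simp add: take_Suc_conv_app_nth chain_snoc)

lemma nn_integral_pmf_mono:
  assumes "\<And>x. x \<in> set_pmf M \<Longrightarrow> f x \<le> g x"
  shows "(\<integral>\<^sup>+x. f x \<partial>measure_pmf M) \<le> (\<integral>\<^sup>+x. g x \<partial>measure_pmf M)"
  using assms by (intro nn_integral_mono_AE AE_pmfI)

lemma nn_integral_pmf_add:
  "(\<integral>\<^sup>+x. f x + g x \<partial>measure_pmf M) = (\<integral>\<^sup>+x. f x \<partial>measure_pmf M) + (\<integral>\<^sup>+x. g x \<partial>measure_pmf M)"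
  by (rule nn_integral_add) auto

text \<open>A drift argument: in each state the expected growth of \<open>f\<close> is at most some
  \<open>d\<close> and that of \<open>g\<close> at least \<open>d\<close>. The amount
  \<open>d\<close> may depend on the state, and since nothing is subtracted, infinite values do no
  harm.\<close>

lemma chain_compare:
  fixes f g :: "'s \<Rightarrow> ennreal"
  assumes init: "f s \<le> g s"
    and step: "\<And>i t. i < length \<sigma> \<Longrightarrow> t \<in> set_pmf (chain K s (take i \<sigma>)) \<Longrightarrow>
      \<exists>d. (\<integral>\<^sup>+u. f u \<partial>measure_pmf (K t (\<sigma> ! i))) \<le> f t + d \<and> g t + d \<le> (\<integral>\<^sup>+u. g u \<partial>measure_pmf (K t (\<sigma> ! i)))"
  shows "(\<integral>\<^sup>+t. f t \<partial>measure_pmf (chain K s \<sigma>)) \<le> (\<integral>\<^sup>+t. g t \<partial>measure_pmf (chain K s \<sigma>))"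
proof -
  have "(\<integral>\<^sup>+t. f t \<partial>measure_pmf (chain K s (take n \<sigma>))) \<le> (\<integral>\<^sup>+t. g t \<partial>measure_pmf (chain K s (take n \<sigma>)))"
    if "n \<le> length \<sigma>" for n
    using that
  proof (induction n)
    case 0
    then show ?case using init by simp
  next
    case (Suc i)
    then have i: "i < length \<sigma>" by simp
    let ?M = "measure_pmf (chain K s (take i \<sigma>))"
    obtain d where d: "\<And>t. t \<in> set_pmf (chain K s (take i \<sigma>)) \<Longrightarrow>
      (\<integral>\<^sup>+u. f u \<partial>measure_pmf (K t (\<sigma> ! i))) \<le> f t + d t \<and> g t + d t \<le> (\<integral>\<^sup>+u. g u \<partial>measure_pmf (K t (\<sigma> ! i)))"
      using step[OF i] by metis
    have "(\<integral>\<^sup>+t. f t \<partial>measure_pmf (chain K s (take (Suc i) \<sigma>))) \<le> (\<integral>\<^sup>+t. f t + d t \<partial>?M)"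
      unfolding nn_integral_chain_step[OF i] using d by (intro nn_integral_pmf_mono) blast
    also have "\<dots> \<le> (\<integral>\<^sup>+t. g t + d t \<partial>?M)"
      unfolding nn_integral_pmf_add using Suc by (intro add_right_mono) auto
    also have "\<dots> \<le> (\<integral>\<^sup>+t. g t \<partial>measure_pmf (chain K s (take (Suc i) \<sigma>)))"
      unfolding nn_integral_chain_step[OF i] using d by (intro nn_integral_pmf_mono) blast
    finally show ?case .
  qed
  from this[of "length \<sigma>"] show ?thesis by simp
qed

context node_weighted begin

lemma event_sum_update:
  assumes "sane s"
  shows "event_sum (update G w s (a, b, p) (Some c)) = event_sum s + reward G w s a b"
    "event_sum (update G w s (a, b, p) None) = event_sum s"
proof -
  show "event_sum (update G w s (a, b, p) (Some c)) = event_sum s + reward G w s a b"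
  proof (cases "action G w s a b")
    case (Private x g)
    have "events (update G w s (a, b, p) (Some c)) = insert (clock s, level (gap G w s a b), x, g) (events s)"
      using Private by (simp add: update_def connect_def Let_def)
    then show ?thesis
      using event_sum_insert[OF assms] unfolding event_sum_def[of "update G w s (a, b, p) (Some c)"]
      by (simp add: reward_def Private)
  qed (simp_all add: update_def connect_def Let_def event_sum_def reward_def)
qed (simp add: update_def event_sum_def)

lemma event_sum_nonneg: "0 \<le> event_sum s"
  unfolding event_sum_def by (intro sum_nonneg) (simp add: less_imp_le)

lemma selection_valid:
  assumes s: "sane s" and ab: "links G a b \<noteq> {}" and act: "action G w s a b = Private x True"
  defines "B \<equiv> rim G w (rad (level (gap G w s a b))) x"
  defines "f \<equiv> increment G w s (level (gap G w s a b)) x"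
  shows "sample G w s a b = selection B f" "finite B" "\<And>v. v \<in> B \<Longrightarrow> 0 \<le> f v" "sum f B \<le> 1"
    "(\<Sum>v\<in>B. w v * f v) \<le> reward G w s a b"
proof -
  have Vne: "V \<noteq> {}" using link_ends_V[OF ab] by auto
  have lt: "sum (wt s) B < limit (clock s)"
    using act by (cases rule: action_cases[of G w s a b]) (auto simp: B_def)
  have L: "0 \<le> limit (clock s)" by (rule limit_ge)
  show "sample G w s a b = selection B f" by (simp add: sample_def act B_def f_def)
  show "finite B" unfolding B_def by (rule finite_subV[OF rim_subset])
  show "0 \<le> f v" if "v \<in> B" for v
    unfolding f_def using that rim_subset by (intro increment_nonneg[OF s]) (auto simp: B_def)
  have "sum f B \<le> (sum (wt s) B + 1) / (limit (clock s) + 2)"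
    unfolding f_def B_def by (rule sum_weight_increment(2)[OF s Vne])
  also have "\<dots> \<le> 1" using lt L by simp
  finally show "sum f B \<le> 1" .
  have "(\<Sum>v\<in>B. w v * f v) \<le> rad (level (gap G w s a b)) / (limit (clock s) + 2) * (sum (wt s) B + 1)"
    unfolding f_def B_def by (rule sum_weight_increment(1)[OF s Vne])
  also have "\<dots> \<le> rad (level (gap G w s a b)) / (limit (clock s) + 2) * (limit (clock s) + 2)"
    using lt L less_imp_le[OF rad_pos[of "level (gap G w s a b)"]]
    by (intro mult_left_mono divide_nonneg_pos) linarith+
  also have "\<dots> = reward G w s a b" using L by (simp add: reward_def act)
  finally show "(\<Sum>v\<in>B. w v * f v) \<le> reward G w s a b" .
qed

lemma fac_update:
  "fac (update G w s (a, b, p) (Some c)) = (if is_Private (action G w s a b) then fac s \<union> set_option c else fac s)"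
  "fac (update G w s (a, b, p) None) = fac s"
  by (auto simp: update_def connect_def Let_def split: action.split)

text \<open>The sampling probabilities are the weight increments, so the expected weight of the
  sampled vertex is the increase of the fractional cost, which is at most the radius of the
  event.\<close>

lemma expected_fac_step:
  assumes s: "sane s" and ab: "links G a b \<noteq> {}"
  shows "(\<integral>\<^sup>+c. ennreal (sum w (fac (update G w s (a, b, p) (Some c)))) \<partial>measure_pmf (sample G w s a b))
    \<le> ennreal (sum w (fac s) + reward G w s a b)"
proof -
  have fV: "fac s \<subseteq> V" using s by (simp add: sane_def)
  have W: "0 \<le> sum w (fac s)" by (rule sum_w_nonneg[OF fV])
  show ?thesis
  proof (cases "\<exists>x. action G w s a b = Private x True")
    case True
    then obtain x where act: "action G w s a b = Private x True" by blast
    let ?B = "rim G w (rad (level (gap G w s a b))) x" and ?f = "increment G w s (level (gap G w s a b)) x"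
    note v = selection_valid[OF s ab act]
    have one: "ennreal (1 - sum ?f ?B) + (\<Sum>v\<in>?B. ennreal (?f v)) = 1"
      using v(3,4) by (subst sum_ennreal) (simp_all flip: ennreal_plus add: sum_nonneg)
    have "(\<integral>\<^sup>+c. ennreal (sum w (fac (update G w s (a, b, p) (Some c)))) \<partial>measure_pmf (sample G w s a b))
      = ennreal (sum w (fac s)) * ennreal (1 - sum ?f ?B) + (\<Sum>v\<in>?B. ennreal (sum w (fac s \<union> {v})) * ennreal (?f v))"
      unfolding v(1) by (subst nn_integral_selection[OF v(2-4)]) (simp_all add: fac_update act)
    also have "\<dots> \<le> ennreal (sum w (fac s)) * ennreal (1 - sum ?f ?B)
        + (\<Sum>v\<in>?B. (ennreal (sum w (fac s)) + ennreal (w v)) * ennreal (?f v))"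
    proof (intro add_left_mono sum_mono mult_right_mono)
      fix v assume "v \<in> ?B"
      then have vV: "v \<in> V" using rim_subset by blast
      have "ennreal (sum w (fac s \<union> {v})) \<le> ennreal (sum w (fac s) + w v)"
        using sum_w_Un[OF fV, of "{v}"] vV by (intro ennreal_leI) simp
      then show "ennreal (sum w (fac s \<union> {v})) \<le> ennreal (sum w (fac s)) + ennreal (w v)"
        using W w_nonneg[OF vV] by (simp add: ennreal_plus)
    qed simp
    also have "\<dots> = ennreal (sum w (fac s)) * (ennreal (1 - sum ?f ?B) + (\<Sum>v\<in>?B. ennreal (?f v)))
        + (\<Sum>v\<in>?B. ennreal (w v) * ennreal (?f v))"
      by (simp add: distrib_left distrib_right sum.distrib sum_distrib_left ac_simps)
    also have "(\<Sum>v\<in>?B. ennreal (w v) * ennreal (?f v)) = (\<Sum>v\<in>?B. ennreal (w v * ?f v))"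
      by (intro sum.cong ennreal_mult[symmetric] w_nonneg v(3)) (use rim_subset in auto)
    also have "\<dots> = ennreal (\<Sum>v\<in>?B. w v * ?f v)"
      by (intro sum_ennreal mult_nonneg_nonneg w_nonneg v(3)) (use rim_subset in auto)
    also have "ennreal (sum w (fac s)) * (ennreal (1 - sum ?f ?B) + (\<Sum>v\<in>?B. ennreal (?f v))) + ennreal (\<Sum>v\<in>?B. w v * ?f v)
      = ennreal (sum w (fac s)) + ennreal (\<Sum>v\<in>?B. w v * ?f v)"
      unfolding one by simp
    also have "\<dots> \<le> ennreal (sum w (fac s)) + ennreal (reward G w s a b)"
      using v(5) by (intro add_left_mono ennreal_leI)
    also have "\<dots> = ennreal (sum w (fac s) + reward G w s a b)"
      using W reward_nonneg[of G w s a b] by (rule ennreal_plus[symmetric])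
    finally show ?thesis .
  next
    case False
    then have "sample G w s a b = return_pmf None"
      by (auto simp: sample_def split: action.split)
    then show ?thesis using reward_nonneg[of G w s a b] by (auto simp: fac_update intro!: ennreal_leI)
  qed
qed

lemma join_prob_no_links: "links G a b = {} \<Longrightarrow> join_prob G w s (a, b, p) = 0"
  by (simp add: join_prob_def)

lemma expected_fac:
  "(\<integral>\<^sup>+s. ennreal (sum w (fac s)) \<partial>measure_pmf (chain (transition G w) initial \<sigma>))
    \<le> (\<integral>\<^sup>+s. ennreal (event_sum s) \<partial>measure_pmf (chain (transition G w) initial \<sigma>))"
proof (rule chain_compare)
  show "ennreal (sum w (fac initial)) \<le> ennreal (event_sum initial)"
    by (simp add: initial_def event_sum_def)
  fix i s assume i: "i < length \<sigma>" and s: "s \<in> set_pmf (chain (transition G w) initial (take i \<sigma>))"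
  obtain a b p where r: "\<sigma> ! i = (a, b, p)" by (cases "\<sigma> ! i")
  let ?q = "join_prob G w s (a, b, p)"
  have sane: "sane s" using chain_invariant[OF s, of 0] by (simp add: invariant_def)
  have q: "0 \<le> ?q" "?q \<le> 1" by (rule join_prob_range)+
  have W: "0 \<le> sum w (fac s)" using sane by (intro sum_w_nonneg) (simp add: sane_def)
  show "\<exists>d. (\<integral>\<^sup>+u. ennreal (sum w (fac u)) \<partial>measure_pmf (transition G w s (\<sigma> ! i))) \<le> ennreal (sum w (fac s)) + d \<and>
    ennreal (event_sum s) + d \<le> (\<integral>\<^sup>+u. ennreal (event_sum u) \<partial>measure_pmf (transition G w s (\<sigma> ! i)))"
  proof (intro exI[of _ "ennreal (?q * reward G w s a b)"] conjI)
    show "ennreal (event_sum s) + ennreal (?q * reward G w s a b) \<le> (\<integral>\<^sup>+u. ennreal (event_sum u) \<partial>measure_pmf (transition G w s (\<sigma> ! i)))"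
      unfolding r
    proof (subst nn_integral_transition_simple[where x = "reward G w s a b"])
      show "ennreal (event_sum (update G w s (a, b, p) (Some c))) = ennreal (event_sum s) + ennreal (reward G w s a b)" for c
        unfolding event_sum_update(1)[OF sane] by (intro ennreal_plus event_sum_nonneg reward_nonneg)
    qed (simp_all add: event_sum_update(2)[OF sane] reward_nonneg)
    have "(\<integral>\<^sup>+u. ennreal (sum w (fac u)) \<partial>measure_pmf (transition G w s (\<sigma> ! i)))
       \<le> ennreal (sum w (fac s) + reward G w s a b) * ennreal ?q + ennreal (sum w (fac s)) * ennreal (1 - ?q)"
      unfolding r nn_integral_transition fac_update(2)
    proof (intro add_right_mono)
      show "(\<integral>\<^sup>+c. ennreal (sum w (fac (update G w s (a, b, p) (Some c)))) \<partial>measure_pmf (sample G w s a b)) * ennreal ?q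
        \<le> ennreal (sum w (fac s) + reward G w s a b) * ennreal ?q"
        by (cases "links G a b = {}")
          (simp_all only: join_prob_no_links ennreal_0 mult_zero_right order_refl mult_right_mono expected_fac_step[OF sane] zero_le not_False_eq_True)
    qed
    also have "\<dots> = ennreal ((sum w (fac s) + reward G w s a b) * ?q + sum w (fac s) * (1 - ?q))"
      using q W reward_nonneg[of G w s a b] by (subst ennreal_plus) (simp_all add: ennreal_mult)
    also have "(sum w (fac s) + reward G w s a b) * ?q + sum w (fac s) * (1 - ?q) = sum w (fac s) + ?q * reward G w s a b"
      by (simp add: algebra_simps)
    finally show "(\<integral>\<^sup>+u. ennreal (sum w (fac u)) \<partial>measure_pmf (transition G w s (\<sigma> ! i)))
      \<le> ennreal (sum w (fac s)) + ennreal (?q * reward G w s a b)"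
      using q W reward_nonneg[of G w s a b] by (simp add: ennreal_plus)
  qed
qed

text \<open>The set \<open>B\<close> is fixed in advance, but the run of the algorithm may depend on all earlier
  random choices: only the conditional law of the next choice matters.\<close>

lemma expected_survival:
  "(\<integral>\<^sup>+s. (if fac s \<inter> B = {} then ennreal (exp (sum (wt s) (B \<inter> V))) else 0)
      \<partial>measure_pmf (chain (transition G w) initial \<sigma>)) \<le> 1"
proof -
  define h where "h s = (if fac s \<inter> B = {} then ennreal (exp (sum (wt s) (B \<inter> V))) else 0)" for s :: "'v state"
  have "(\<integral>\<^sup>+s. h s \<partial>measure_pmf (chain (transition G w) initial \<sigma>))
    \<le> (\<integral>\<^sup>+s. 1 \<partial>measure_pmf (chain (transition G w) initial \<sigma>))"
  proof (rule chain_compare)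
    show "h initial \<le> 1" by (simp add: h_def initial_def)
    fix i s assume i: "i < length \<sigma>" and s: "s \<in> set_pmf (chain (transition G w) initial (take i \<sigma>))"
    obtain a b p where r: "\<sigma> ! i = (a, b, p)" by (cases "\<sigma> ! i")
    let ?q = "join_prob G w s (a, b, p)"
    have sane: "sane s" using chain_invariant[OF s, of 0] by (simp add: invariant_def)
    have q: "0 \<le> ?q" "?q \<le> 1" by (rule join_prob_range)+
    have none: "h (update G w s (a, b, p) None) = h s"
      by (simp add: h_def update_def)
    have some: "(\<integral>\<^sup>+c. h (update G w s (a, b, p) (Some c)) \<partial>measure_pmf (sample G w s a b)) \<le> h s"
      if ab: "links G a b \<noteq> {}"
    proof (cases "\<exists>x. action G w s a b = Private x True")
      case True
      then obtain x where act: "action G w s a b = Private x True" by blast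
      let ?R = "rim G w (rad (level (gap G w s a b))) x" and ?f = "increment G w s (level (gap G w s a b)) x"
      note v = selection_valid[OF sane ab act]
      have fac': "fac (update G w s (a, b, p) (Some c)) = fac s \<union> set_option c" for c
        by (simp add: fac_update act)
      have wt': "wt (update G w s (a, b, p) (Some c)) = (\<lambda>v. wt s v + ?f v)" for c
        by (simp add: update_def connect_def Let_def act)
      show ?thesis
      proof (cases "fac s \<inter> B = {}")
        case False
        then have "h (update G w s (a, b, p) (Some c)) = 0" for c by (auto simp: h_def fac')
        then show ?thesis by simp
      next
        case dis: True
        let ?e = "exp (sum (wt s) (B \<inter> V) + sum ?f (B \<inter> V))"
        have RV: "?R \<subseteq> V" by (rule rim_subset)
        have hc: "h (update G w s (a, b, p) (Some c)) = (if set_option c \<inter> B = {} then ennreal ?e else 0)" for c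
          using dis by (auto simp: h_def fac' wt' sum.distrib Int_Un_distrib2)
        \<comment> \<open>The rim \<open>?R\<close> sampled now need not be related to
          \<open>B\<close>; both the growth of the exponent and the chance of hitting
          \<open>B\<close> involve only the common part.\<close>
        have fB: "sum ?f (B \<inter> V) = sum ?f (?R \<inter> B)"
          by (rule sum.mono_neutral_right) (use RV in \<open>auto simp: increment_def\<close>)
        have split: "sum ?f ?R = sum ?f (?R \<inter> B) + sum ?f (?R - B)"
          using v(2) by (subst sum.Int_Diff[of _ _ B]) auto
        have nn: "0 \<le> sum ?f (?R - B)" "0 \<le> sum ?f (?R \<inter> B)" using v(3) by (auto intro!: sum_nonneg)
        have "(\<integral>\<^sup>+c. h (update G w s (a, b, p) (Some c)) \<partial>measure_pmf (sample G w s a b))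
          = ennreal ?e * ennreal (1 - sum ?f ?R) + (\<Sum>v\<in>?R. (if v \<notin> B then ennreal ?e else 0) * ennreal (?f v))"
          unfolding v(1) by (subst nn_integral_selection[OF v(2-4)]) (simp_all add: hc)
        also have "(\<Sum>v\<in>?R. (if v \<notin> B then ennreal ?e else 0) * ennreal (?f v)) = (\<Sum>v\<in>?R - B. ennreal ?e * ennreal (?f v))"
          using v(2) by (intro sum.mono_neutral_cong_right) auto
        also have "\<dots> = ennreal ?e * ennreal (sum ?f (?R - B))"
          using v(3) by (subst sum_distrib_left[symmetric], subst sum_ennreal) auto
        also have "ennreal ?e * ennreal (1 - sum ?f ?R) + \<dots> = ennreal (?e * (1 - sum ?f (?R \<inter> B)))"
        proof -
          have "ennreal ?e * ennreal (1 - sum ?f ?R) + ennreal ?e * ennreal (sum ?f (?R - B))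
            = ennreal ?e * ennreal ((1 - sum ?f ?R) + sum ?f (?R - B))"
            using nn v(4) by (subst ennreal_plus) (auto simp: distrib_left)
          also have "(1 - sum ?f ?R) + sum ?f (?R - B) = 1 - sum ?f (?R \<inter> B)" using split by simp
          finally show ?thesis by (simp add: ennreal_mult')
        qed
        also have "\<dots> \<le> ennreal (exp (sum (wt s) (B \<inter> V)))"
        proof (rule ennreal_leI)
          \<comment> \<open>The chance to miss \<open>B\<close> again compensates the growth of the
            exponential exactly because 1 - y <= exp (- y).\<close>
          have "1 - sum ?f (?R \<inter> B) \<le> exp (- sum ?f (?R \<inter> B))"
            using exp_ge_add_one_self[of "- sum ?f (?R \<inter> B)"] by simp
          then have "?e * (1 - sum ?f (?R \<inter> B)) \<le> ?e * exp (- sum ?f (?R \<inter> B))" by (intro mult_left_mono) auto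
          also have "\<dots> = exp (sum (wt s) (B \<inter> V))" unfolding fB by (simp flip: exp_add)
          finally show "?e * (1 - sum ?f (?R \<inter> B)) \<le> exp (sum (wt s) (B \<inter> V))" .
        qed
        finally show ?thesis using dis by (simp add: h_def)
      qed
    next
      case False
      then have "sample G w s a b = return_pmf None"
        by (auto simp: sample_def split: action.split)
      moreover have "wt (update G w s (a, b, p) (Some None)) = wt s"
        using False by (auto simp: update_def connect_def Let_def split: action.split)
      ultimately show ?thesis by (simp add: h_def fac_update)
    qed
    have "(\<integral>\<^sup>+u. h u \<partial>measure_pmf (transition G w s (\<sigma> ! i))) \<le> h s * ennreal ?q + h s * ennreal (1 - ?q)"
      unfolding r nn_integral_transition none
      by (cases "links G a b = {}") (auto simp: join_prob_no_links intro!: add_right_mono mult_right_mono some)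
    also have "\<dots> = h s * (ennreal ?q + ennreal (1 - ?q))" by (simp add: distrib_left)
    also have "ennreal ?q + ennreal (1 - ?q) = 1" using q by (simp flip: ennreal_plus)
    finally show "\<exists>d. (\<integral>\<^sup>+u. h u \<partial>measure_pmf (transition G w s (\<sigma> ! i))) \<le> h s + d \<and>
      1 + d \<le> (\<integral>\<^sup>+u. 1 \<partial>measure_pmf (transition G w s (\<sigma> ! i)))"
      by (intro exI[of _ 0]) (simp add: measure_pmf.emeasure_space_1)
  qed
  then show ?thesis by (simp add: h_def measure_pmf.emeasure_space_1)
qed

end

section \<open>Comparison with an offline solution\<close>

definition sum_where :: "(nat \<times> int \<times> 'v \<times> bool \<Rightarrow> bool) \<Rightarrow> 'v state \<Rightarrow> real" where
  "sum_where Q s = (\<Sum>e\<in>{e\<in>events s. Q e}. rad (fst (snd e)))"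

lemma sum_where_nonneg: "0 \<le> sum_where Q s"
  unfolding sum_where_def by (intro sum_nonneg) (simp add: less_imp_le)

lemma exp_limit: "exp (limit i) = (real i + 2)\<^sup>2"
  by (simp add: limit_def exp_double flip: exp_of_nat_mult)

lemma sum_inverse_squares: "(\<Sum>i<n. 1 / (real i + 2)\<^sup>2) \<le> 1"
proof -
  have "(\<Sum>i<n. 1 / (real i + 2)\<^sup>2) \<le> 1 - 1 / (real n + 1)"
  proof (induction n)
    case (Suc n)
    have "1 / (real n + 2)\<^sup>2 \<le> 1 / ((real n + 1) * (real n + 2))"
      by (intro divide_left_mono) (auto simp: power2_eq_square intro!: mult_right_mono)
    also have "\<dots> = 1 / (real n + 1) - 1 / (real n + 2)" by (simp add: field_simps)
    finally show ?case using Suc by (simp add: add_ac)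
  qed simp
  also have "\<dots> \<le> 1" by simp
  finally show ?thesis .
qed

text \<open>These are the powers of two within a factor \<open>k\<close> of each other, so their
  exponents lie in an interval of length \<open>log 2 k\<close>.\<close>

lemma card_levels:
  assumes "0 < c" "1 \<le> k"
  shows "finite {j. c / k \<le> rad j \<and> rad j \<le> c}" "real (card {j. c / k \<le> rad j \<and> rad j \<le> c}) \<le> log 2 k + 1"
proof -
  let ?m = "\<lceil>log 2 (c / k)\<rceil>" and ?M = "\<lfloor>log 2 c\<rfloor>"
  have sub: "{j. c / k \<le> rad j \<and> rad j \<le> c} \<subseteq> {?m..?M}"
  proof
    fix j assume j: "j \<in> {j. c / k \<le> rad j \<and> rad j \<le> c}"
    have "log 2 (c / k) \<le> log 2 (rad j)" "log 2 (rad j) \<le> log 2 c"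
      using j assms by (auto simp: divide_pos_pos)
    moreover have "log 2 (rad j) = j" by (simp add: rad_def)
    ultimately show "j \<in> {?m..?M}" by (simp add: ceiling_le_iff le_floor_iff)
  qed
  then show "finite {j. c / k \<le> rad j \<and> rad j \<le> c}" using finite_subset by blast
  have "card {j. c / k \<le> rad j \<and> rad j \<le> c} \<le> card {?m..?M}" using sub by (intro card_mono) auto
  then have "real (card {j. c / k \<le> rad j \<and> rad j \<le> c}) \<le> real (nat (?M - ?m + 1))" by simp
  also have "\<dots> \<le> log 2 k + 1"
  proof -
    have "log 2 (c / k) = log 2 c - log 2 k" using assms by (simp add: log_divide_pos)
    moreover have "0 \<le> log 2 k" using assms by simp
    ultimately have "real_of_int (?M - ?m + 1) \<le> log 2 k + 1" "0 \<le> log 2 k + 1" by linarith+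
    then show ?thesis by (cases "0 \<le> ?M - ?m + 1") auto
  qed
  finally show "real (card {j. c / k \<le> rad j \<and> rad j \<le> c}) \<le> log 2 k + 1" .
qed

context node_weighted begin

lemma sum_where_update:
  assumes "sane s"
  shows "sum_where Q (update G w s (a, b, p) (Some c)) = sum_where Q s +
      (case action G w s a b of Private x g \<Rightarrow>
         if Q (clock s, level (gap G w s a b), x, g) then rad (level (gap G w s a b)) else 0 | _ \<Rightarrow> 0)"
    "sum_where Q (update G w s (a, b, p) None) = sum_where Q s"
proof -
  show "sum_where Q (update G w s (a, b, p) (Some c)) = sum_where Q s +
      (case action G w s a b of Private x g \<Rightarrow>
         if Q (clock s, level (gap G w s a b), x, g) then rad (level (gap G w s a b)) else 0 | _ \<Rightarrow> 0)"
  proof (cases "action G w s a b")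
    case (Private x g)
    let ?e = "(clock s, level (gap G w s a b), x, g)"
    have ev: "events (update G w s (a, b, p) (Some c)) = insert ?e (events s)"
      using Private by (simp add: update_def connect_def Let_def)
    have fin: "finite {e \<in> events s. Q e}" using assms by (simp add: sane_def)
    have "{e \<in> insert ?e (events s). Q e} = (if Q ?e then insert ?e {e \<in> events s. Q e} else {e \<in> events s. Q e})"
      by auto
    then show ?thesis unfolding sum_where_def ev using fin fresh_event[OF assms] Private by simp
  qed (simp_all add: update_def connect_def Let_def sum_where_def)
qed (simp add: update_def sum_where_def)

lemma transition_events:
  assumes "t \<in> set_pmf (transition G w s (a, b, p))"
  obtains "events t = events s"
  | x g where "links G a b \<noteq> {}" "0 < gap G w s a b" "x \<in> {a, b}"
      "events t = insert (clock s, level (gap G w s a b), x, g) (events s)"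
  using assms
proof (cases rule: transition_cases)
  case skip
  then show ?thesis using that(1) by simp
next
  case (join c)
  show ?thesis
  proof (cases rule: action_cases[of G w s a b])
    case (priv x)
    then show ?thesis using that(2)[OF join(1) priv(2,3)] by (simp add: join(3) connect_def Let_def)
  qed (use that(1) in \<open>simp_all add: join(3) connect_def Let_def\<close>)
qed

lemma chain_skipped:
  "t \<in> set_pmf (chain (transition G w) initial \<sigma>) \<Longrightarrow> skipped t \<subseteq> {..<length \<sigma>}"
proof (induction \<sigma> arbitrary: t rule: rev_induct)
  case Nil
  then show ?case by (simp add: initial_def)
next
  case (snoc r \<sigma>)
  obtain a b p where r: "r = (a, b, p)" by (cases r)
  obtain s where s: "s \<in> set_pmf (chain (transition G w) initial \<sigma>)" "t \<in> set_pmf (transition G w s (a, b, p))"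
    using snoc.prems unfolding r by (auto simp: chain_snoc)
  note IH = snoc.IH[OF s(1)] and clk = chain_clock[OF s(1)]
  show ?case using s(2)
  proof (cases rule: transition_cases)
    case skip
    then show ?thesis using IH clk by (auto simp: less_SucI)
  next
    case (join c)
    have "skipped (connect G w s a b c) = skipped s" by (simp add: connect_def Let_def split: action.split)
    then show ?thesis using IH by (auto simp: join(3) less_SucI)
  qed
qed

text \<open>A lower bound on purpose: the weight of the trunk is the budget to which
  \<open>expected_penalty\<close> charges the penalties.\<close>

lemma expected_trunk_step:
  assumes s: "sane s"
  shows "ennreal (sum w (trunk s)) + ennreal (join_prob G w s (a, b, p) * gap G w s a b)
    \<le> (\<integral>\<^sup>+u. ennreal (sum w (trunk u)) \<partial>measure_pmf (transition G w s (a, b, p)))"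
proof -
  let ?q = "join_prob G w s (a, b, p)" and ?W = "sum w (trunk s)"
  have q: "0 \<le> ?q" "?q \<le> 1" by (rule join_prob_range)+
  have W: "0 \<le> ?W" using s by (intro sum_w_nonneg) (simp add: sane_def)
  have none: "trunk (update G w s (a, b, p) None) = trunk s" by (simp add: update_def)
  show ?thesis
  proof (cases "links G a b = {}")
    case True
    then show ?thesis unfolding nn_integral_transition none by (simp add: join_prob_no_links)
  next
    case ab: False
    have gap: "0 \<le> gap G w s a b" unfolding gap_def by (rule remaining_nonneg[OF ab])
    have some: "?W + gap G w s a b \<le> sum w (trunk (update G w s (a, b, p) (Some c)))" for c
    proof -
      obtain X where X: "X \<in> links G a b" "trunk (connect G w s a b c) = trunk s \<union> (X - solution G s)"
        "gap G w s a b \<le> link_cost w (solution G s) X"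
        by (rule connect_path[OF s ab, of c])
      show ?thesis
        using sum_trunk_connect[OF s link_subset[OF X(1)] X(2)] X(3) by (simp add: update_def Let_def)
    qed
    have "ennreal (?W + gap G w s a b) = (\<integral>\<^sup>+c. ennreal (?W + gap G w s a b) \<partial>measure_pmf (sample G w s a b))"
      by (simp add: measure_pmf.emeasure_space_1)
    also have "\<dots> \<le> (\<integral>\<^sup>+c. ennreal (sum w (trunk (update G w s (a, b, p) (Some c)))) \<partial>measure_pmf (sample G w s a b))"
      using some by (intro nn_integral_mono ennreal_leI)
    finally have "ennreal (?W + gap G w s a b) * ennreal ?q + ennreal ?W * ennreal (1 - ?q)
      \<le> (\<integral>\<^sup>+u. ennreal (sum w (trunk u)) \<partial>measure_pmf (transition G w s (a, b, p)))"
      unfolding nn_integral_transition none by (intro add_right_mono mult_right_mono) auto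
    moreover have "ennreal (?W + gap G w s a b) * ennreal ?q + ennreal ?W * ennreal (1 - ?q)
      = ennreal ((?W + gap G w s a b) * ?q + ?W * (1 - ?q))"
      using q W gap by (subst ennreal_plus) (simp_all add: ennreal_mult)
    moreover have "(?W + gap G w s a b) * ?q + ?W * (1 - ?q) = ?W + ?q * gap G w s a b"
      by (simp add: algebra_simps)
    ultimately show ?thesis using W q gap by (simp add: ennreal_plus)
  qed
qed

text \<open>Below the gap, the probability is penalty / gap, so the expected gap equals
  \<open>p\<close>, which also bounds the expected penalty. Otherwise the request is served for
  certain, with a gap of at most \<open>p\<close>; an infinite penalty then has probability 0 and
  contributes nothing.\<close>

lemma join_prob_balance:
  assumes "links G a b \<noteq> {}"
  shows "p * ennreal (1 - join_prob G w s (a, b, p)) \<le> ennreal (join_prob G w s (a, b, p) * gap G w s a b)"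
    "ennreal (join_prob G w s (a, b, p) * gap G w s a b) \<le> p"
proof -
  have "p * ennreal (1 - join_prob G w s (a, b, p)) \<le> ennreal (join_prob G w s (a, b, p) * gap G w s a b) \<and>
    ennreal (join_prob G w s (a, b, p) * gap G w s a b) \<le> p"
  proof (cases "ennreal (gap G w s a b) \<le> p")
    case True
    then show ?thesis using assms by (simp add: join_prob_def)
  next
    case False
    then have lt: "p < ennreal (gap G w s a b)" by (simp add: not_le)
    then have fin: "p \<noteq> \<top>" by auto
    have pos: "0 < gap G w s a b" using lt by (metis ennreal_neg not_less not_less_zero)
    have q: "join_prob G w s (a, b, p) * gap G w s a b = enn2real p"
      using False assms pos by (simp add: join_prob_def)
    have "p * ennreal (1 - join_prob G w s (a, b, p)) \<le> p * 1"
      using join_prob_range(1)[of G w s "(a, b, p)"] by (intro mult_left_mono) (simp_all add: ennreal_le_1)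
    then show ?thesis unfolding q using fin by (simp add: less_top)
  qed
  then show "p * ennreal (1 - join_prob G w s (a, b, p)) \<le> ennreal (join_prob G w s (a, b, p) * gap G w s a b)"
    "ennreal (join_prob G w s (a, b, p) * gap G w s a b) \<le> p" by auto
qed

lemma reward_le_gap: "0 \<le> gap G w s a b \<Longrightarrow> reward G w s a b \<le> gap G w s a b"
proof (cases rule: action_cases[of G w s a b])
  case (priv x)
  then show ?thesis using rad_level(1)[of "gap G w s a b"] rad_pos[of "level (gap G w s a b)"]
    unfolding reward_def priv(1) by simp
qed (simp_all add: reward_def)

end

section \<open>Charging the run to one fixed offline solution\<close>

locale offline = node_weighted G w
  for G :: "('v, 'e) pre_digraph" and w :: "'v \<Rightarrow> real" +
  fixes \<sigma> :: "'v request list" and S :: "'v set" and P :: "nat set"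
  assumes valid: "valid_requests G \<sigma>"
    and S_subset: "S \<subseteq> V"
    and P_subset: "P \<subseteq> {..<length \<sigma>}"
    and served: "\<And>i. i < length \<sigma> \<Longrightarrow> i \<notin> P \<Longrightarrow> connects G S (\<sigma> ! i)"
begin

abbreviation cost where "cost \<equiv> sum w S"
abbreviation run where "run n \<equiv> chain (transition G w) initial (take n \<sigma>)"

lemma cost_nonneg: "0 \<le> cost"
  by (rule sum_w_nonneg[OF S_subset])

lemma S_link:
  assumes "i < length \<sigma>" "i \<notin> P" "\<sigma> ! i = (a, b, p)"
  shows "S \<in> links G a b"
  using served[OF assms(1,2)] S_subset by (simp add: assms(3) connects_def links_def)

lemma run_sane: "t \<in> set_pmf (run n) \<Longrightarrow> sane t"
  using chain_invariant[of t _ 0] by (simp add: invariant_def)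

lemma run_clock: "t \<in> set_pmf (run n) \<Longrightarrow> n \<le> length \<sigma> \<Longrightarrow> clock t = n"
  using chain_clock by fastforce

lemma gap_le_cost: "S \<in> links G a b \<Longrightarrow> gap G w s a b \<le> cost"
  unfolding gap_def using remaining_le[of S a b "solution G s"] link_cost_antimono[OF S_subset, of "{}" "solution G s"]
  by (simp add: link_cost_def)

definition light :: "int \<Rightarrow> 'v \<Rightarrow> bool" where
  "light j x \<longleftrightarrow> (\<exists>X\<subseteq>S. (\<forall>u\<in>X. X \<in> links G x u) \<and> rad j < sum w X \<and> sum w X \<le> 2 * rad j)"

definition charged :: "nat \<times> int \<times> 'v \<times> bool \<Rightarrow> bool" where
  "charged e \<longleftrightarrow> (case e of (i, j, x, g) \<Rightarrow> i \<notin> P \<longrightarrow>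
     rad j \<le> cost \<and> (rim G w (rad j) x \<inter> S \<noteq> {} \<or> light j x))"

text \<open>The gap is at most the original distance, since bought vertices are free, and at most
  the offline cost, since \<open>S\<close> is a link. Being at least \<open>16 * rad\<close> it puts
  the radius below both, so \<open>rim_or_light\<close> applies to \<open>S\<close>.\<close>

lemma new_event_charged:
  assumes "S \<in> links G a b" "0 < gap G w s a b" "x \<in> {a, b}"
  shows "charged (i, level (gap G w s a b), x, g)"
proof -
  let ?j = "level (gap G w s a b)"
  obtain y where xy: "{x, y} = {a, b}" using assms(3) by auto
  have l: "links G a b = links G x y" using xy links_sym[of a b] by (auto simp: doubleton_eq_iff)
  have d: "16 * rad ?j \<le> gap G w s a b" by (rule rad_level(1)[OF assms(2)])
  have X: "cheapest G w {} x y \<in> links G a b" using cheapest_in[of x y "{}"] assms(1) l by auto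
  have "gap G w s a b \<le> link_cost w (solution G s) (cheapest G w {} x y)"
    unfolding gap_def by (rule remaining_le[OF X])
  also have "\<dots> \<le> link_cost w {} (cheapest G w {} x y)"
    by (rule link_cost_antimono[OF link_subset[OF X]]) simp
  finally have "rad ?j < remaining G w {} x y"
    using d rad_pos[of ?j] unfolding remaining_def by linarith
  moreover have "rad ?j \<le> cost" using d rad_pos[of ?j] gap_le_cost[OF assms(1), of s] by linarith
  ultimately show ?thesis
    using rim_or_light[of S x y "rad ?j"] assms(1) unfolding l charged_def light_def by (auto simp: less_imp_le)
qed

lemma run_charged: "n \<le> length \<sigma> \<Longrightarrow> t \<in> set_pmf (run n) \<Longrightarrow> e \<in> events t \<Longrightarrow> charged e"
proof (induction n arbitrary: t)
  case 0
  then show ?case by (simp add: initial_def)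
next
  case (Suc n)
  obtain a b p where r: "\<sigma> ! n = (a, b, p)" by (cases "\<sigma> ! n")
  obtain s where s: "s \<in> set_pmf (run n)" "t \<in> set_pmf (transition G w s (a, b, p))"
    using Suc.prems r by (auto simp: chain_snoc take_Suc_conv_app_nth)
  have old: "e \<in> events s \<Longrightarrow> charged e" using Suc s(1) by auto
  show ?case using s(2)
  proof (cases rule: transition_events)
    case 1
    then show ?thesis using Suc.prems old by simp
  next
    case (2 x g)
    show ?thesis
    proof (cases "n \<in> P")
      case True
      then show ?thesis using Suc.prems old 2(4) run_clock[OF s(1)] by (auto simp: charged_def)
    next
      case False
      then have "S \<in> links G a b" using S_link[of n] r Suc.prems by simp
      then show ?thesis using new_event_charged[OF _ 2(2,3)] Suc.prems(3) old 2(4) by auto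
    qed
  qed
qed

definition offline_penalty :: ennreal where
  "offline_penalty = (\<Sum>i\<in>P. penalty (\<sigma> ! i))"

lemma finite_P: "finite P"
  using P_subset finite_subset by blast

text \<open>Outside \<open>P\<close> the set \<open>S\<close> links the terminals, so
  \<open>join_prob_balance\<close> bounds the expected penalty of each step by the expected growth
  of the trunk. Penalties inside \<open>P\<close> are left to the offline solution.\<close>

lemma expected_penalty:
  "(\<integral>\<^sup>+t. (\<Sum>i\<in>skipped t - P. penalty (\<sigma> ! i)) \<partial>measure_pmf (chain (transition G w) initial \<sigma>))
    \<le> (\<integral>\<^sup>+t. ennreal (sum w (trunk t)) \<partial>measure_pmf (chain (transition G w) initial \<sigma>))"
proof (rule chain_compare)
  show "(\<Sum>i\<in>skipped initial - P. penalty (\<sigma> ! i)) \<le> ennreal (sum w (trunk initial))"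
    by (simp add: initial_def)
  fix i s assume i: "i < length \<sigma>" and s: "s \<in> set_pmf (run i)"
  obtain a b p where r: "\<sigma> ! i = (a, b, p)" by (cases "\<sigma> ! i")
  let ?q = "join_prob G w s (a, b, p)" and ?f = "\<lambda>t. \<Sum>i\<in>skipped t - P. penalty (\<sigma> ! i)"
  have q: "0 \<le> ?q" "?q \<le> 1" by (rule join_prob_range)+
  have q1: "ennreal ?q + ennreal (1 - ?q) = 1" using q by (simp flip: ennreal_plus)
  have clk: "clock s = i" using run_clock[OF s] i by simp
  have sk: "skipped s \<subseteq> {..<i}" using chain_skipped[OF s] i by simp
  have some: "skipped (update G w s (a, b, p) (Some c)) = skipped s" for c
    by (simp add: update_def connect_def Let_def split: action.split)
  have none: "skipped (update G w s (a, b, p) None) = insert i (skipped s)"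
    by (simp add: update_def clk)
  have fs: "?f (update G w s (a, b, p) None) = ?f s + (if i \<in> P then 0 else p)"
  proof -
    have "finite (skipped s - P)" using sk finite_subset by auto
    moreover have "i \<notin> skipped s" using sk by auto
    ultimately show ?thesis unfolding none by (simp add: insert_Diff_if r penalty_def add.commute)
  qed
  have "(\<integral>\<^sup>+u. ?f u \<partial>measure_pmf (transition G w s (\<sigma> ! i))) = ?f s * ennreal ?q + (?f s + (if i \<in> P then 0 else p)) * ennreal (1 - ?q)"
    unfolding r nn_integral_transition fs some by (simp add: measure_pmf.emeasure_space_1)
  also have "\<dots> = ?f s * (ennreal ?q + ennreal (1 - ?q)) + (if i \<in> P then 0 else p) * ennreal (1 - ?q)"
    by (simp add: distrib_left distrib_right add_ac)
  also have "\<dots> \<le> ?f s + ennreal (?q * gap G w s a b)"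
  proof -
    have "(if i \<in> P then 0 else p) * ennreal (1 - ?q) \<le> ennreal (?q * gap G w s a b)"
      using S_link[OF i _ r] join_prob_balance(1)[of a b p s] by auto
    then show ?thesis unfolding q1 by (simp add: add_left_mono)
  qed
  finally show "\<exists>d. (\<integral>\<^sup>+u. ?f u \<partial>measure_pmf (transition G w s (\<sigma> ! i))) \<le> ?f s + d \<and>
    ennreal (sum w (trunk s)) + d \<le> (\<integral>\<^sup>+u. ennreal (sum w (trunk u)) \<partial>measure_pmf (transition G w s (\<sigma> ! i)))"
    using expected_trunk_step[OF run_sane[OF s], of a b p] unfolding r by blast
qed

lemma expected_unserved:
  "(\<integral>\<^sup>+t. ennreal (sum_where (\<lambda>e. fst e \<in> P) t) \<partial>measure_pmf (chain (transition G w) initial \<sigma>)) \<le> offline_penalty"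
proof -
  let ?Q = "\<lambda>e :: nat \<times> int \<times> 'v \<times> bool. fst e \<in> P"
  \<comment> \<open>The offline penalties incurred so far, written as a function of the clock so
    that \<open>chain_compare\<close> can treat them as part of the state.\<close>
  let ?g = "\<lambda>t :: 'v state. \<Sum>i\<in>P \<inter> {..<clock t}. penalty (\<sigma> ! i)"
  have "(\<integral>\<^sup>+t. ennreal (sum_where ?Q t) \<partial>measure_pmf (chain (transition G w) initial \<sigma>))
    \<le> (\<integral>\<^sup>+t. ?g t \<partial>measure_pmf (chain (transition G w) initial \<sigma>))"
  proof (rule chain_compare)
    show "ennreal (sum_where ?Q initial) \<le> ?g initial"
      by (simp add: initial_def sum_where_def)
    fix i s assume i: "i < length \<sigma>" and s: "s \<in> set_pmf (run i)"
    obtain a b p where r: "\<sigma> ! i = (a, b, p)" by (cases "\<sigma> ! i")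
    let ?q = "join_prob G w s (a, b, p)" and ?p = "if i \<in> P then p else 0"
    have q: "0 \<le> ?q" "?q \<le> 1" by (rule join_prob_range)+
    have sane: "sane s" by (rule run_sane[OF s])
    have clk: "clock s = i" using run_clock[OF s] i by simp
    have g: "?g (update G w s (a, b, p) z) = ?g s + ?p" for z
    proof -
      have "clock (update G w s (a, b, p) z) = Suc i"
        by (simp add: update_def Let_def clk split: option.split)
      then show ?thesis unfolding clk
        by (simp add: lessThan_Suc Int_insert_right r penalty_def add.commute)
    qed
    let ?x = "if i \<in> P then reward G w s a b else 0"
    have x: "0 \<le> ?x" using reward_nonneg[of G w s a b] by simp
    have inc: "sum_where ?Q (update G w s (a, b, p) (Some c)) = sum_where ?Q s + ?x" for c
      unfolding sum_where_update(1)[OF sane] by (auto simp: clk reward_def split: action.split)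
    have "(\<integral>\<^sup>+u. ennreal (sum_where ?Q u) \<partial>measure_pmf (transition G w s (\<sigma> ! i))) = ennreal (sum_where ?Q s) + ennreal (?q * ?x)"
      unfolding r
    proof (rule nn_integral_transition_simple)
      show "ennreal (sum_where ?Q (update G w s (a, b, p) (Some c))) = ennreal (sum_where ?Q s) + ennreal ?x" for c
        unfolding inc using sum_where_nonneg x by (rule ennreal_plus)
    qed (use x sum_where_update(2)[OF sane] in auto)
    moreover have "ennreal (?q * ?x) \<le> ?p"
    proof (cases "i \<in> P \<and> links G a b \<noteq> {}")
      case True
      then have "0 \<le> gap G w s a b" unfolding gap_def by (intro remaining_nonneg) auto
      then have "ennreal (?q * reward G w s a b) \<le> ennreal (?q * gap G w s a b)"
        using q by (intro ennreal_leI mult_left_mono reward_le_gap)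
      also have "\<dots> \<le> p" using True join_prob_balance(2) by blast
      finally show ?thesis using True by simp
    qed (auto simp: join_prob_no_links)
    moreover have "(\<integral>\<^sup>+u. ?g u \<partial>measure_pmf (transition G w s (\<sigma> ! i))) = ?g s + ?p"
    proof -
      have "(\<integral>\<^sup>+u. ?g u \<partial>measure_pmf (transition G w s (\<sigma> ! i))) = (\<integral>\<^sup>+z. ?g s + ?p \<partial>measure_pmf (transition G w s (\<sigma> ! i)))"
        unfolding r transition_def nn_integral_map_pmf g by simp
      then show ?thesis by (simp add: measure_pmf.emeasure_space_1)
    qed
    ultimately show "\<exists>d. (\<integral>\<^sup>+u. ennreal (sum_where ?Q u) \<partial>measure_pmf (transition G w s (\<sigma> ! i))) \<le> ennreal (sum_where ?Q s) + d \<and>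
      ?g s + d \<le> (\<integral>\<^sup>+u. ?g u \<partial>measure_pmf (transition G w s (\<sigma> ! i)))"
      by (intro exI[of _ ?p]) (simp add: add_left_mono)
  qed
  also have "\<dots> \<le> (\<integral>\<^sup>+t. offline_penalty \<partial>measure_pmf (chain (transition G w) initial \<sigma>))"
    unfolding offline_penalty_def by (intro nn_integral_mono sum_mono2 finite_P) auto
  also have "\<dots> = offline_penalty" by (simp add: measure_pmf.emeasure_space_1)
  finally show ?thesis .
qed

definition levels :: "int set" where
  "levels = {j. cost / real (length \<sigma>) \<le> rad j \<and> rad j \<le> cost}"

text \<open>Events without a weight update on requests that the offline solution serves. The
  restriction to \<open>levels\<close> leaves finitely many scales; smaller radii are covered by
  \<open>small_events\<close>.\<close>

definition missed :: "nat \<times> int \<times> 'v \<times> bool \<Rightarrow> bool" where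
  "missed e \<longleftrightarrow> (case e of (i, j, x, g) \<Rightarrow> i \<notin> P \<and> \<not> g \<and> j \<in> levels)"

lemma levels_finite: "\<sigma> \<noteq> [] \<Longrightarrow> finite levels"
  and levels_card: "\<sigma> \<noteq> [] \<Longrightarrow> real (card levels) \<le> log 2 (real (length \<sigma>)) + 1"
proof -
  assume "\<sigma> \<noteq> []"
  then have k: "1 \<le> real (length \<sigma>)" by (cases \<sigma>) auto
  have "finite levels \<and> real (card levels) \<le> log 2 (real (length \<sigma>)) + 1"
  proof (cases "cost = 0")
    case True
    then have "levels = {}" using rad_pos by (auto simp: levels_def not_le)
    moreover have "0 \<le> log 2 (real (length \<sigma>))"
      using k by (intro zero_le_log_cancel_iff[THEN iffD2]) linarith+
    ultimately show ?thesis by simp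
  next
    case False
    then have "0 < cost" using cost_nonneg by simp
    then show ?thesis using card_levels[OF _ k] by (simp add: levels_def)
  qed
  then show "finite levels" "real (card levels) \<le> log 2 (real (length \<sigma>)) + 1" by auto
qed

text \<open>\<open>expected_survival\<close> needs a fixed set, whereas level and terminal of an
  event are chosen by the run. Hence the bound is summed over \<open>levels\<close> and both
  terminals of each request, which gives the factor \<open>2 * card levels\<close>.\<close>

lemma expected_missed:
  assumes "\<sigma> \<noteq> []"
  shows "(\<integral>\<^sup>+t. ennreal (sum_where missed t) \<partial>measure_pmf (chain (transition G w) initial \<sigma>))
    \<le> ennreal (2 * real (card levels) * cost)"
proof -
  let ?c = "2 * real (card levels) * cost"
  have fin: "finite levels" by (rule levels_finite[OF assms])
  have "(\<integral>\<^sup>+t. ennreal (sum_where missed t) \<partial>measure_pmf (run n)) \<le> ennreal (\<Sum>i<n. ?c * (1 / (real i + 2)\<^sup>2))"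
    if "n \<le> length \<sigma>" for n
    using that
  proof (induction n)
    case 0
    then show ?case by (simp add: initial_def sum_where_def)
  next
    case (Suc i)
    then have i: "i < length \<sigma>" by simp
    obtain a b p where r: "\<sigma> ! i = (a, b, p)" by (cases "\<sigma> ! i")
    let ?z = "1 / (real i + 2)\<^sup>2"
    define B where "B jx = rim G w (rad (fst jx)) (snd jx)" for jx :: "int \<times> 'v"
    define h where "h jx s = (if fac s \<inter> B jx = {} then ennreal (exp (sum (wt s) (B jx \<inter> V))) else 0)" for jx and s :: "'v state"
    let ?I = "levels \<times> {a, b}"
    have step: "(\<integral>\<^sup>+u. ennreal (sum_where missed u) \<partial>measure_pmf (transition G w s (\<sigma> ! i)))
      \<le> ennreal (sum_where missed s) + (\<Sum>jx\<in>?I. ennreal (cost * ?z) * h jx s)" if s: "s \<in> set_pmf (run i)" for s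
    proof -
      let ?q = "join_prob G w s (a, b, p)" and ?j = "level (gap G w s a b)"
      have q: "0 \<le> ?q" "?q \<le> 1" by (rule join_prob_range)+
      have sane: "sane s" by (rule run_sane[OF s])
      have clk: "clock s = i" using run_clock[OF s] i by simp
      define y where "y = (case action G w s a b of Private x g \<Rightarrow> if missed (clock s, ?j, x, g) then rad ?j else 0 | _ \<Rightarrow> 0)"
      have y0: "0 \<le> y" by (auto simp: y_def less_imp_le split: action.split)
      have "(\<integral>\<^sup>+u. ennreal (sum_where missed u) \<partial>measure_pmf (transition G w s (\<sigma> ! i))) = ennreal (sum_where missed s) + ennreal (?q * y)"
        unfolding r
      proof (rule nn_integral_transition_simple)
        show "ennreal (sum_where missed (update G w s (a, b, p) (Some c))) = ennreal (sum_where missed s) + ennreal y" for c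
          unfolding sum_where_update(1)[OF sane] y_def[symmetric] using sum_where_nonneg y0 by (rule ennreal_plus)
      qed (use y0 sum_where_update(2)[OF sane] in auto)
      also have "ennreal (?q * y) \<le> ennreal y" using q y0 by (intro ennreal_leI mult_left_le_one_le)
      also have "ennreal y \<le> (\<Sum>jx\<in>?I. ennreal (cost * ?z) * h jx s)"
      proof (cases "y = 0")
        case False
        show ?thesis
        proof (cases rule: action_cases[of G w s a b])
          case (priv x)
          let ?A = "sum (wt s) (rim G w (rad ?j) x)"
          have y: "y = rad ?j" and ms: "missed (i, ?j, x, ?A < limit (clock s))"
            using False priv(1) by (auto simp: y_def clk split: if_splits)
          then have iP: "i \<notin> P" and A: "limit i \<le> ?A" and jl: "?j \<in> levels"
            by (auto simp: missed_def clk)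
          have mem: "(?j, x) \<in> ?I" using jl priv(3) by auto
          have "B (?j, x) \<inter> V = rim G w (rad ?j) x" using rim_subset by (auto simp: B_def)
          moreover have "fac s \<inter> B (?j, x) = {}" using priv(5) by (auto simp: B_def facilities_def)
          ultimately have h: "h (?j, x) s = ennreal (exp ?A)" by (simp add: h_def)
          have "rad ?j \<le> cost" using jl by (simp add: levels_def)
          \<comment> \<open>A Markov bound: a missed event has rim weight at least
            \<open>limit i\<close>, and \<open>exp (limit i)\<close> is the reciprocal of
            \<open>?z\<close>.\<close>
          also have "cost = cost * ?z * exp (limit i)" by (simp add: exp_limit)
          also have "\<dots> \<le> cost * ?z * exp ?A" using A cost_nonneg by (intro mult_left_mono) auto
          finally have "ennreal y \<le> ennreal (cost * ?z) * h (?j, x) s"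
            unfolding h y using cost_nonneg by (simp add: ennreal_leI flip: ennreal_mult)
          also have "\<dots> \<le> (\<Sum>jx\<in>?I. ennreal (cost * ?z) * h jx s)"
            using mem fin by (intro member_le_sum) auto
          finally show ?thesis .
        qed (use False in \<open>simp_all add: y_def\<close>)
      qed simp
      finally show ?thesis by (simp add: add_left_mono)
    qed
    have "(\<integral>\<^sup>+t. ennreal (sum_where missed t) \<partial>measure_pmf (run (Suc i)))
      \<le> (\<integral>\<^sup>+s. ennreal (sum_where missed s) + (\<Sum>jx\<in>?I. ennreal (cost * ?z) * h jx s) \<partial>measure_pmf (run i))"
      unfolding nn_integral_chain_step[OF i] using step by (rule nn_integral_pmf_mono)
    also have "\<dots> = (\<integral>\<^sup>+s. ennreal (sum_where missed s) \<partial>measure_pmf (run i))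
        + (\<Sum>jx\<in>?I. ennreal (cost * ?z) * (\<integral>\<^sup>+s. h jx s \<partial>measure_pmf (run i)))"
      by (simp add: nn_integral_pmf_add nn_integral_sum nn_integral_cmult)
    also have "\<dots> \<le> ennreal (\<Sum>i<i. ?c * (1 / (real i + 2)\<^sup>2)) + (\<Sum>jx\<in>?I. ennreal (cost * ?z) * 1)"
      unfolding h_def using Suc by (intro add_mono sum_mono mult_left_mono expected_survival) auto
    also have "(\<Sum>jx\<in>?I. ennreal (cost * ?z) * 1) = ennreal (real (card ?I) * (cost * ?z))"
      using cost_nonneg by (subst ennreal_mult) (simp_all add: ennreal_of_nat_eq_real_of_nat)
    also have "\<dots> \<le> ennreal (?c * ?z)"
    proof (rule ennreal_leI)
      have "card ?I \<le> card levels * 2" using fin by (simp add: card_cartesian_product card_insert_if)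
      then have "real (card ?I) \<le> 2 * real (card levels)" by simp
      then have "real (card ?I) * (cost * ?z) \<le> 2 * real (card levels) * (cost * ?z)"
        using cost_nonneg by (intro mult_right_mono) auto
      then show "real (card ?I) * (cost * ?z) \<le> ?c * ?z" by (simp add: mult.assoc)
    qed
    also have "ennreal (\<Sum>i<i. ?c * (1 / (real i + 2)\<^sup>2)) + ennreal (?c * ?z) = ennreal (\<Sum>i<Suc i. ?c * (1 / (real i + 2)\<^sup>2))"
      using cost_nonneg by (subst ennreal_plus[symmetric]) (auto intro!: sum_nonneg)
    finally show ?case by (simp add: add_left_mono)
  qed
  from this[of "length \<sigma>"]
  have "(\<integral>\<^sup>+t. ennreal (sum_where missed t) \<partial>measure_pmf (chain (transition G w) initial \<sigma>))
    \<le> ennreal (\<Sum>i<length \<sigma>. ?c * (1 / (real i + 2)\<^sup>2))" by simp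
  also have "\<dots> \<le> ennreal ?c"
    unfolding sum_distrib_left[symmetric]
    using cost_nonneg sum_inverse_squares[of "length \<sigma>"] by (intro ennreal_leI mult_left_le) auto
  finally show ?thesis .
qed

end

section \<open>Cost of the online solution in terms of event radii\<close>

context node_weighted begin

lemma sum_facilities_le:
  assumes "sane s" "weight_bound s"
  shows "sum w (facilities G s) \<le> sum w (fac s) + event_sum s"
proof -
  let ?D = "{v \<in> V. 1 \<le> wt s v}"
  have "sum w ?D \<le> (\<Sum>v\<in>?D. w v * wt s v)" 
  proof (rule sum_mono)
    fix v assume "v \<in> ?D"
    then show "w v \<le> w v * wt s v" using mult_left_mono[of 1 "wt s v" "w v"] w_nonneg[of v] by simp
  qed
  also have "\<dots> \<le> (\<Sum>v\<in>V. w v * wt s v)"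
    using assms(1) w_nonneg by (intro sum_mono2) (auto simp: sane_def)
  also have "\<dots> \<le> event_sum s" using assms(2) by (simp add: weight_bound_def)
  finally show ?thesis
    using sum_w_Un[of "fac s" ?D] assms(1) unfolding facilities_def sane_def by auto
qed

text \<open>The levels of a facility hub \<open>h\<close> give distinct powers of two of size at
  most \<open>w h\<close>, with sum at most \<open>2 * w h\<close>; every other hub is the centre of
  an event.\<close>

lemma rad_sum_hubs_le:
  assumes "sane s" "hub_origin s"
  shows "rad_sum (hubs s) \<le> 2 * sum w (facilities G s) + event_sum s"
proof -
  let ?F = "facilities G s"
  let ?A = "{(j, h) \<in> hubs s. h \<in> ?F \<and> rad j \<le> w h}"
  let ?B = "(\<lambda>e. (fst (snd e), fst (snd (snd e)))) ` events s"
  have fin: "finite (hubs s)" "finite (events s)" using assms(1) by (auto simp: sane_def)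
  have finA: "finite ?A" by (rule finite_subset[OF _ fin(1)]) auto
  have FV: "?F \<subseteq> V" by (rule facilities_subset[OF assms(1)])
  have sub: "hubs s \<subseteq> ?A \<union> ?B"
  proof
    fix x assume x: "x \<in> hubs s"
    obtain j h where jh: "x = (j, h)" by (cases x)
    then have "(h \<in> ?F \<and> rad j \<le> w h) \<or> (\<exists>i g. (i, j, h, g) \<in> events s)"
      using assms(2) x unfolding hub_origin_def by blast
    then show "x \<in> ?A \<union> ?B" using x jh by (force simp: image_iff)
  qed
  have "rad_sum (hubs s) \<le> rad_sum (?A \<union> ?B)"
    unfolding rad_sum_def using sub finA fin by (intro sum_mono2) (auto simp: less_imp_le)
  also have "\<dots> \<le> rad_sum ?A + rad_sum ?B"
    unfolding rad_sum_def using finA fin by (subst sum.union_inter[symmetric]) (auto intro!: sum_nonneg simp: less_imp_le)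
  also have "rad_sum ?B \<le> event_sum s"
    unfolding rad_sum_def event_sum_def using fin
    by (intro order_trans[OF sum_image_le]) (auto simp: less_imp_le)
  also have "rad_sum ?A \<le> 2 * sum w ?F"
  proof -
    let ?J = "\<lambda>h. {j. (j, h) \<in> hubs s \<and> rad j \<le> w h}"
    have finJ: "finite (?J h)" for h
      by (rule finite_subset[of _ "fst ` hubs s"]) (use fin in force)+
    have "rad_sum ?A = (\<Sum>h\<in>?F. sum rad (?J h))"
    proof -
      have "(\<Sum>h\<in>?F. sum rad (?J h)) = (\<Sum>(h, j)\<in>Sigma ?F ?J. rad j)"
        using finite_subV[OF FV] finJ by (intro sum.Sigma) auto
      also have "\<dots> = rad_sum ?A"
        unfolding rad_sum_def
        by (rule sum.reindex_bij_witness[of _ "\<lambda>(j, h). (h, j)" "\<lambda>(h, j). (j, h)"]) auto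
      finally show ?thesis by simp
    qed
    also have "\<dots> \<le> (\<Sum>h\<in>?F. 2 * w h)"
      using finJ FV w_nonneg by (intro sum_mono rad_sum_bounded) auto
    finally show ?thesis by (simp add: sum_distrib_left)
  qed
  finally show ?thesis by simp
qed

text \<open>With F the facility weight and E the event sum, the trunk is at most 80 (2 F + E), so
  twice the trunk plus F is at most 321 F + 160 E; F is at most the weight of \<open>fac\<close>
  plus E. The trunk is counted a second time to pay for penalties.\<close>

lemma solution_cost_bound:
  assumes "invariant K s"
  shows "sum w (solution G s) + sum w (trunk s) \<le> 321 * sum w (fac s) + 481 * event_sum s"
proof -
  have i: "sane s" "cost_bound s" "hub_origin s" "weight_bound s" using assms by (auto simp: invariant_def)
  have "0 \<le> rad_sum (comps G (solution G s) (hubs s))"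
    unfolding rad_sum_def by (intro sum_nonneg) (simp add: less_imp_le)
  then have "sum w (trunk s) \<le> 80 * rad_sum (hubs s)" using i(2) by (simp add: cost_bound_def)
  moreover note rad_sum_hubs_le[OF i(1,3)] sum_facilities_le[OF i(1,4)]
  moreover have "sum w (solution G s) \<le> sum w (trunk s) + sum w (facilities G s)"
    unfolding solution_def using i(1) facilities_subset by (intro sum_w_Un) (auto simp: sane_def)
  ultimately show ?thesis by linarith
qed

end

section \<open>Bounds for the kinds of events and the expected total cost\<close>

context offline begin

lemma sum_where_filter:
  "sane t \<Longrightarrow> sum_where Q t = (\<Sum>e\<in>events t. if Q e then rad (fst (snd e)) else 0)"
  unfolding sum_where_def by (rule sum.inter_filter) (simp add: sane_def)

lemma small_events:
  assumes t: "t \<in> set_pmf (run (length \<sigma>))" and ne: "\<sigma> \<noteq> []"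
  shows "sum_where (\<lambda>e. rad (fst (snd e)) < cost / real (length \<sigma>)) t \<le> cost"
proof -
  let ?k = "real (length \<sigma>)" and ?A = "{e \<in> events t. rad (fst (snd e)) < cost / real (length \<sigma>)}"
  have s: "sane t" "clock t = length \<sigma>" using run_sane[OF t] run_clock[OF t] by auto
  have k: "0 < ?k" using ne by simp
  have "card ?A \<le> card (events t)" using s by (intro card_mono) (auto simp: sane_def)
  also have "\<dots> = card (fst ` events t)" using s by (intro card_image[symmetric]) (simp add: sane_def)
  also have "\<dots> \<le> card {..<length \<sigma>}" using s by (intro card_mono) (auto simp: sane_def)
  finally have "real (card ?A) \<le> ?k" by simp
  have "sum_where (\<lambda>e. rad (fst (snd e)) < cost / ?k) t \<le> real (card ?A) * (cost / ?k)"
    unfolding sum_where_def by (intro sum_bounded_above) auto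
  also have "\<dots> \<le> ?k * (cost / ?k)" using \<open>real (card ?A) \<le> ?k\<close> cost_nonneg by (intro mult_right_mono) auto
  also have "\<dots> = cost" using k by simp
  finally show ?thesis .
qed

text \<open>Every such event is counted at the vertices of \<open>S\<close> on its rim. Exchanging
  the sums gives \<open>good_near\<close>, and the bound 3 on the weights turns
  \<open>growth_bound\<close> into the factor \<open>ln (3 * n + 1)\<close>.\<close>

lemma heavy_events:
  assumes t: "t \<in> set_pmf (run (length \<sigma>))"
  shows "sum_where (\<lambda>(i, j, x, g). g \<and> rim G w (rad j) x \<inter> S \<noteq> {}) t
    \<le> 2 * cost * (limit (length \<sigma>) + 2) * ln (3 * real (card V) + 1)"
proof -
  let ?K = "length \<sigma>" and ?n = "real (card V)"
  have inv: "invariant ?K t" using chain_invariant t by simp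
  have s: "sane t" "growth_bound ?K t" using inv run_clock[OF t] by (auto simp: invariant_def)
  have fin: "finite (events t)" "finite S" using s(1) finite_subV[OF S_subset] by (auto simp: sane_def)
  let ?in = "\<lambda>(i :: nat, j, x, g) v. g \<and> v \<in> rim G w (rad j) x"
  have gn: "good_near t v = (\<Sum>e\<in>events t. if ?in e v then rad (fst (snd e)) else 0)" for v
    unfolding good_near_def using fin(1)
    by (subst sum.inter_filter[symmetric]) (auto intro!: sum.cong)
  have "sum_where (\<lambda>(i, j, x, g). g \<and> rim G w (rad j) x \<inter> S \<noteq> {}) t
    \<le> (\<Sum>e\<in>events t. \<Sum>v\<in>S. if ?in e v then rad (fst (snd e)) else 0)"
    unfolding sum_where_filter[OF s(1)]
  proof (rule sum_mono)
    fix e assume "e \<in> events t"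
    obtain i j x g where e: "e = (i, j, x, g)" by (cases e)
    show "(if (case e of (i, j, x, g) \<Rightarrow> g \<and> rim G w (rad j) x \<inter> S \<noteq> {}) then rad (fst (snd e)) else 0)
      \<le> (\<Sum>v\<in>S. if ?in e v then rad (fst (snd e)) else 0)"
    proof (cases "g \<and> rim G w (rad j) x \<inter> S \<noteq> {}")
      case True
      then obtain v where v: "v \<in> S" "?in e v" by (auto simp: e)
      have "rad j \<le> (if ?in e v then rad (fst (snd e)) else 0)" using v by (simp add: e)
      also have "\<dots> \<le> (\<Sum>v\<in>S. if ?in e v then rad (fst (snd e)) else 0)"
        using v fin by (intro member_le_sum) (auto simp: less_imp_le)
      finally show ?thesis using True by (simp add: e)
    qed (auto simp: e less_imp_le intro!: sum_nonneg)
  qed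
  also have "\<dots> = (\<Sum>v\<in>S. good_near t v)" unfolding gn by (rule sum.swap)
  also have "\<dots> \<le> (\<Sum>v\<in>S. 2 * w v * (limit ?K + 2) * ln (3 * ?n + 1))"
  proof (rule sum_mono)
    fix v assume "v \<in> S"
    then have v: "v \<in> V" using S_subset by auto
    have b: "0 \<le> wt t v" "wt t v \<le> 3" using s(1) v by (auto simp: sane_def)
    have "?n * wt t v \<le> ?n * 3" using b by (intro mult_left_mono) auto
    then have "ln (?n * wt t v + 1) \<le> ln (3 * ?n + 1)"
      using b by (subst ln_le_cancel_iff) (auto intro!: add_nonneg_pos)
    then have "2 * w v * (limit ?K + 2) * ln (?n * wt t v + 1) \<le> 2 * w v * (limit ?K + 2) * ln (3 * ?n + 1)"
      using w_nonneg[OF v] limit_ge[of ?K] by (intro mult_left_mono) auto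
    then show "good_near t v \<le> 2 * w v * (limit ?K + 2) * ln (3 * ?n + 1)"
      using s(2) v unfolding growth_bound_def by fastforce
  qed
  also have "\<dots> = 2 * cost * (limit ?K + 2) * ln (3 * ?n + 1)"
    by (simp only: sum_distrib_left[symmetric] sum_distrib_right[symmetric])
  finally show ?thesis .
qed

text \<open>Separated centres of one level have disjoint light pieces inside \<open>S\<close>, each
  heavier than the radius, so the radii fit into the weight of \<open>S\<close>.\<close>

lemma light_events_level:
  assumes t: "t \<in> set_pmf (run (length \<sigma>))"
  shows "(\<Sum>e\<in>{(i, j', x, g) \<in> events t. j' = j \<and> light j x}. rad j) \<le> cost"
proof -
  let ?E = "{(i, j', x, g) \<in> events t. j' = j \<and> light j x}"
  have inv: "sane t" "separated t" using chain_invariant[OF t, of 0] by (auto simp: invariant_def)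
  have fin: "finite ?E" by (rule finite_subset[of _ "events t"]) (use inv in \<open>auto simp: sane_def\<close>)
  have ex: "\<forall>x. \<exists>X. light j x \<longrightarrow> X \<subseteq> S \<and> (\<forall>u\<in>X. X \<in> links G x u) \<and> rad j < sum w X \<and> sum w X \<le> 2 * rad j"
    unfolding light_def by blast
  obtain Y where Y: "\<forall>x. light j x \<longrightarrow> Y x \<subseteq> S \<and> (\<forall>u\<in>Y x. Y x \<in> links G x u) \<and>
      rad j < sum w (Y x) \<and> sum w (Y x) \<le> 2 * rad j"
    using choice[OF ex] by blast
  define X where "X e = Y (fst (snd (snd e)))" for e :: "nat \<times> int \<times> 'v \<times> bool"
  have X: "X e \<subseteq> S" "\<forall>u\<in>X e. X e \<in> links G (fst (snd (snd e))) u" "rad j < sum w (X e)" "sum w (X e) \<le> 2 * rad j"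
    if "e \<in> ?E" for e
  proof -
    have "light j (fst (snd (snd e)))" using that by auto
    then show "X e \<subseteq> S" "\<forall>u\<in>X e. X e \<in> links G (fst (snd (snd e))) u" "rad j < sum w (X e)" "sum w (X e) \<le> 2 * rad j"
      using Y unfolding X_def by simp_all
  qed
  have disj: "X e \<inter> X e' = {}" if e: "e \<in> ?E" "e' \<in> ?E" "e \<noteq> e'" for e e'
  proof -
    obtain i x g where 1: "e = (i, j, x, g)" "(i, j, x, g) \<in> events t" using e(1) by auto
    obtain i' x' g' where 2: "e' = (i', j, x', g')" "(i', j, x', g') \<in> events t" using e(2) by auto
    have "(i, x, g) \<noteq> (i', x', g')" using e(3) 1 2 by auto
    then have sep: "\<not> (near G w (4 * rad j) x x' \<and> near G w (4 * rad j) x' x)"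
      using inv(2) 1(2) 2(2) unfolding separated_def by meson
    have x: "fst (snd (snd e)) = x" "fst (snd (snd e')) = x'" by (simp_all add: 1 2)
    show ?thesis
      by (rule light_disjoint[OF X(2)[OF e(1), unfolded x] X(2)[OF e(2), unfolded x] X(4)[OF e(1)] X(4)[OF e(2)] sep])
  qed
  have "(\<Sum>e\<in>?E. rad j) \<le> (\<Sum>e\<in>?E. sum w (X e))" using X(3) by (intro sum_mono less_imp_le)
  also have "\<dots> = sum w (\<Union>e\<in>?E. X e)"
  proof (rule sum.UNION_disjoint[symmetric, OF fin])
    show "\<forall>e\<in>?E. finite (X e)" using X(1) S_subset finite_subV by (meson subset_trans)
    show "\<forall>e\<in>?E. \<forall>e'\<in>?E. e \<noteq> e' \<longrightarrow> X e \<inter> X e' = {}" using disj by blast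
  qed
  also have "\<dots> \<le> cost" by (rule sum_w_mono[OF _ S_subset]) (use X(1) in blast)
  finally show ?thesis .
qed

lemma light_events:
  assumes t: "t \<in> set_pmf (run (length \<sigma>))" and ne: "\<sigma> \<noteq> []"
  shows "sum_where (\<lambda>(i, j, x, g). j \<in> levels \<and> light j x) t \<le> real (card levels) * cost"
proof -
  have sane: "sane t" by (rule run_sane[OF t])
  let ?E = "\<lambda>j. {(i, j', x, g) \<in> events t. j' = j \<and> light j x}"
  have fin: "finite (?E j)" for j by (rule finite_subset[of _ "events t"]) (use sane in \<open>auto simp: sane_def\<close>)
  have set: "{e \<in> events t. case e of (i, j, x, g) \<Rightarrow> j \<in> levels \<and> light j x} = (\<Union>j\<in>levels. ?E j)"
    by auto
  have "sum_where (\<lambda>(i, j, x, g). j \<in> levels \<and> light j x) t = (\<Sum>j\<in>levels. \<Sum>e\<in>?E j. rad (fst (snd e)))"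
    unfolding sum_where_def set using levels_finite[OF ne] fin by (intro sum.UNION_disjoint) auto
  also have "\<dots> = (\<Sum>j\<in>levels. \<Sum>e\<in>?E j. rad j)" by (intro sum.cong) auto
  also have "\<dots> \<le> (\<Sum>j\<in>levels. cost)" using light_events_level[OF t] by (intro sum_mono)
  finally show ?thesis by simp
qed

lemma event_sum_split:
  assumes t: "t \<in> set_pmf (run (length \<sigma>))" and ne: "\<sigma> \<noteq> []"
  shows "event_sum t \<le> sum_where (\<lambda>e. fst e \<in> P) t + sum_where missed t +
    cost * (1 + real (card levels) + 2 * (limit (length \<sigma>) + 2) * ln (3 * real (card V) + 1))"
proof -
  let ?Q = "\<lambda>e :: nat \<times> int \<times> 'v \<times> bool. rad (fst (snd e)) < cost / real (length \<sigma>)"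
  let ?H = "\<lambda>(i :: nat, j, x, g). g \<and> rim G w (rad j) x \<inter> S \<noteq> {}"
  let ?L = "\<lambda>(i :: nat, j, x, g :: bool). j \<in> levels \<and> light j x"
  have sane: "sane t" by (rule run_sane[OF t])
  have "event_sum t \<le> sum_where (\<lambda>e. fst e \<in> P) t + sum_where missed t + (sum_where ?Q t + sum_where ?H t + sum_where ?L t)"
    unfolding sum_where_filter[OF sane] event_sum_def sum.distrib[symmetric]
  proof (rule sum_mono)
    fix e assume e: "e \<in> events t"
    obtain i j x g where ee: "e = (i, j, x, g)" by (cases e)
    have "charged e" by (rule run_charged[OF _ t e]) simp
    \<comment> \<open>A served event that is not small lies in \<open>levels\<close>; without an
      update it is missed, and with one it meets \<open>S\<close> on its rim or is light.\<close>
    then have "fst e \<in> P \<or> missed e \<or> ?Q e \<or> ?H e \<or> ?L e"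
      by (auto simp: charged_def missed_def levels_def ee)
    then show "rad (fst (snd e)) \<le> (if fst e \<in> P then rad (fst (snd e)) else 0) + (if missed e then rad (fst (snd e)) else 0)
      + ((if ?Q e then rad (fst (snd e)) else 0) + (if ?H e then rad (fst (snd e)) else 0) + (if ?L e then rad (fst (snd e)) else 0))"
      using rad_pos[of "fst (snd e)"] by (smt (verit))
  qed
  then show ?thesis
    using small_events[OF t ne] heavy_events[OF t] light_events[OF t ne] by (simp add: algebra_simps)
qed

text \<open>One share for the small events, one per level for the light ones, two per level for the
  missed ones, and the last summand for the growth of weights.\<close>

definition ratio :: real where
  "ratio = 1 + 3 * real (card levels) + 2 * (limit (length \<sigma>) + 2) * ln (3 * real (card V) + 1)"

lemma ratio_ge: "1 \<le> ratio"
  using limit_ge[of "length \<sigma>"] by (simp add: ratio_def)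

lemma expected_event_sum:
  assumes ne: "\<sigma> \<noteq> []"
  shows "(\<integral>\<^sup>+t. ennreal (event_sum t) \<partial>measure_pmf (run (length \<sigma>))) \<le> offline_penalty + ennreal (cost * ratio)"
proof -
  let ?M = "measure_pmf (run (length \<sigma>))"
  let ?c = "1 + real (card levels) + 2 * (limit (length \<sigma>) + 2) * ln (3 * real (card V) + 1)"
  have c: "0 \<le> cost * ?c" using cost_nonneg limit_ge[of "length \<sigma>"] by (intro mult_nonneg_nonneg add_nonneg_nonneg) auto
  have "(\<integral>\<^sup>+t. ennreal (event_sum t) \<partial>?M) \<le> (\<integral>\<^sup>+t. ennreal (sum_where (\<lambda>e. fst e \<in> P) t) + ennreal (sum_where missed t) + ennreal (cost * ?c) \<partial>?M)"
  proof (rule nn_integral_pmf_mono)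
    fix t assume t: "t \<in> set_pmf (run (length \<sigma>))"
    have "ennreal (event_sum t) \<le> ennreal (sum_where (\<lambda>e. fst e \<in> P) t + sum_where missed t + cost * ?c)"
      by (rule ennreal_leI[OF event_sum_split[OF t ne]])
    also have "\<dots> = ennreal (sum_where (\<lambda>e. fst e \<in> P) t) + ennreal (sum_where missed t) + ennreal (cost * ?c)"
      by (simp only: ennreal_plus c sum_where_nonneg add_nonneg_nonneg)
    finally show "ennreal (event_sum t) \<le> \<dots>" .
  qed
  also have "\<dots> = (\<integral>\<^sup>+t. ennreal (sum_where (\<lambda>e. fst e \<in> P) t) \<partial>?M) + (\<integral>\<^sup>+t. ennreal (sum_where missed t) \<partial>?M) + ennreal (cost * ?c)"
    by (simp add: nn_integral_pmf_add measure_pmf.emeasure_space_1)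
  also have "\<dots> \<le> offline_penalty + ennreal (2 * real (card levels) * cost) + ennreal (cost * ?c)"
    using expected_unserved expected_missed[OF ne] by (intro add_mono) auto
  also have "\<dots> = offline_penalty + ennreal (cost * ratio)"
  proof -
    have "ennreal (2 * real (card levels) * cost) + ennreal (cost * ?c) = ennreal (cost * ratio)"
      using c cost_nonneg by (subst ennreal_plus[symmetric]) (auto simp: ratio_def algebra_simps)
    then show ?thesis by (simp add: add.assoc)
  qed
  finally show ?thesis .
qed

text \<open>\<open>expected_penalty\<close> replaces the penalties outside \<open>P\<close> by a
  second copy of the trunk, and \<open>expected_fac\<close> turns the sampled weight into event
  sums: 321 + 481 = 802 of these, plus one offline penalty for requests skipped by both.\<close>

lemma expected_total:
  assumes ne: "\<sigma> \<noteq> []"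
  shows "(\<integral>\<^sup>+t. ennreal (sum w (solution G t)) + (\<Sum>i\<in>skipped t. penalty (\<sigma> ! i))
      \<partial>measure_pmf (chain (transition G w) initial \<sigma>))
    \<le> ennreal (803 * ratio) * (ennreal cost + offline_penalty)"
proof -
  let ?M = "measure_pmf (chain (transition G w) initial \<sigma>)"
  let ?E = "\<integral>\<^sup>+t. ennreal (event_sum t) \<partial>?M"
  have skip: "(\<Sum>i\<in>skipped t. penalty (\<sigma> ! i)) \<le> (\<Sum>i\<in>skipped t - P. penalty (\<sigma> ! i)) + offline_penalty"
    if t: "t \<in> set_pmf (chain (transition G w) initial \<sigma>)" for t
  proof -
    have fin: "finite (skipped t)" using chain_skipped[OF t] finite_subset by blast
    have "(\<Sum>i\<in>skipped t. penalty (\<sigma> ! i)) = (\<Sum>i\<in>skipped t - P. penalty (\<sigma> ! i)) + (\<Sum>i\<in>skipped t \<inter> P. penalty (\<sigma> ! i))"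
      using sum.Int_Diff[OF fin, of _ P] by (simp add: add.commute)
    also have "(\<Sum>i\<in>skipped t \<inter> P. penalty (\<sigma> ! i)) \<le> offline_penalty"
      unfolding offline_penalty_def by (intro sum_mono2 finite_P) auto
    finally show ?thesis by (simp add: add_left_mono)
  qed
  have "(\<integral>\<^sup>+t. ennreal (sum w (solution G t)) + (\<Sum>i\<in>skipped t. penalty (\<sigma> ! i)) \<partial>?M)
    \<le> (\<integral>\<^sup>+t. ennreal (sum w (solution G t)) + ((\<Sum>i\<in>skipped t - P. penalty (\<sigma> ! i)) + offline_penalty) \<partial>?M)"
    using skip by (intro nn_integral_pmf_mono add_left_mono)
  also have "\<dots> = (\<integral>\<^sup>+t. ennreal (sum w (solution G t)) \<partial>?M) + (\<integral>\<^sup>+t. (\<Sum>i\<in>skipped t - P. penalty (\<sigma> ! i)) \<partial>?M) + offline_penalty"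
    by (simp add: nn_integral_pmf_add measure_pmf.emeasure_space_1 add.assoc)
  also have "\<dots> \<le> (\<integral>\<^sup>+t. ennreal (sum w (solution G t)) \<partial>?M) + (\<integral>\<^sup>+t. ennreal (sum w (trunk t)) \<partial>?M) + offline_penalty"
    by (intro add_mono expected_penalty order_refl)
  also have "\<dots> = (\<integral>\<^sup>+t. ennreal (sum w (solution G t)) + ennreal (sum w (trunk t)) \<partial>?M) + offline_penalty"
    by (simp add: nn_integral_pmf_add)
  also have "\<dots> \<le> (\<integral>\<^sup>+t. 321 * ennreal (sum w (fac t)) + 481 * ennreal (event_sum t) \<partial>?M) + offline_penalty"
  proof (intro add_right_mono nn_integral_pmf_mono)
    fix t assume t: "t \<in> set_pmf (chain (transition G w) initial \<sigma>)"
    have inv: "invariant 0 t" by (rule chain_invariant[OF t])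
    then have sane: "sane t" by (simp add: invariant_def)
    have nn: "0 \<le> sum w (solution G t)" "0 \<le> sum w (trunk t)" "0 \<le> sum w (fac t)"
      using sane solution_subset[OF sane] by (auto intro!: sum_w_nonneg simp: sane_def)
    have "ennreal (sum w (solution G t)) + ennreal (sum w (trunk t)) = ennreal (sum w (solution G t) + sum w (trunk t))"
      using nn by simp
    also have "\<dots> \<le> ennreal (321 * sum w (fac t) + 481 * event_sum t)"
      by (rule ennreal_leI[OF solution_cost_bound[OF inv]])
    also have "\<dots> = 321 * ennreal (sum w (fac t)) + 481 * ennreal (event_sum t)"
      using nn event_sum_nonneg[of t] by (simp add: ennreal_plus ennreal_mult)
    finally show "ennreal (sum w (solution G t)) + ennreal (sum w (trunk t)) \<le> 321 * ennreal (sum w (fac t)) + 481 * ennreal (event_sum t)" .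
  qed
  also have "\<dots> = 321 * (\<integral>\<^sup>+t. ennreal (sum w (fac t)) \<partial>?M) + 481 * ?E + offline_penalty"
    by (simp add: nn_integral_pmf_add nn_integral_cmult)
  also have "\<dots> \<le> 321 * ?E + 481 * ?E + offline_penalty"
    by (intro add_mono mult_left_mono expected_fac) auto
  also have "\<dots> = 802 * ?E + offline_penalty" by (simp flip: distrib_right)
  also have "\<dots> \<le> 802 * (offline_penalty + ennreal (cost * ratio)) + offline_penalty"
    using expected_event_sum[OF ne] by (intro add_mono mult_left_mono) auto
  also have "\<dots> = 803 * offline_penalty + 802 * ennreal (cost * ratio)"
  proof -
    have "803 * offline_penalty = 802 * offline_penalty + 1 * offline_penalty"
      unfolding distrib_right[symmetric] by simp
    then show ?thesis by (simp add: distrib_left add_ac)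
  qed
  also have "\<dots> \<le> ennreal (803 * ratio) * offline_penalty + ennreal (803 * ratio) * ennreal cost"
  proof (intro add_mono mult_right_mono)
    have "ennreal 803 \<le> ennreal (803 * ratio)" using ratio_ge by (intro ennreal_leI) simp
    then show "803 \<le> ennreal (803 * ratio)" by simp
    have "802 * (cost * ratio) \<le> (803 * ratio) * cost" using cost_nonneg ratio_ge by (simp add: mult_ac mult_mono)
    then have "ennreal (802 * (cost * ratio)) \<le> ennreal ((803 * ratio) * cost)" by (rule ennreal_leI)
    then show "802 * ennreal (cost * ratio) \<le> ennreal (803 * ratio) * ennreal cost"
      using cost_nonneg ratio_ge by (simp add: ennreal_mult)
  qed simp
  also have "\<dots> = ennreal (803 * ratio) * (ennreal cost + offline_penalty)"
    by (simp add: distrib_left add.commute)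
  finally show ?thesis .
qed

text \<open>With a = ln (k + 1) and b = ln (n + 1), both at least 1 / 2, the ratio is at most 4 + 6
  a + 48 a b. Since 1 <= 4 a b and a <= 2 a b, this is at most (16 + 12 + 48) a b.\<close>

lemma ratio_le:
  assumes ne: "\<sigma> \<noteq> []"
  shows "ratio \<le> 76 * ln (real (length \<sigma>) + 1) * ln (real (card V) + 1)"
proof -
  define k where "k = real (length \<sigma>)"
  define n where "n = real (card V)"
  define a where "a = ln (k + 1)"
  define b where "b = ln (n + 1)"
  have "V \<noteq> {}"
    using valid ne by (cases \<sigma>) (auto simp: valid_requests_def)
  then have "0 < card V" by (simp add: card_gt_0_iff)
  then have n1: "1 \<le> n" by (simp add: n_def Suc_leI)
  have k1: "1 \<le> k" using ne by (cases \<sigma>) (auto simp: k_def)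
  have l2: "1 / 2 \<le> ln (2::real)" using ln2_ge_two_thirds by simp
  have "ln 2 \<le> a" "ln 2 \<le> b" using n1 k1 by (auto simp: a_def b_def)
  then have a: "1 \<le> 2 * a" and b: "1 \<le> 2 * b" using l2 by linarith+
  have ab: "1 \<le> 4 * (a * b)" using mult_mono[OF a b] a b by simp
  have aab: "a \<le> 2 * (a * b)" using mult_left_mono[OF b, of a] a by simp
  have "log 2 k \<le> 2 * a"
  proof -
    have "ln k \<le> a" using k1 by (simp add: a_def)
    also have "a \<le> 2 * a * ln 2" using mult_left_mono[OF l2, of "2 * a"] a by simp
    finally show ?thesis using l2 by (simp add: log_def field_simps)
  qed
  then have c: "real (card levels) \<le> 2 * a + 1" using levels_card[OF ne] by (simp add: k_def)
  have l: "limit (length \<sigma>) \<le> 4 * a"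
  proof -
    have "k + 2 \<le> (k + 1)\<^sup>2" using k1 by (simp add: power2_eq_square algebra_simps add_increasing2)
    then have "ln (k + 2) \<le> ln ((k + 1)\<^sup>2)" using k1 by (subst ln_le_cancel_iff) auto
    also have "\<dots> = 2 * a" using k1 by (simp add: a_def ln_realpow)
    finally show ?thesis by (simp add: limit_def k_def)
  qed
  have m: "ln (3 * n + 1) \<le> 3 * b" "0 \<le> ln (3 * n + 1)"
  proof -
    have "3 * n + 1 \<le> (n + 1) ^ 3" using n1 by (simp add: power3_eq_cube algebra_simps add_increasing)
    then have "ln (3 * n + 1) \<le> ln ((n + 1) ^ 3)" using n1 by (subst ln_le_cancel_iff) auto
    also have "\<dots> = 3 * b" using n1 by (simp add: b_def ln_realpow)
    finally show "ln (3 * n + 1) \<le> 3 * b" .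
    show "0 \<le> ln (3 * n + 1)" using n1 by simp
  qed
  have l16: "2 * (limit (length \<sigma>) + 2) \<le> 16 * a" using l a by simp
  have "2 * (limit (length \<sigma>) + 2) * ln (3 * n + 1) \<le> (16 * a) * (3 * b)"
    by (rule mult_mono[OF l16 m(1)]) (use m(2) a in auto)
  also have "\<dots> = 48 * (a * b)" by simp
  finally have "ratio \<le> 4 + 6 * a + 48 * (a * b)"
    using c unfolding ratio_def n_def[symmetric] by linarith
  also have "\<dots> \<le> 76 * (a * b)" using ab aab by linarith
  finally show ?thesis unfolding a_def b_def k_def n_def by (simp add: mult.assoc)
qed

end

section \<open>The online strategy, its cost and the competitive ratio\<close>

lemma Inf_attained:
  fixes f :: "'a \<Rightarrow> 'b \<Rightarrow> 'c :: complete_linorder"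
  assumes "finite {(x, y). Q x y}" "Q a b"
  shows "\<exists>x y. Q x y \<and> Inf {f x y | x y. Q x y} = f x y"
proof -
  let ?B = "(\<lambda>(x, y). f x y) ` {(x, y). Q x y}"
  have A: "{f x y | x y. Q x y} = ?B" by auto
  have B: "finite ?B" "?B \<noteq> {}" using assms by auto
  have "Inf ?B \<in> ?B" unfolding Min_Inf[OF B, symmetric] by (rule Min_in[OF B])
  then show ?thesis unfolding A by (auto simp: image_iff)
qed

text \<open>The strategy keeps no state of its own: it replays the whole history with the same seed
  and returns the last answer.\<close>

definition algorithm :: "(nat \<Rightarrow> real, 'v, 'e) online_algorithm" where
  "algorithm \<omega> G w \<sigma> = resp (seeded (transition G w) initial \<sigma> \<omega>)"

context node_weighted begin

lemma seeded_reachable: "seeded (transition G w) initial \<sigma> \<omega> \<in> set_pmf (chain (transition G w) initial \<sigma>)"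
  by (rule seeded_in_chain[OF finite_set_transition])

lemma seeded_step:
  "seeded (transition G w) initial (\<sigma> @ [r]) \<omega> \<in> set_pmf (transition G w (seeded (transition G w) initial \<sigma> \<omega>) r)"
  unfolding seeded_snoc by (rule sampler(2)[OF finite_set_transition])

text \<open>A response is the entire current solution, solutions only grow when a request is served,
  and a skipped request leaves the solution unchanged.\<close>

lemma bought_algorithm:
  "bought (algorithm \<omega> G w) \<sigma> = solution G (seeded (transition G w) initial \<sigma> \<omega>)"
proof (induction \<sigma> rule: rev_induct)
  case Nil
  then show ?case by (simp add: bought_def solution_def facilities_def initial_def)
next
  case (snoc r \<sigma>)
  obtain a b p where r: "r = (a, b, p)" by (cases r)
  let ?s = "seeded (transition G w) initial \<sigma> \<omega>" and ?t = "seeded (transition G w) initial (\<sigma> @ [r]) \<omega>"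
  have sane: "sane ?s" using chain_invariant[OF seeded_reachable, of 0] by (simp add: invariant_def)
  have b: "bought (algorithm \<omega> G w) (\<sigma> @ [r]) = bought (algorithm \<omega> G w) \<sigma> \<union>
      (case resp ?t of None \<Rightarrow> {} | Some X \<Rightarrow> X)"
    by (simp add: bought_def lessThan_Suc algorithm_def Un_commute)
  have "?t \<in> set_pmf (transition G w ?s (a, b, p))" using seeded_step[of \<sigma> r \<omega>] by (simp add: r)
  then show ?case
  proof (cases rule: transition_cases)
    case skip
    then show ?thesis unfolding b snoc.IH by simp
  next
    case (join c)
    show ?thesis unfolding b snoc.IH join(3) using connect_solution(1)[OF sane join(1), of c] by auto
  qed
qed

lemma paid_algorithm:
  "paid (algorithm \<omega> G w) \<sigma> = (\<Sum>i\<in>skipped (seeded (transition G w) initial \<sigma> \<omega>). penalty (\<sigma> ! i))"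
proof (induction \<sigma> rule: rev_induct)
  case Nil
  then show ?case by (simp add: paid_def initial_def)
next
  case (snoc r \<sigma>)
  obtain a b p where r: "r = (a, b, p)" by (cases r)
  let ?s = "seeded (transition G w) initial \<sigma> \<omega>" and ?t = "seeded (transition G w) initial (\<sigma> @ [r]) \<omega>"
  have sk: "skipped ?s \<subseteq> {..<length \<sigma>}" by (rule chain_skipped[OF seeded_reachable])
  have clk: "clock ?s = length \<sigma>" by (rule chain_clock[OF seeded_reachable])
  have p: "paid (algorithm \<omega> G w) (\<sigma> @ [r]) = paid (algorithm \<omega> G w) \<sigma> +
      (case resp ?t of None \<Rightarrow> penalty r | Some X \<Rightarrow> 0)"
    by (simp add: paid_def lessThan_Suc algorithm_def add.commute nth_append cong: option.case_cong)
  have old: "(\<Sum>i\<in>skipped ?s. penalty ((\<sigma> @ [r]) ! i)) = (\<Sum>i\<in>skipped ?s. penalty (\<sigma> ! i))"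
    using sk by (intro sum.cong) (auto simp: nth_append)
  have "?t \<in> set_pmf (transition G w ?s (a, b, p))" using seeded_step[of \<sigma> r \<omega>] by (simp add: r)
  then show ?case
  proof (cases rule: transition_cases)
    case skip
    have "finite (skipped ?s)" "length \<sigma> \<notin> skipped ?s" using sk finite_subset by auto
    then show ?thesis unfolding p snoc.IH skip using old by (simp add: clk add.commute)
  next
    case (join c)
    have "skipped (connect G w ?s a b c) = skipped ?s" by (simp add: connect_def Let_def split: action.split)
    then show ?thesis unfolding p snoc.IH join(3) using old by simp
  qed
qed

lemma algorithm_feasible: "feasible_strategy G (algorithm \<omega> G w)"
  unfolding feasible_strategy_def
proof (intro allI impI)
  fix \<sigma> X assume a: "\<sigma> \<noteq> [] \<and> valid_requests G \<sigma> \<and> algorithm \<omega> G w \<sigma> = Some X"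
  then obtain \<tau> r where \<sigma>: "\<sigma> = \<tau> @ [r]" by (metis rev_exhaust)
  obtain a b p where r: "r = (a, b, p)" by (cases r)
  let ?s = "seeded (transition G w) initial \<tau> \<omega>" and ?t = "seeded (transition G w) initial \<sigma> \<omega>"
  have sane: "sane ?s" "sane ?t" using chain_invariant[OF seeded_reachable, of 0] by (auto simp: invariant_def)
  have X: "resp ?t = Some X" using a by (simp add: algorithm_def)
  have "?t \<in> set_pmf (transition G w ?s (a, b, p))" using seeded_step[of \<tau> r \<omega>] by (simp add: r \<sigma>)
  then show "X \<subseteq> V \<and> connects G (bought (algorithm \<omega> G w) \<sigma>) (last \<sigma>)"
  proof (cases rule: transition_cases)
    case skip
    then show ?thesis using X by simp
  next
    case (join c)
    have sol: "solution G ?t = solution G (connect G w ?s a b c)" by (simp add: join(3))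
    have "solution G ?t \<in> links G a b"
      using connect_solution(2)[OF sane(1) join(1), of c] solution_subset[OF sane(2)] unfolding sol by simp
    moreover have "X = solution G ?t" using X unfolding sol by (simp add: join(3))
    ultimately show ?thesis
      unfolding bought_algorithm by (simp add: \<sigma> r connects_def links_def)
  qed
qed

lemma algorithm_measurable: "(\<lambda>\<omega>. algorithm \<omega> G w \<sigma>) \<in> seeds \<rightarrow>\<^sub>M count_space UNIV"
  unfolding algorithm_def
  by (rule measurable_compose[OF conjunct1[OF seeded_measurable_distr[OF finite_set_transition]]]) simp

lemma opt_attained:
  obtains S P where "S \<subseteq> V" "P \<subseteq> {..<length \<sigma>}" "\<forall>i\<in>{..<length \<sigma>} - P. connects G S (\<sigma> ! i)"
    "opt G w \<sigma> = node_cost w S + (\<Sum>i\<in>P. penalty (\<sigma> ! i))"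
proof -
  let ?Q = "\<lambda>S P. S \<subseteq> V \<and> P \<subseteq> {..<length \<sigma>} \<and> (\<forall>i\<in>{..<length \<sigma>} - P. connects G S (\<sigma> ! i))"
  have "{(S, P). ?Q S P} \<subseteq> Pow V \<times> Pow {..<length \<sigma>}" by blast
  then have fin: "finite {(S, P). ?Q S P}" by (rule finite_subset) simp
  have "?Q {} {..<length \<sigma>}" by simp
  from Inf_attained[of ?Q, OF fin this, of "\<lambda>S P. node_cost w S + (\<Sum>i\<in>P. penalty (\<sigma> ! i))"]
  obtain S P where "?Q S P" "opt G w \<sigma> = node_cost w S + (\<Sum>i\<in>P. penalty (\<sigma> ! i))"
    unfolding opt_def by metis
  then show thesis using that by blast
qed

text \<open>An optimal offline pair exists by finiteness and is fixed before the expectation is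
  taken. The constant is 803 * 76.\<close>

lemma algorithm_competitive:
  assumes valid: "valid_requests G \<sigma>"
  shows "(\<integral>\<^sup>+\<omega>. alg_cost w (algorithm \<omega> G w) \<sigma> \<partial>seeds)
    \<le> ennreal (61028 * ln (real (length \<sigma>) + 1) * ln (real (card V) + 1)) * opt G w \<sigma>"
proof (cases "\<sigma> = []")
  \<comment> \<open>Without requests the claimed ratio is 0, because \<open>ln 1 = 0\<close>, but
    the algorithm has no cost either.\<close>
  case True
  then show ?thesis by (simp add: alg_cost_def bought_def paid_def node_cost_def)
next
  case ne: False
  obtain S P where SP: "S \<subseteq> V" "P \<subseteq> {..<length \<sigma>}" "\<forall>i\<in>{..<length \<sigma>} - P. connects G S (\<sigma> ! i)"
    and opt: "opt G w \<sigma> = node_cost w S + (\<Sum>i\<in>P. penalty (\<sigma> ! i))"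
    by (rule opt_attained)
  interpret offline G w \<sigma> S P
    using valid SP by unfold_locales auto
  have "(\<integral>\<^sup>+\<omega>. alg_cost w (algorithm \<omega> G w) \<sigma> \<partial>seeds)
    = (\<integral>\<^sup>+t. ennreal (sum w (solution G t)) + (\<Sum>i\<in>skipped t. penalty (\<sigma> ! i)) \<partial>measure_pmf (chain (transition G w) initial \<sigma>))"
    unfolding alg_cost_def bought_algorithm paid_algorithm node_cost_def
    by (rule nn_integral_seeded[OF finite_set_transition])
  also have "\<dots> \<le> ennreal (803 * ratio) * opt G w \<sigma>"
    using expected_total[OF ne] unfolding opt node_cost_def offline_penalty_def .
  also have "\<dots> \<le> ennreal (61028 * ln (real (length \<sigma>) + 1) * ln (real (card V) + 1)) * opt G w \<sigma>"
    using ratio_le[OF ne] by (intro mult_right_mono ennreal_leI) auto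
  finally show ?thesis .
qed

end

theorem theorem1:
  shows "\<exists>C > 0. \<exists>(M :: (nat \<Rightarrow> real) measure) (A :: (nat \<Rightarrow> real, 'v, 'e) online_algorithm).
           randomized_online_algorithm M A \<and>
           competitive M A (\<lambda>k n. C * ln (real k + 1) * ln (real n + 1))"
proof (intro exI conjI)
  show "randomized_online_algorithm seeds (algorithm :: (nat \<Rightarrow> real, 'v, 'e) online_algorithm)"
    unfolding randomized_online_algorithm_def
  proof (intro conjI allI impI ballI)
    show "prob_space seeds" by (rule prob_space_seeds)
    fix G :: "('v, 'e) pre_digraph" and w :: "'v \<Rightarrow> real"
    assume "node_weighted_graph G w"
    then interpret node_weighted G w by unfold_locales
    show "feasible_strategy G (algorithm \<omega> G w)" for \<omega> by (rule algorithm_feasible)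
    show "(\<lambda>\<omega>. algorithm \<omega> G w \<sigma>) \<in> seeds \<rightarrow>\<^sub>M count_space UNIV" for \<sigma> by (rule algorithm_measurable)
  qed
  show "competitive seeds (algorithm :: (nat \<Rightarrow> real, 'v, 'e) online_algorithm)
      (\<lambda>k n. 61028 * ln (real k + 1) * ln (real n + 1))"
    unfolding competitive_def
  proof (intro allI impI)
    fix G :: "('v, 'e) pre_digraph" and w :: "'v \<Rightarrow> real" and \<sigma>
    assume a: "node_weighted_graph G w \<and> valid_requests G \<sigma>"
    then interpret node_weighted G w by unfold_locales simp
    show "(\<integral>\<^sup>+\<omega>. alg_cost w (algorithm \<omega> G w) \<sigma> \<partial>seeds)
        \<le> ennreal (61028 * ln (real (length \<sigma>) + 1) * ln (real (card (verts G)) + 1)) * opt G w \<sigma>"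
      by (rule algorithm_competitive) (use a in simp)
  qed
qed simp

end
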